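(* Let $m=2$ and let $n\ge 6$ be any integer. Then there exists a uniformly elliptic (fourth order) operator $L$ on $\mathbb{R}^n$ with constant coefficients such that the corresponding fundamental solution $K_L$ is sign changing for $|x-y|\to 0$.
   Context: Operators: $L=(-1)^m Q\left(\frac{\partial}{\partial x_1},\dots,\frac{\partial}{\partial x_n}\right)$, where $Q(\xi)=\sum_{i_1,\dots,i_{2m}=1}^n A_{i_1,\dots,i_{2m}}\xi_{i_1}\cdots\xi_{i_{2m}}$ is a real $2m$-homogeneous polynomial on $\mathbb{R}^n$ with constant coefficients, called the symbol of $L$. $L$ is uniformly elliptic if there is $\lambda>0$ with $Q(\xi)\ge\lambda|\xi|^{2m}$ for all $\xi\in\mathbb{R}^n$. Fundamental solution: for $n>2m$, $K_L$ denotes John's fundamental solution of $L$, i.e. for $x\neq y$ in $\mathbb{R}^n$ $$K_L(x,y)=-\frac{1}{4(2\pi)^{n-1}}(-\Delta_y)^{\frac{n+1-2m}{2}}\int_{|\xi|=1}\frac{|(x-y)\cdot\xi|}{Q(\xi)}\,d\mathcal{H}^{n-1}(\xi)\quad (n\text{ odd}),$$ $$K_L(x,y)=-\frac{1}{(2\pi)^{n}}(-\Delta_y)^{\frac{n-2m}{2}}\int_{|\xi|=1}\frac{\log|(x-y)\cdot\xi|}{Q(\xi)}\,d\mathcal{H}^{n-1}(\xi)\quad (n\text{ even}).$$ It satisfies $\int_{\mathbb{R}^n}K_L(x,y)L\psi(y)\,dy=\psi(x)$ for all $\psi\in C_0^\infty(\mathbb{R}^n)$, depends only on $x-y$, and is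 even in $x-y$. $\mathcal{H}^{k}$ is the $k$-dimensional Hausdorff measure. "$K_L$ is sign changing for $|x-y|\to0$" means that $K_L$ takes both positive and negative values in every neighbourhood of its pole, i.e. for every $r>0$ there are points with $0<|x-y|<r$ where $K_L(x,y)>0$ and points with $0<|x-y|<r$ where $K_L(x,y)<0$. *)

theory Defs
  imports "HOL-Analysis.Analysis"
begin

section \<open>Hausdorff measure\<close>

text \<open>
  Federer's normalisation: on an \<open>n\<close>-dimensional Euclidean space the \<open>n\<close>-dimensional Hausdorff
  measure is Lebesgue measure.  Empty sets get weight 0 explicitly because \<open>0 ^ 0 = 1\<close>;
  boundedness is required explicitly because \<^const>\<open>diameter\<close> is unspecified on unbounded sets.
\<close>

definition hausdorff_content :: "nat \<Rightarrow> real \<Rightarrow> 'a::metric_space set \<Rightarrow> ennreal" where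
  "hausdorff_content k \<delta> A =
     (INF C \<in> {C :: nat \<Rightarrow> 'a set. A \<subseteq> (\<Union>j. C j) \<and> (\<forall>j. bounded (C j) \<and> diameter (C j) \<le> \<delta>)}.
        \<Sum>j. if C j = {} then 0 else ennreal (unit_ball_vol (real k) * (diameter (C j) / 2) ^ k))"

definition hausdorff_outer :: "nat \<Rightarrow> 'a::metric_space set \<Rightarrow> ennreal" where
  "hausdorff_outer k A = (SUP \<delta>\<in>{0<..}. hausdorff_content k \<delta> A)"

definition hausdorff_measure :: "nat \<Rightarrow> 'a::metric_space measure" where
  "hausdorff_measure k = measure_of UNIV (sets borel) (hausdorff_outer k)"

text \<open>
  \<^const>\<open>measure_of\<close> yields the zero measure unless the given function is countably additive on
  the given sets.  The following lemmas, up to \<open>emeasure_hausdorff_measure\<close>, show that it is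
  (Caratheodory's criterion for metric outer measures).
\<close>

definition hausdorff_gauge :: "nat \<Rightarrow> real \<Rightarrow> 'a::metric_space set \<Rightarrow> ennreal" where
  "hausdorff_gauge k \<delta> C =
     (if C = {} then 0
      else if bounded C \<and> diameter C \<le> \<delta> then ennreal (unit_ball_vol (real k) * (diameter C / 2) ^ k)
      else top)"

lemma hausdorff_gauge_mono:
  assumes "C \<subseteq> D" shows "hausdorff_gauge k \<delta> C \<le> hausdorff_gauge k \<delta> D"
proof -
  have "bounded C \<and> diameter C \<le> diameter D \<and> 0 \<le> diameter C" if "bounded D"
    using that assms bounded_subset diameter_subset diameter_ge_0 by blast
  then show ?thesis
    using assms
    by (auto simp: hausdorff_gauge_def intro!: ennreal_leI mult_left_mono power_mono)
qed

lemma positive_hausdorff_gauge: "positive (Pow UNIV) (hausdorff_gauge k \<delta>)"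
  and increasing_hausdorff_gauge: "increasing (Pow UNIV) (hausdorff_gauge k \<delta>)"
  by (auto simp: positive_def increasing_def hausdorff_gauge_mono)
     (simp add: hausdorff_gauge_def)

lemma hausdorff_content_eq_outer_measure:
  assumes "\<delta> > 0"
  shows "hausdorff_content k \<delta> A = outer_measure (Pow UNIV) (hausdorff_gauge k \<delta>) A"
proof (rule antisym)
  interpret sigma_algebra UNIV "Pow UNIV :: 'a set set" by (rule sigma_algebra_Pow)
  show "outer_measure (Pow UNIV) (hausdorff_gauge k \<delta>) A \<le> hausdorff_content k \<delta> A"
    unfolding hausdorff_content_def
  proof (rule INF_greatest)
    fix C :: "nat \<Rightarrow> 'a set"
    assume C: "C \<in> {C. A \<subseteq> (\<Union>j. C j) \<and> (\<forall>j. bounded (C j) \<and> diameter (C j) \<le> \<delta>)}"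
    then have "outer_measure (Pow UNIV) (hausdorff_gauge k \<delta>) A \<le> (\<Sum>j. hausdorff_gauge k \<delta> (C j))"
      by (intro outer_measure_le positive_hausdorff_gauge increasing_hausdorff_gauge) auto
    also have "\<dots> = (\<Sum>j. if C j = {} then 0 else ennreal (unit_ball_vol (real k) * (diameter (C j) / 2) ^ k))"
      using C by (intro suminf_cong) (auto simp: hausdorff_gauge_def)
    finally show "outer_measure (Pow UNIV) (hausdorff_gauge k \<delta>) A \<le> \<dots>" .
  qed
  show "hausdorff_content k \<delta> A \<le> outer_measure (Pow UNIV) (hausdorff_gauge k \<delta>) A"
    unfolding outer_measure_def
  proof (rule INF_greatest)
    fix C :: "nat \<Rightarrow> 'a set"
    assume C: "C \<in> {C. range C \<subseteq> Pow UNIV \<and> disjoint_family C \<and> A \<subseteq> (\<Union>j. C j)}"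
    show "hausdorff_content k \<delta> A \<le> (\<Sum>j. hausdorff_gauge k \<delta> (C j))"
    proof (cases "\<forall>j. hausdorff_gauge k \<delta> (C j) \<noteq> top")
      case True
      then have *: "bounded (C j) \<and> diameter (C j) \<le> \<delta>" for j
        using assms by (cases "C j = {}") (auto simp: hausdorff_gauge_def split: if_splits dest!: spec[of _ j])
      then have "hausdorff_content k \<delta> A
          \<le> (\<Sum>j. if C j = {} then 0 else ennreal (unit_ball_vol (real k) * (diameter (C j) / 2) ^ k))"
        unfolding hausdorff_content_def using C by (intro INF_lower) auto
      also have "\<dots> = (\<Sum>j. hausdorff_gauge k \<delta> (C j))"
        using * by (intro suminf_cong) (auto simp: hausdorff_gauge_def)
      finally show ?thesis .
    next
      case False
      then obtain j where "hausdorff_gauge k \<delta> (C j) = top" by auto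
      then have "(\<Sum>j. hausdorff_gauge k \<delta> (C j)) = top"
        using sum_le_suminf[of "\<lambda>j. hausdorff_gauge k \<delta> (C j)" "{j}"] by (auto simp: top_unique)
      then show ?thesis by simp
    qed
  qed
qed

lemma hausdorff_content_mono: "A \<subseteq> B \<Longrightarrow> hausdorff_content k \<delta> A \<le> hausdorff_content k \<delta> B"
  unfolding hausdorff_content_def by (intro INF_superset_mono) auto

lemma hausdorff_content_antimono:
  "\<delta> \<le> \<epsilon> \<Longrightarrow> hausdorff_content k \<epsilon> A \<le> hausdorff_content k \<delta> A"
  unfolding hausdorff_content_def by (intro INF_superset_mono) (auto intro: order_trans)

lemma hausdorff_outer_mono: "A \<subseteq> B \<Longrightarrow> hausdorff_outer k A \<le> hausdorff_outer k B"
  unfolding hausdorff_outer_def by (intro SUP_mono) (auto intro: hausdorff_content_mono)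

lemma outer_measure_space_hausdorff_outer:
  "outer_measure_space (Pow UNIV) (hausdorff_outer k :: 'a::metric_space set \<Rightarrow> ennreal)"
proof -
  interpret sigma_algebra UNIV "Pow UNIV :: 'a set set" by (rule sigma_algebra_Pow)
  have om: "outer_measure_space (Pow UNIV) (hausdorff_content k \<delta> :: 'a set \<Rightarrow> ennreal)" if "\<delta> > 0" for \<delta>
    using that outer_measure_space_outer_measure[OF positive_hausdorff_gauge increasing_hausdorff_gauge, of k \<delta>]
    by (simp add: outer_measure_space_def positive_def increasing_def countably_subadditive_def
        hausdorff_content_eq_outer_measure)
  have "hausdorff_outer k ({} :: 'a set) = 0"
  proof -
    have "hausdorff_content k \<delta> ({} :: 'a set) = 0" if "\<delta> > 0" for \<delta>
      using om[OF that] by (auto simp: outer_measure_space_def positive_def)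
    then show ?thesis by (simp add: hausdorff_outer_def)
  qed
  moreover have "hausdorff_outer k (\<Union>i. A i) \<le> (\<Sum>i. hausdorff_outer k (A i))" if "disjoint_family A"
    for A :: "nat \<Rightarrow> 'a set"
    unfolding hausdorff_outer_def[of k "\<Union>i. A i"]
  proof (rule SUP_least)
    fix \<delta> :: real assume \<delta>: "\<delta> \<in> {0<..}"
    then have "hausdorff_content k \<delta> (\<Union>i. A i) \<le> (\<Sum>i. hausdorff_content k \<delta> (A i))"
      using om[of \<delta>] that by (auto simp: outer_measure_space_def countably_subadditive_def)
    also have "\<dots> \<le> (\<Sum>i. hausdorff_outer k (A i))"
      using \<delta> by (intro suminf_le allI) (auto simp: hausdorff_outer_def intro: SUP_upper)
    finally show "hausdorff_content k \<delta> (\<Union>i. A i) \<le> (\<Sum>i. hausdorff_outer k (A i))" .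
  qed
  ultimately show ?thesis
    by (auto simp: outer_measure_space_def positive_def increasing_def countably_subadditive_def
        hausdorff_outer_mono)
qed

lemma hausdorff_outer_empty [simp]: "hausdorff_outer k {} = 0"
  using outer_measure_space_hausdorff_outer by (auto simp: outer_measure_space_def positive_def)

lemma hausdorff_outer_UN_le:
  "hausdorff_outer k (\<Union>i. A i) \<le> (\<Sum>i. hausdorff_outer k (A i))" for A :: "nat \<Rightarrow> _"
proof -
  have "hausdorff_outer k (\<Union>i. A i) = hausdorff_outer k (\<Union>i. disjointed A i)"
    by (simp add: UN_disjointed_eq)
  also have "\<dots> \<le> (\<Sum>i. hausdorff_outer k (disjointed A i))"
    using outer_measure_space_hausdorff_outer[of k] disjoint_family_disjointed[of A]
    by (auto simp: outer_measure_space_def countably_subadditive_def)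
  also have "\<dots> \<le> (\<Sum>i. hausdorff_outer k (A i))"
    by (intro suminf_le allI hausdorff_outer_mono disjointed_subset) auto
  finally show ?thesis .
qed

lemma hausdorff_outer_Un_le: "hausdorff_outer k (A \<union> B) \<le> hausdorff_outer k A + hausdorff_outer k B"
proof -
  have "(\<Union>i. if i = 0 then A else if i = Suc 0 then B else {}) = A \<union> B"
    by (auto split: if_splits)
  then have "hausdorff_outer k (A \<union> B)
      \<le> (\<Sum>i. hausdorff_outer k (if i = 0 then A else if i = Suc 0 then B else {}))"
    using hausdorff_outer_UN_le[of k "\<lambda>i. if i = 0 then A else if i = Suc 0 then B else {}"] by simp
  also have "\<dots> = (\<Sum>i\<in>{0, Suc 0}. hausdorff_outer k (if i = 0 then A else if i = Suc 0 then B else {}))"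
    by (rule suminf_finite) auto
  finally show ?thesis by simp
qed

lemma hausdorff_outer_separated:
  assumes "\<eta> > 0" and sep: "\<And>x y. x \<in> A \<Longrightarrow> y \<in> B \<Longrightarrow> \<eta> \<le> dist x y"
  shows "hausdorff_outer k A + hausdorff_outer k B \<le> hausdorff_outer k (A \<union> B)"
proof -
  let ?h = "\<lambda>A \<delta>. hausdorff_content k \<delta> A"
  have *: "?h A \<delta> + ?h B \<delta> \<le> ?h (A \<union> B) \<delta>" if \<delta>: "0 < \<delta>" "\<delta> < \<eta>" for \<delta>
    unfolding hausdorff_content_def[of k \<delta> "A \<union> B"]
  proof (rule INF_greatest)
    fix C :: "nat \<Rightarrow> 'a set"
    assume C: "C \<in> {C. A \<union> B \<subseteq> (\<Union>j. C j) \<and> (\<forall>j. bounded (C j) \<and> diameter (C j) \<le> \<delta>)}"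
    interpret sigma_algebra UNIV "Pow UNIV :: 'a set set" by (rule sigma_algebra_Pow)
    let ?g = "hausdorff_gauge k \<delta>"
    have le: "?h S \<delta> \<le> (\<Sum>j. ?g (C j \<inter> S))" if "S \<subseteq> A \<union> B" for S
      using C that \<open>0 < \<delta>\<close> unfolding hausdorff_content_eq_outer_measure[OF \<open>0 < \<delta>\<close>]
      by (intro outer_measure_le positive_hausdorff_gauge increasing_hausdorff_gauge) auto
    have "C j \<inter> A = {} \<or> C j \<inter> B = {}" for j
    proof (rule ccontr)
      assume "\<not> ?thesis"
      then obtain x y where xy: "x \<in> C j" "x \<in> A" "y \<in> C j" "y \<in> B" by blast
      then have "dist x y \<le> diameter (C j)"
        using C by (intro diameter_bounded_bound) auto
      moreover have "diameter (C j) \<le> \<delta>" using C by auto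
      moreover have "\<eta> \<le> dist x y" using sep xy by blast
      ultimately show False using \<delta> by linarith
    qed
    then have g: "?g (C j \<inter> A) + ?g (C j \<inter> B) \<le> ?g (C j)" for j
      using hausdorff_gauge_mono[of "C j \<inter> A" "C j" k \<delta>] hausdorff_gauge_mono[of "C j \<inter> B" "C j" k \<delta>]
      by (metis Int_lower1 add.left_neutral add.right_neutral hausdorff_gauge_def)
    have "?h A \<delta> + ?h B \<delta> \<le> (\<Sum>j. ?g (C j \<inter> A)) + (\<Sum>j. ?g (C j \<inter> B))"
      by (intro add_mono le) auto
    also have "\<dots> = (\<Sum>j. ?g (C j \<inter> A) + ?g (C j \<inter> B))"
      by (rule suminf_add) auto
    also have "\<dots> \<le> (\<Sum>j. ?g (C j))"
      by (intro suminf_le g) auto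
    also have "\<dots> = (\<Sum>j. if C j = {} then 0 else ennreal (unit_ball_vol (real k) * (diameter (C j) / 2) ^ k))"
      using C by (intro suminf_cong) (auto simp: hausdorff_gauge_def)
    finally show "?h A \<delta> + ?h B \<delta> \<le> \<dots>" .
  qed
  have outer: "hausdorff_outer k S = (SUP n. ?h S (\<eta> / real (n + 2)))" for S :: "'a set"
  proof (rule antisym)
    show "hausdorff_outer k S \<le> (SUP n. ?h S (\<eta> / real (n + 2)))"
      unfolding hausdorff_outer_def
    proof (rule SUP_mono)
      fix \<delta> :: real assume "\<delta> \<in> {0<..}"
      then have "0 < \<delta>" by simp
      obtain n where "\<eta> / \<delta> < real n" using reals_Archimedean2 by blast
      then have "\<eta> < real n * \<delta>" using \<open>0 < \<delta>\<close> by (simp add: field_simps)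
      also have "\<dots> \<le> real (n + 2) * \<delta>" using \<open>0 < \<delta>\<close> by simp
      finally have "\<eta> / real (n + 2) \<le> \<delta>" by (simp add: field_simps)
      then show "\<exists>n\<in>UNIV. ?h S \<delta> \<le> ?h S (\<eta> / real (n + 2))"
        by (intro bexI[of _ n] hausdorff_content_antimono) auto
    qed
    show "(SUP n. ?h S (\<eta> / real (n + 2))) \<le> hausdorff_outer k S"
      unfolding hausdorff_outer_def using \<open>\<eta> > 0\<close> by (intro SUP_mono) (auto simp: field_simps)
  qed
  have inc: "incseq (\<lambda>n. ?h S (\<eta> / real (n + 2)))" for S :: "'a set"
    using \<open>\<eta> > 0\<close>
    by (intro incseq_SucI hausdorff_content_antimono) (simp add: field_simps)
  have "hausdorff_outer k A + hausdorff_outer k B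
      = (SUP n. ?h A (\<eta> / real (n + 2)) + ?h B (\<eta> / real (n + 2)))"
    unfolding outer by (rule ennreal_SUP_add[symmetric]) (rule inc)+
  also have "\<dots> \<le> (SUP n. ?h (A \<union> B) (\<eta> / real (n + 2)))"
  proof (rule SUP_mono)
    show "\<exists>n'\<in>UNIV. ?h A (\<eta> / real (n + 2)) + ?h B (\<eta> / real (n + 2)) \<le> ?h (A \<union> B) (\<eta> / real (n' + 2))"
      for n
    proof (intro bexI[of _ n] * )
      show "\<eta> / real (n + 2) < \<eta>"
        using \<open>\<eta> > 0\<close> by (simp add: divide_less_eq)
    qed (use \<open>\<eta> > 0\<close> in auto)
  qed
  also have "\<dots> = hausdorff_outer k (A \<union> B)"
    by (rule outer[symmetric])
  finally show ?thesis .
qed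

lemma hausdorff_outer_closed_split:
  assumes F: "closed F"
  shows "hausdorff_outer k (X \<inter> F) + hausdorff_outer k (X - F) \<le> hausdorff_outer k X"
proof (cases "hausdorff_outer k X = top \<or> F = {}")
  case True
  then show ?thesis by auto
next
  case False
  let ?H = "hausdorff_outer k"
  have fin: "?H X < top" and "F \<noteq> {}" using False by (auto simp: less_top)
  define d where "d x = infdist x F" for x
  have lip: "d x \<le> d y + dist x y" for x y
    unfolding d_def by (rule infdist_triangle)
  define S where "S n = {x\<in>X. 1 / real (n + 1) \<le> d x}" for n
  define R where "R n = {x\<in>X. 1 / real (n + 2) \<le> d x \<and> d x < 1 / real (n + 1)}" for n
  have union: "X - F = S n \<union> (\<Union>i. R (i + n))" for n
  proof (intro equalityI subsetI)
    fix x assume x: "x \<in> X - F"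
    then have "0 < d x"
      using infdist_pos_not_in_closed[OF F \<open>F \<noteq> {}\<close>] by (auto simp: d_def)
    obtain m where "1 / d x < real m" using reals_Archimedean2 by blast
    then have ex: "1 / real (m + 1) \<le> d x"
      using \<open>0 < d x\<close> by (simp add: field_simps)
    define l where "l = (LEAST m. 1 / real (m + 1) \<le> d x)"
    have l: "1 / real (l + 1) \<le> d x" unfolding l_def using ex by (rule LeastI)
    show "x \<in> S n \<union> (\<Union>i. R (i + n))"
    proof (cases "l \<le> n")
      case True
      then have "1 / real (n + 1) \<le> 1 / real (l + 1)" by (simp add: field_simps)
      then show ?thesis using l x by (auto simp: S_def)
    next
      case False
      then obtain i where i: "l = Suc (i + n)"
        by (metis add.commute less_iff_Suc_add not_le)
      have "\<not> 1 / real (i + n + 1) \<le> d x"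
        using i not_less_Least[of "i + n" "\<lambda>m. 1 / real (m + 1) \<le> d x"] by (auto simp: l_def)
      then have "x \<in> R (i + n)"
        using l i x by (auto simp: R_def algebra_simps)
      then show ?thesis by blast
    qed
  next
    fix x assume "x \<in> S n \<union> (\<Union>i. R (i + n))"
    then have "x \<in> X" "0 < d x"
      by (auto simp: S_def R_def intro: less_le_trans[rotated])
    then show "x \<in> X - F" by (auto simp: d_def)
  qed
  have step: "?H (X \<inter> F) + ?H (S n) \<le> ?H X" for n
  proof -
    have "?H (X \<inter> F) + ?H (S n) \<le> ?H ((X \<inter> F) \<union> S n)"
    proof (rule hausdorff_outer_separated[of "1 / real (n + 1)"])
      fix x y assume "x \<in> X \<inter> F" "y \<in> S n"
      then show "1 / real (n + 1) \<le> dist x y"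
        using lip[of y x] by (auto simp: S_def d_def dist_commute)
    qed simp
    also have "\<dots> \<le> ?H X" by (rule hausdorff_outer_mono) (auto simp: S_def)
    finally show ?thesis .
  qed
  have alt: "(\<Sum>i<N. ?H (R (2 * i + p))) \<le> ?H (\<Union>i<N. R (2 * i + p))" for p N
  proof (induction N)
    case (Suc N)
    have "(\<Sum>i<Suc N. ?H (R (2 * i + p))) \<le> ?H (\<Union>i<N. R (2 * i + p)) + ?H (R (2 * N + p))"
      using Suc by (simp add: add_right_mono)
    also have "\<dots> \<le> ?H ((\<Union>i<N. R (2 * i + p)) \<union> R (2 * N + p))"
    proof (rule hausdorff_outer_separated[of "1 / (real (2 * N + p) + 1 / 2) - 1 / (real (2 * N + p) + 1)"])
      show "0 < 1 / (real (2 * N + p) + 1 / 2) - 1 / (real (2 * N + p) + 1)"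
        using frac_less2[of 1 1 "real (2 * N + p) + 1 / 2" "real (2 * N + p) + 1"] by simp
      fix x y assume "x \<in> (\<Union>i<N. R (2 * i + p))" and y: "y \<in> R (2 * N + p)"
      then obtain i where i: "i < N" "x \<in> R (2 * i + p)" by auto
      then have "1 / (real (2 * N + p) + 1 / 2) \<le> 1 / real (2 * i + p + 2)"
        by (intro divide_left_mono) (auto intro!: mult_pos_pos add_nonneg_pos)
      also have "\<dots> \<le> d x" using i by (auto simp: R_def)
      finally have "1 / (real (2 * N + p) + 1 / 2) \<le> d x" .
      moreover have "d y < 1 / (real (2 * N + p) + 1)"
        using y by (auto simp: R_def ac_simps)
      ultimately show "1 / (real (2 * N + p) + 1 / 2) - 1 / (real (2 * N + p) + 1) \<le> dist x y"
        using lip[of x y] by linarith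
    qed
    also have "\<dots> = ?H (\<Union>i<Suc N. R (2 * i + p))"
      by (simp add: lessThan_Suc Un_commute)
    finally show ?case .
  qed simp
  have sum_le: "(\<Sum>i. ?H (R (2 * i + p))) \<le> ?H X" for p
  proof (rule suminf_le_const)
    show "sum (\<lambda>i. ?H (R (2 * i + p))) {..<N} \<le> ?H X" for N
      using alt[of p N] hausdorff_outer_mono[of "\<Union>i<N. R (2 * i + p)" X k]
      by (auto simp: R_def intro: order_trans)
  qed simp
  have "(\<Sum>i. ?H (R i)) \<le> ?H X + ?H X"
  proof (rule suminf_le_const)
    fix N
    have "(\<Sum>i<N. ?H (R i)) \<le> (\<Sum>i<2 * N. ?H (R i))"
      by (intro sum_mono2) auto
    also have "\<dots> = (\<Sum>i<N. ?H (R (2 * i + 0))) + (\<Sum>i<N. ?H (R (2 * i + 1)))"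
      by (induction N) (auto simp: ac_simps)
    also have "\<dots> \<le> ?H X + ?H X"
      by (intro add_mono order_trans[OF sum_le_suminf sum_le]) auto
    finally show "sum (\<lambda>i. ?H (R i)) {..<N} \<le> ?H X + ?H X" .
  qed simp
  also have "\<dots> < top" using fin by simp
  finally have Rfin: "(\<Sum>i. ?H (R i)) < top" .
  have tail: "(\<lambda>n. \<Sum>i. ?H (R (i + n))) \<longlonglongrightarrow> 0"
  proof -
    have "?H (R i) < top" for i
      using ennreal_suminf_lessD[OF Rfin] .
    then have R_eq: "?H (R i) = ennreal (enn2real (?H (R i)))" for i
      by (simp add: less_top)
    have sm: "summable (\<lambda>i. enn2real (?H (R i)))"
      using Rfin by (intro summable_suminf_not_top) (auto simp: R_eq[symmetric])
    have "(\<lambda>n. \<Sum>i. enn2real (?H (R (i + n)))) \<longlonglongrightarrow> 0"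
      by (rule suminf_exist_split2[OF sm])
    then have "(\<lambda>n. ennreal (\<Sum>i. enn2real (?H (R (i + n))))) \<longlonglongrightarrow> ennreal 0"
      by (rule tendsto_ennrealI)
    moreover have "ennreal (\<Sum>i. enn2real (?H (R (i + n)))) = (\<Sum>i. ?H (R (i + n)))" for n
      using summable_ignore_initial_segment[OF sm, of n]
      by (subst suminf_ennreal2[symmetric]) (auto simp: R_eq[symmetric])
    ultimately show ?thesis by simp
  qed
  have "?H (X \<inter> F) + ?H (X - F) \<le> ?H X + (\<Sum>i. ?H (R (i + n)))" for n
  proof -
    have "?H (X - F) \<le> ?H (S n) + ?H (\<Union>i. R (i + n))"
      by (subst union[of n]) (rule hausdorff_outer_Un_le)
    also have "\<dots> \<le> ?H (S n) + (\<Sum>i. ?H (R (i + n)))"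
      by (intro add_left_mono hausdorff_outer_UN_le)
    finally have "?H (X \<inter> F) + ?H (X - F) \<le> (?H (X \<inter> F) + ?H (S n)) + (\<Sum>i. ?H (R (i + n)))"
      by (simp add: add.assoc add_left_mono)
    also have "\<dots> \<le> ?H X + (\<Sum>i. ?H (R (i + n)))"
      by (intro add_right_mono step)
    finally show ?thesis .
  qed
  moreover have "(\<lambda>n. ?H X + (\<Sum>i. ?H (R (i + n)))) \<longlonglongrightarrow> ?H X + 0"
    by (intro tendsto_add tendsto_const tail)
  ultimately show ?thesis
    by (intro LIMSEQ_le_const[where a = "?H (X \<inter> F) + ?H (X - F)"]) auto
qed

lemma space_hausdorff_measure [simp]: "space (hausdorff_measure k) = UNIV"
  and sets_hausdorff_measure [simp, measurable_cong]: "sets (hausdorff_measure k) = sets borel"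
  using sets.sigma_sets_eq[of borel] by (auto simp: hausdorff_measure_def)

lemma emeasure_hausdorff_measure:
  assumes "A \<in> sets borel"
  shows "emeasure (hausdorff_measure k) A = hausdorff_outer k A"
proof -
  interpret sigma_algebra UNIV "Pow UNIV :: 'a set set" by (rule sigma_algebra_Pow)
  let ?L = "lambda_system UNIV (Pow UNIV) (hausdorff_outer k :: 'a set \<Rightarrow> ennreal)"
  have ms: "measure_space UNIV ?L (hausdorff_outer k)"
    by (rule caratheodory_lemma[OF outer_measure_space_hausdorff_outer])
  have "Collect closed \<subseteq> ?L"
  proof safe
    fix F :: "'a set" assume "closed F"
    then have "hausdorff_outer k (X \<inter> F) + hausdorff_outer k (X - F) = hausdorff_outer k X" for X
      by (intro antisym[OF hausdorff_outer_closed_split])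
         (use hausdorff_outer_Un_le[of k "X \<inter> F" "X - F"] in \<open>simp_all add: Int_Diff_Un\<close>)
    then show "F \<in> ?L" unfolding lambda_system_eq by auto
  qed
  moreover have "sigma_algebra UNIV ?L" using ms by (simp add: measure_space_def)
  ultimately have "sets borel \<subseteq> ?L"
    unfolding borel_eq_closed by (simp add: sigma_algebra.sigma_sets_subset)
  then have "positive (sets borel) (hausdorff_outer k :: 'a set \<Rightarrow> ennreal)"
    and "countably_additive (sets borel) (hausdorff_outer k :: 'a set \<Rightarrow> ennreal)"
    using ms by (auto simp: measure_space_def positive_def countably_additive_def)
  then show ?thesis
    using assms unfolding hausdorff_measure_def
    by (intro emeasure_measure_of_sigma)
       (auto intro: sets.sigma_algebra_axioms[of borel, simplified])
qed


section \<open>Elliptic operators with constant coefficients\<close>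

definition partial :: "'n::finite \<Rightarrow> (real^'n \<Rightarrow> real) \<Rightarrow> real^'n \<Rightarrow> real" where
  "partial i u x = deriv (\<lambda>t. u (x + t *\<^sub>R axis i 1)) 0"

definition neg_laplacian :: "(real^'n::finite \<Rightarrow> real) \<Rightarrow> real^'n \<Rightarrow> real" where
  "neg_laplacian u x = - (\<Sum>i\<in>UNIV. partial i (partial i u) x)"

text \<open>
  The multi-indices \<open>(i\<^sub>1, \<dots>, i\<^sub>2\<^sub>m)\<close> are the lists of length \<open>2 * m\<close> over the index type \<open>'n\<close>;
  the coefficient family \<open>A\<close> need not be symmetric, and only its values on such lists matter.
\<close>

definition symbol_poly :: "nat \<Rightarrow> ('n::finite list \<Rightarrow> real) \<Rightarrow> real^'n \<Rightarrow> real" where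
  "symbol_poly m A \<xi> = (\<Sum>is | length is = 2 * m. A is * (\<Prod>i\<leftarrow>is. \<xi> $ i))"

definition const_coeff_op ::
  "nat \<Rightarrow> ('n::finite list \<Rightarrow> real) \<Rightarrow> (real^'n \<Rightarrow> real) \<Rightarrow> real^'n \<Rightarrow> real" where
  "const_coeff_op m A u x = (- 1) ^ m * (\<Sum>is | length is = 2 * m. A is * foldr partial is u x)"

definition operator_with_symbol ::
  "nat \<Rightarrow> ((real^'n::finite \<Rightarrow> real) \<Rightarrow> real^'n \<Rightarrow> real) \<Rightarrow> (real^'n \<Rightarrow> real) \<Rightarrow> bool" where
  "operator_with_symbol m L Q \<longleftrightarrow> (\<exists>A. L = const_coeff_op m A \<and> Q = symbol_poly m A)"

text \<open>Uniform ellipticity of an operator, as a condition on its symbol.\<close>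

definition uniformly_elliptic :: "nat \<Rightarrow> (real^'n::finite \<Rightarrow> real) \<Rightarrow> bool" where
  "uniformly_elliptic m Q \<longleftrightarrow> (\<exists>c>0. \<forall>\<xi>. Q \<xi> \<ge> c * norm \<xi> ^ (2 * m))"


section \<open>John's fundamental solution\<close>

text \<open>
  The fundamental solution of the operator of order \<open>2 * m\<close> with symbol \<open>Q\<close>, meaningful for
  \<open>CARD('n) > 2 * m\<close> and \<open>x \<noteq> y\<close>.  The powers of \<open>-\<Delta>\<close> act on the variable \<open>y\<close>.
\<close>

definition john_fundamental_solution ::
  "nat \<Rightarrow> (real^'n::finite \<Rightarrow> real) \<Rightarrow> real^'n \<Rightarrow> real^'n \<Rightarrow> real" where
  "john_fundamental_solution m Q x y =
     (if odd CARD('n) then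
        - (1 / (4 * (2 * pi) ^ (CARD('n) - 1))) *
          (neg_laplacian ^^ ((CARD('n) + 1 - 2 * m) div 2))
            (\<lambda>y. LINT \<xi>:sphere 0 1|hausdorff_measure (CARD('n) - 1). \<bar>(x - y) \<bullet> \<xi>\<bar> / Q \<xi>) y
      else
        - (1 / (2 * pi) ^ CARD('n)) *
          (neg_laplacian ^^ ((CARD('n) - 2 * m) div 2))
            (\<lambda>y. LINT \<xi>:sphere 0 1|hausdorff_measure (CARD('n) - 1). ln \<bar>(x - y) \<bullet> \<xi>\<bar> / Q \<xi>) y)"

definition sign_changing_at_pole :: "('a::metric_space \<Rightarrow> 'a \<Rightarrow> real) \<Rightarrow> bool" where
  "sign_changing_at_pole K \<longleftrightarrow>
     (\<forall>r>0. (\<exists>x y. 0 < dist x y \<and> dist x y < r \<and> K x y > 0) \<and>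
            (\<exists>x y. 0 < dist x y \<and> dist x y < r \<and> K x y < 0))"

end

theory Submission
  imports Defs "HOL-Computational_Algebra.Polynomial"
begin

text \<open>
  Let \<open>\<tau> = \<xi>\<^sub>p\<close> be a coordinate, \<open>r\<^sup>2 = \<bar>\<xi>\<bar>\<^sup>2 - \<tau>\<^sup>2\<close> and
  \<open>Q\<^sub>\<theta> = \<tau>\<^sup>4 + 2 cos \<theta> \<tau>\<^sup>2 r\<^sup>2 + r\<^sup>4 = \<bar>\<tau>\<^sup>2 + exp (i \<theta>) r\<^sup>2\<bar>\<^sup>2\<close>, which is elliptic for \<open>\<bar>\<theta>\<bar> < \<pi>\<close>.
  Write \<open>1 / Q = f (\<xi>\<^sub>p)\<close> on the sphere and let \<open>\<phi>\<close> be \<open>\<bar>\<cdot>\<bar>\<close> or \<open>ln \<bar>\<cdot>\<bar>\<close>.  The reflection exchanging \<open>z / \<bar>z\<bar>\<close>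
  and \<open>e\<^sub>p\<close> turns \<open>\<integral> \<phi> (z \<bullet> \<xi>) f (\<xi>\<^sub>p)\<close> into \<open>\<integral> \<phi> (\<bar>z\<bar> \<xi>\<^sub>p) f (z \<bullet> \<xi> / \<bar>z\<bar>)\<close>, in which the singular factor
  does not depend on the direction of \<open>z\<close>.  Hence the powers of the Laplacian act on \<open>f\<close> through the spherical
  Laplacian \<open>\<Lambda>\<close>, and \<open>K (e\<^sub>p)\<close> is, up to a constant of known sign, a linear functional \<open>T f\<close>.

  As a limit of \<open>\<integral> \<phi>\<^sub>\<epsilon>\<^sup>(\<^sup>2\<^sup>k\<^sup>) (\<xi>\<^sub>p) f (\<xi>\<^sub>p)\<close>, the functional \<open>T\<close> inherits the homogeneity of its kernel: on functions
  of degree \<open>-4\<close> it satisfies \<open>T (\<tau> \<partial>\<^sub>\<tau> f) = (n - 5) T f\<close>.  Because \<open>r\<^sup>2 sin \<theta> / Q\<^sub>\<theta>\<close> is the imaginary part of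
  \<open>1 / (\<tau>\<^sup>2 + exp (-i \<theta>) r\<^sup>2)\<close>, it follows that \<open>y = T (sin \<theta> / Q\<^sub>\<theta>)\<close> solves \<open>y'' = - \<omega>\<^sup>2 y\<close> with \<open>\<omega> = (n - 3) / 2\<close>, so
  \<open>y = T 1 sin (\<omega> \<theta>) / \<omega>\<close>.  For \<open>n \<ge> 6\<close> one can choose \<open>\<theta> < \<pi>\<close> with \<open>\<omega> \<theta> = 4 \<pi> / 3\<close>, and then \<open>K (e\<^sub>p) < 0\<close>.
  On the other hand the mean of \<open>K\<close> over the sphere is a positive multiple of the one for \<open>(-\<Delta>)\<^sup>2\<close>, hence positive.
\<close>

section \<open>Surface measure of the sphere\<close>

text \<open>The angle \<open>\<theta>\<close> leads from \<open>(-\<Delta>)\<^sup>2\<close> at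
  \<open>\<theta> = 0\<close> to the degenerate form
  \<open>(\<tau>\<^sup>2 - r\<^sup>2)\<^sup>2\<close> at \<open>\<theta> = \<pi>\<close>. A negative
  value of \<open>sin (\<omega> \<theta>)\<close> before \<open>\<pi>\<close> requires
  \<open>\<omega> > 1\<close>, that is \<open>n > 5\<close>: for \<open>n = 5\<close> the solution
  is a multiple of \<open>sin \<theta>\<close> and \<open>y / sin \<theta>\<close> keeps its sign.
  Two obstacles shape the proof. The kernels \<open>\<bar>t\<bar>\<close> and
  \<open>ln \<bar>t\<bar>\<close> cannot be differentiated \<open>2 k\<close> times under the
  integral. After the reflection only the smooth factor is differentiated, but the resulting formula
  for \<open>T\<close> hides the homogeneity, which is why \<open>T\<close> is also written as a
  limit over smooth kernels. The other obstacle is that the surface measure is a Hausdorff measure.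
  Its value on the sphere is never computed: only finiteness, positive total mass and invariance
  under reflections are proved. Integration by parts for functions of one coordinate then comes from
  invariance alone, since a rotation invariant integral is constant and so has Laplacian 0.\<close>

lemma hausdorff_outer_isometry_image_le:
  fixes f :: "'a::metric_space \<Rightarrow> 'b::metric_space"
  assumes f: "\<And>x y. dist (f x) (f y) = dist x y"
  shows "hausdorff_outer k (f ` A) \<le> hausdorff_outer k A"
  unfolding hausdorff_outer_def
proof (rule SUP_mono, rule bexI)
  fix \<delta> :: real
  have "bounded (f ` C)" if "bounded C" for C :: "'a set"
    using that unfolding bounded_def by (metis (no_types, lifting) f image_iff)
  moreover have "diameter (f ` C) = diameter C" for C :: "'a set"
  proof -
    have "(\<lambda>(x, y). dist x y) ` (f ` C \<times> f ` C) = (\<lambda>(x, y). dist x y) ` (C \<times> C)"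
      by (force simp: f image_iff)
    then show ?thesis by (simp add: diameter_def)
  qed
  ultimately show "hausdorff_content k \<delta> (f ` A) \<le> hausdorff_content k \<delta> A"
    unfolding hausdorff_content_def
  proof (intro INF_mono)
    fix C :: "nat \<Rightarrow> 'a set"
    assume "C \<in> {C. A \<subseteq> (\<Union>j. C j) \<and> (\<forall>j. bounded (C j) \<and> diameter (C j) \<le> \<delta>)}"
    then have "(\<lambda>j. f ` C j) \<in> {C. f ` A \<subseteq> (\<Union>j. C j) \<and> (\<forall>j. bounded (C j) \<and> diameter (C j) \<le> \<delta>)}"
      using \<open>\<And>C. bounded C \<Longrightarrow> bounded (f ` C)\<close> \<open>\<And>C. diameter (f ` C) = diameter C\<close>
      by simp (simp add: image_UN[symmetric] image_mono)
    then show "\<exists>D\<in>{C. f ` A \<subseteq> (\<Union>j. C j) \<and> (\<forall>j. bounded (C j) \<and> diameter (C j) \<le> \<delta>)}.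
        (\<Sum>j. if D j = {} then 0 else ennreal (unit_ball_vol (real k) * (diameter (D j) / 2) ^ k))
        \<le> (\<Sum>j. if C j = {} then 0 else ennreal (unit_ball_vol (real k) * (diameter (C j) / 2) ^ k))"
      by (intro bexI[of _ "\<lambda>j. f ` C j"]) (simp_all only: \<open>\<And>C. diameter (f ` C) = diameter C\<close> image_is_empty order_refl)
  qed
qed

text \<open>Lebesgue measure of the truncated cone serves as a substitute for surface area: it
  bounds the Hausdorff measure of the sphere from below without a parametrization.\<close>

definition spherical_cone :: "'a::euclidean_space set \<Rightarrow> 'a set" where
  "spherical_cone A = {y. 0 < norm y \<and> norm y < 1 \<and> y /\<^sub>R norm y \<in> A}"

lemma sets_spherical_cone [measurable]:
  "A \<in> sets borel \<Longrightarrow> spherical_cone A \<in> sets borel"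
proof -
  assume A: "A \<in> sets borel"
  have "(\<lambda>y. y /\<^sub>R norm y) -` A \<inter> space borel \<in> sets borel"
    using A by (rule measurable_sets[rotated]) measurable
  moreover have "spherical_cone A = {y. 0 < norm y \<and> norm y < 1} \<inter> ((\<lambda>y. y /\<^sub>R norm y) -` A \<inter> space borel)"
    by (auto simp: spherical_cone_def)
  moreover have "{y::'a. 0 < norm y \<and> norm y < 1} \<in> sets borel" by measurable
  ultimately show ?thesis by auto
qed

lemma emeasure_spherical_cone_scaled:
  fixes A :: "'a::euclidean_space set"
  assumes "A \<in> sets borel" "0 \<le> r" "r \<le> 1"
  shows "emeasure lborel {y \<in> spherical_cone A. norm y < r} =
    ennreal (r ^ DIM('a)) * emeasure lborel (spherical_cone A)"
proof (cases "r = 0")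
  case False
  then have "0 < r" using assms by simp
  have "{y \<in> spherical_cone A. norm y < r} = (\<lambda>x. r *\<^sub>R x + 0) ` spherical_cone A"
  proof (intro equalityI subsetI)
    fix y assume "y \<in> {y \<in> spherical_cone A. norm y < r}"
    then have "y /\<^sub>R r \<in> spherical_cone A"
      using \<open>0 < r\<close> by (auto simp: spherical_cone_def field_simps)
    then show "y \<in> (\<lambda>x. r *\<^sub>R x + 0) ` spherical_cone A"
      using \<open>0 < r\<close> by (intro image_eqI[of _ _ "y /\<^sub>R r"]) auto
  next
    fix y assume "y \<in> (\<lambda>x. r *\<^sub>R x + 0) ` spherical_cone A"
    then obtain x where x: "x \<in> spherical_cone A" "y = r *\<^sub>R x" by auto
    then have "r * norm x < r * 1" using \<open>0 < r\<close> by (simp add: spherical_cone_def)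
    with \<open>r \<le> 1\<close> have "r * norm x < 1" by linarith
    then show "y \<in> {y \<in> spherical_cone A. norm y < r}"
      using x \<open>0 < r\<close> \<open>r * norm x < r * 1\<close> \<open>r * norm x < 1\<close> by (auto simp: spherical_cone_def field_simps)
  qed
  then have "emeasure lebesgue {y \<in> spherical_cone A. norm y < r} =
      ennreal (r ^ DIM('a)) * emeasure lebesgue (spherical_cone A)"
    using emeasure_lebesgue_affine[of r "0::'a" "spherical_cone A"] \<open>0 < r\<close> by simp
  moreover have "{y \<in> spherical_cone A. norm y < r} \<in> sets borel"
    using assms by measurable
  ultimately show ?thesis
    using assms by (simp add: sets_spherical_cone)
qed (use DIM_positive[where 'a='a] in \<open>simp add: spherical_cone_def\<close>)

text \<open>The part of the cone with \<open>norm y \<ge> 1 - d\<close> lies in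
  \<open>cball x (2 * d)\<close>, so its volume is of order \<open>d ^ n\<close>. By homogeneity it
  makes up the fraction \<open>1 - (1 - d) ^ n \<ge> d\<close> of the whole cone. Dividing by
  \<open>d\<close> leaves the exponent \<open>n - 1\<close>.\<close>

lemma emeasure_spherical_cone_cball_le:
  fixes x :: "'a::euclidean_space"
  assumes d: "0 < d" "d \<le> 1"
  shows "emeasure lborel (spherical_cone (sphere 0 1 \<inter> cball x d))
    \<le> ennreal (unit_ball_vol (DIM('a)) * 2 ^ DIM('a) * d ^ (DIM('a) - 1))"
proof -
  let ?n = "DIM('a)"
  let ?C = "spherical_cone (sphere 0 1 \<inter> cball x d)"
  have C: "?C \<in> sets borel" by (intro sets_spherical_cone) auto
  have "?C \<subseteq> ball 0 1" by (auto simp: spherical_cone_def)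
  then have "emeasure lborel ?C \<le> emeasure lborel (ball (0::'a) 1)"
    using C by (intro emeasure_mono) auto
  then have "emeasure lborel ?C < \<infinity>"
    by (metis emeasure_lborel_ball_finite le_less_trans infinity_ennreal_def)
  then obtain s where s: "emeasure lborel ?C = ennreal s" "0 \<le> s"
    by (metis ennreal_cases infinity_ennreal_def less_irrefl)
  define U where "U = {y \<in> ?C. norm y < 1 - d}"
  have U: "U \<in> sets borel" unfolding U_def using C by measurable
  have mU: "emeasure lborel U = ennreal ((1 - d) ^ ?n * s)"
    unfolding U_def using d s by (subst emeasure_spherical_cone_scaled) (auto simp: ennreal_mult)
  have "?C - U \<subseteq> cball x (2 * d)"
  proof
    fix y assume y: "y \<in> ?C - U"
    then have *: "0 < norm y" "norm y < 1" "dist x (y /\<^sub>R norm y) \<le> d" "1 - d \<le> norm y"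
      by (auto simp: spherical_cone_def U_def)
    have "y /\<^sub>R norm y - y = (1 / norm y - 1) *\<^sub>R y"
      by (simp add: scaleR_left_diff_distrib divide_inverse)
    then have "dist (y /\<^sub>R norm y) y = \<bar>1 / norm y - 1\<bar> * norm y"
      by (simp add: dist_norm)
    also have "\<dots> = 1 - norm y" using * by (simp add: abs_if field_simps)
    finally show "y \<in> cball x (2 * d)"
      using * dist_triangle[of x y "y /\<^sub>R norm y"] by simp
  qed
  then have "emeasure lborel (?C - U) \<le> emeasure lborel (cball x (2 * d))"
    by (intro emeasure_mono) auto
  also have "\<dots> = ennreal (unit_ball_vol ?n * (2 * d) ^ ?n)"
    using d by (subst emeasure_cball) auto
  finally have "emeasure lborel (?C - U) \<le> ennreal (unit_ball_vol ?n * (2 * d) ^ ?n)" .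
  moreover have "emeasure lborel (?C - U) = ennreal (s - (1 - d) ^ ?n * s)"
    using C U s d mU by (subst emeasure_Diff) (auto simp: U_def ennreal_minus)
  ultimately have "s - (1 - d) ^ ?n * s \<le> unit_ball_vol ?n * (2 * d) ^ ?n"
    using d by simp
  moreover have "(1 - d) ^ ?n \<le> 1 - d"
    using power_decreasing[of 1 ?n "1 - d"] d DIM_positive[where 'a='a] by (simp add: Suc_le_eq)
  then have "(1 - d) ^ ?n * s \<le> (1 - d) * s" using s by (intro mult_right_mono) auto
  ultimately have "d * s \<le> unit_ball_vol ?n * (2 * d) ^ ?n" by (simp add: algebra_simps)
  also have "\<dots> = d * (unit_ball_vol ?n * 2 ^ ?n * d ^ (?n - 1))"
    using DIM_positive[where 'a='a] by (simp add: power_mult_distrib power_eq_if[of d "?n"])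
  finally have "s \<le> unit_ball_vol ?n * 2 ^ ?n * d ^ (?n - 1)"
    using d by (subst (asm) mult_le_cancel_left_pos) auto
  then show ?thesis unfolding s(1) by (rule ennreal_leI)
qed

text \<open>Mass distribution principle: the cones over the members of a covering fill the unit ball
  up to its centre, and each has volume at most a constant times the \<open>(n - 1)\<close>-st power
  of the diameter. Hence the sum in \<open>hausdorff_content\<close> has a positive lower bound for
  every covering by sets of diameter at most 1.\<close>

lemma hausdorff_outer_sphere_pos:
  assumes "DIM('a::euclidean_space) \<ge> 2"
  shows "0 < hausdorff_outer (DIM('a) - 1) (sphere (0::'a) 1)"
proof -
  let ?n = "DIM('a)"
  let ?S = "sphere (0::'a) 1"
  define c where "c = unit_ball_vol ?n * 2 ^ ?n"
  define b where "b = unit_ball_vol (real (?n - 1)) * (1 / 2) ^ (?n - 1)"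
  have "0 < c" "0 < b" by (auto simp: c_def b_def)
  have eq_b: "unit_ball_vol (real (?n - 1)) * (d / 2) ^ (?n - 1) = b * d ^ (?n - 1)" for d
    by (simp add: b_def power_divide)
  \<comment> \<open>Covering sets may be single points, so the cone estimate is extended to
    \<open>d = 0\<close> by letting a positive radius \<open>e\<close> shrink.\<close>
  have zero: "emeasure lborel (spherical_cone (?S \<inter> cball x d)) \<le> ennreal (c * d ^ (?n - 1))"
    if "0 \<le> d" "d \<le> 1" for x d
  proof (cases "d = 0")
    case False
    then show ?thesis using emeasure_spherical_cone_cball_le[of d x] that by (auto simp: c_def)
  next
    case True
    have "emeasure lborel (spherical_cone (?S \<inter> cball x d)) \<le> ennreal (c * e ^ (?n - 1))"
      if "e \<in> {0<..<1}" for e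
    proof -
      have "spherical_cone (?S \<inter> cball x d) \<subseteq> spherical_cone (?S \<inter> cball x e)"
        using that True by (auto simp: spherical_cone_def)
      then have "emeasure lborel (spherical_cone (?S \<inter> cball x d))
          \<le> emeasure lborel (spherical_cone (?S \<inter> cball x e))"
        by (intro emeasure_mono) (auto intro!: sets_spherical_cone)
      then show ?thesis
        using emeasure_spherical_cone_cball_le[of e x] that by (auto simp: c_def)
    qed
    then have "\<forall>\<^sub>F e in at_right 0. emeasure lborel (spherical_cone (?S \<inter> cball x d)) \<le> ennreal (c * e ^ (?n - 1))"
      by (intro eventually_at_rightI[of 0 1]) auto
    moreover have "((\<lambda>e. ennreal (c * e ^ (?n - 1))) \<longlongrightarrow> ennreal (c * 0 ^ (?n - 1))) (at_right 0)"
      by (intro tendsto_ennrealI tendsto_intros)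
    ultimately show ?thesis
      using True by (intro tendsto_lowerbound) auto
  qed
  have cover: "ennreal (unit_ball_vol ?n) \<le> ennreal (c / b) *
      (\<Sum>j. if C j = {} then 0 else ennreal (unit_ball_vol (real (?n - 1)) * (diameter (C j) / 2) ^ (?n - 1)))"
    if C: "?S \<subseteq> (\<Union>j. C j)" "\<And>j. bounded (C j)" "\<And>j. diameter (C j) \<le> 1" for C :: "nat \<Rightarrow> 'a set"
  proof -
    \<comment> \<open>The covering sets are arbitrary, possibly not Borel. Each is enclosed in a
      spherical cap whose radius is its diameter, which makes the cones measurable.\<close>
    define A where "A j = (if C j = {} then {} else ?S \<inter> cball (SOME x. x \<in> C j) (diameter (C j)))" for j
    have A: "A j \<in> sets borel" for j by (auto simp: A_def)
    have "?S \<subseteq> (\<Union>j. A j)"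
    proof
      fix y assume "y \<in> ?S"
      then obtain j where j: "y \<in> C j" using C by auto
      then have "(SOME x. x \<in> C j) \<in> C j" by (intro someI)
      then have "dist (SOME x. x \<in> C j) y \<le> diameter (C j)"
        using j C by (intro diameter_bounded_bound) auto
      then show "y \<in> (\<Union>j. A j)" using j \<open>y \<in> ?S\<close> by (auto simp: A_def)
    qed
    then have "ball 0 1 \<subseteq> {0} \<union> (\<Union>j. spherical_cone (A j))"
    proof (intro subsetI)
      fix y :: 'a assume "y \<in> ball 0 1"
      show "y \<in> {0} \<union> (\<Union>j. spherical_cone (A j))"
      proof (cases "y = 0")
        case False
        then have "y /\<^sub>R norm y \<in> ?S" by simp
        then obtain j where "y /\<^sub>R norm y \<in> A j" using \<open>?S \<subseteq> (\<Union>j. A j)\<close> by blast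
        then show ?thesis using False \<open>y \<in> ball 0 1\<close> by (auto simp: spherical_cone_def)
      qed simp
    qed
    have "ennreal (unit_ball_vol ?n) = emeasure lborel (ball (0::'a) 1)"
      by (subst emeasure_ball) auto
    also have "\<dots> \<le> emeasure lborel ({0} \<union> (\<Union>j. spherical_cone (A j)))"
      by (intro emeasure_mono) (use \<open>ball 0 1 \<subseteq> _\<close> A in auto)
    also have "\<dots> \<le> emeasure lborel {0::'a} + emeasure lborel (\<Union>j. spherical_cone (A j))"
      using A by (intro emeasure_subadditive) auto
    also have "\<dots> \<le> 0 + (\<Sum>j. emeasure lborel (spherical_cone (A j)))"
      using A by (intro add_mono emeasure_subadditive_countably) auto
    also have "0 + (\<Sum>j. emeasure lborel (spherical_cone (A j))) \<le>
      (\<Sum>j. ennreal (c / b) * (if C j = {} then 0 else ennreal (unit_ball_vol (real (?n - 1)) * (diameter (C j) / 2) ^ (?n - 1))))"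
      unfolding add_0_left
    proof (intro suminf_le allI)
      fix j
      have "c * diameter (C j) ^ (?n - 1) = c / b * (unit_ball_vol (real (?n - 1)) * (diameter (C j) / 2) ^ (?n - 1))"
        using \<open>0 < b\<close> by (simp only: eq_b) simp
      then have eq: "ennreal (c * diameter (C j) ^ (?n - 1)) =
        ennreal (c / b) * ennreal (unit_ball_vol (real (?n - 1)) * (diameter (C j) / 2) ^ (?n - 1))"
        using \<open>0 < b\<close> \<open>0 < c\<close> diameter_ge_0[OF C(2)[of j]] by (simp add: ennreal_mult[symmetric] eq_b del: of_nat_diff)
      show "emeasure lborel (spherical_cone (A j)) \<le> ennreal (c / b) * (if C j = {} then 0 else ennreal (unit_ball_vol (real (?n - 1)) * (diameter (C j) / 2) ^ (?n - 1)))"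
      proof (cases "C j = {}")
        case True
        then show ?thesis by (simp add: A_def spherical_cone_def)
      next
        case False
        then show ?thesis
          using zero[OF diameter_ge_0[OF C(2)[of j]] C(3)[of j]] unfolding eq A_def by auto
      qed
    qed auto
    also have "\<dots> = ennreal (c / b) * (\<Sum>j. if C j = {} then 0 else ennreal (unit_ball_vol (real (?n - 1)) * (diameter (C j) / 2) ^ (?n - 1)))"
      by (rule ennreal_suminf_cmult)
    finally show ?thesis .
  qed
  have "ennreal (b / c * unit_ball_vol ?n) \<le> (\<Sum>j. if C j = {} then 0 else ennreal (unit_ball_vol (real (?n - 1)) * (diameter (C j) / 2) ^ (?n - 1)))"
    if C: "?S \<subseteq> (\<Union>j. C j)" "\<And>j. bounded (C j)" "\<And>j. diameter (C j) \<le> 1" for C :: "nat \<Rightarrow> 'a set"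
  proof -
    let ?s = "\<Sum>j. if C j = {} then 0 else ennreal (unit_ball_vol (real (?n - 1)) * (diameter (C j) / 2) ^ (?n - 1))"
    have "ennreal (b / c * unit_ball_vol ?n) = ennreal (b / c) * ennreal (unit_ball_vol ?n)"
      using \<open>0 < b\<close> \<open>0 < c\<close> by (subst ennreal_mult[symmetric]) auto
    also have "\<dots> \<le> ennreal (b / c) * (ennreal (c / b) * ?s)"
      using C by (intro mult_left_mono cover) auto
    also have "\<dots> = ?s"
      using \<open>0 < b\<close> \<open>0 < c\<close> by (simp add: mult.assoc[symmetric] ennreal_mult[symmetric])
    finally show ?thesis .
  qed
  then have "ennreal (b / c * unit_ball_vol ?n) \<le> hausdorff_content (?n - 1) 1 ?S"
    unfolding hausdorff_content_def by (intro INF_greatest) auto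
  also have "\<dots> \<le> hausdorff_outer (?n - 1) ?S"
    unfolding hausdorff_outer_def by (rule SUP_upper) auto
  finally have "ennreal (b / c * unit_ball_vol ?n) \<le> hausdorff_outer (?n - 1) ?S" .
  moreover have "0 < b / c * unit_ball_vol ?n"
    using \<open>0 < b\<close> \<open>0 < c\<close> by (intro mult_pos_pos divide_pos_pos) auto
  ultimately show ?thesis
    by (metis ennreal_less_zero_iff less_le_trans)
qed

text \<open>Packing argument. For an \<open>e\<close>-separated subset \<open>X\<close> of the
  sphere the balls of radius \<open>e / 2\<close> are disjoint and lie in a shell of thickness
  \<open>e\<close>; comparing volumes bounds \<open>card X * e ^ (n - 1)\<close> independently of
  \<open>e\<close>. If \<open>card X\<close> is maximal, the balls of radius \<open>e\<close> around
  \<open>X\<close> cover the sphere.\<close>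

lemma hausdorff_content_sphere_le:
  assumes "\<delta> > 0"
  shows "hausdorff_content (DIM('a) - 1) \<delta> (sphere (0::'a::euclidean_space) 1)
    \<le> ennreal (unit_ball_vol (real (DIM('a) - 1)) * (real DIM('a) * 4 ^ DIM('a)))"
proof -
  let ?n = "DIM('a)"
  let ?S = "sphere (0::'a) 1"
  \<comment> \<open>\<open>2 * e \<le> \<delta>\<close> makes the covering balls admissible, and
    \<open>e \<le> 1 / 2\<close> keeps both radii \<open>1 - e / 2\<close> and
    \<open>1 + e / 2\<close> of the shell between 0 and 2.\<close>
  define e where "e = min \<delta> 1 / 2"
  have e: "0 < e" "e \<le> 1 / 2" "2 * e \<le> \<delta>" using assms by (auto simp: e_def)
  define separated where "separated X \<longleftrightarrow> finite X \<and> X \<subseteq> ?S \<and> (\<forall>x\<in>X. \<forall>y\<in>X. x \<noteq> y \<longrightarrow> e \<le> dist x y)" for X :: "'a set"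
  have bound: "real (card X) * e ^ (?n - 1) \<le> ?n * 4 ^ ?n" if "separated X" for X
  proof -
    let ?B = "\<lambda>x::'a. ball x (e / 2)"
    let ?V = "unit_ball_vol ?n"
    have disj: "disjoint_family_on ?B X"
    proof (clarsimp simp: disjoint_family_on_def)
      fix x y assume "x \<in> X" "y \<in> X" "x \<noteq> y"
      then have "e \<le> dist x y" using that by (auto simp: separated_def)
      moreover have False if "z \<in> ?B x" "z \<in> ?B y" for z
        using that \<open>e \<le> dist x y\<close> dist_triangle2[of x y z] by (auto simp: dist_commute)
      ultimately show "?B x \<inter> ?B y = {}" by blast
    qed
    have "?B x \<subseteq> ball 0 (1 + e / 2) - ball 0 (1 - e / 2)" if "x \<in> X" for x
    proof
      fix z assume "z \<in> ?B x"
      then have "norm (x - z) < e / 2" "norm x = 1" using \<open>separated X\<close> that by (auto simp: dist_norm separated_def)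
      then show "z \<in> ball 0 (1 + e / 2) - ball 0 (1 - e / 2)"
        using norm_triangle_ineq2[of x z] norm_triangle_ineq2[of z x] by (auto simp: norm_minus_commute)
    qed
    then have "measure lborel (\<Union>x\<in>X. ?B x) \<le> measure lborel (ball (0::'a) (1 + e / 2) - ball 0 (1 - e / 2))"
    proof (intro measure_mono_fmeasurable UN_least)
      show "(\<Union>x\<in>X. ?B x) \<in> sets lborel"
        using that by (intro sets.finite_UN) (auto simp: separated_def)
      show "ball (0::'a) (1 + e / 2) - ball 0 (1 - e / 2) \<in> fmeasurable lborel"
        by (intro fmeasurable_Diff fmeasurableI)
          (auto simp: emeasure_lborel_ball_finite[unfolded infinity_ennreal_def])
    qed
    moreover have "measure lborel (\<Union>x\<in>X. ?B x) = (\<Sum>x\<in>X. measure lborel (?B x))"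
      using that disj emeasure_lborel_ball_finite
      by (intro measure_finite_Union) (auto simp: separated_def less_top[symmetric])
    moreover have "\<dots> = real (card X) * (?V * (e / 2) ^ ?n)"
      using e by (simp add: content_ball)
    moreover have "measure lborel (ball (0::'a) (1 + e / 2) - ball 0 (1 - e / 2)) =
        ?V * ((1 + e / 2) ^ ?n - (1 - e / 2) ^ ?n)"
      using e emeasure_lborel_ball_finite
      by (subst measure_Diff) (auto simp: content_ball less_top[symmetric] algebra_simps)
    ultimately have "?V * (real (card X) * (e / 2) ^ ?n) \<le> ?V * ((1 + e / 2) ^ ?n - (1 - e / 2) ^ ?n)"
      by (simp add: mult_ac)
    then have "real (card X) * (e / 2) ^ ?n \<le> (1 + e / 2) ^ ?n - (1 - e / 2) ^ ?n"
      by (subst (asm) mult_le_cancel_left_pos) auto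
    also have "\<dots> = e * (\<Sum>i<?n. (1 - e / 2) ^ (?n - Suc i) * (1 + e / 2) ^ i)"
      by (subst power_diff_sumr2) simp
    also have "\<dots> \<le> e * (\<Sum>i<?n. 1 * 2 ^ (?n - 1))"
    proof (intro mult_left_mono sum_mono mult_mono)
      fix i assume "i \<in> {..<?n}"
      have "(1 + e / 2) ^ i \<le> 2 ^ i" using e by (intro power_mono) auto
      also have "(2::real) ^ i \<le> 2 ^ (?n - 1)" using \<open>i \<in> {..<?n}\<close> by (intro power_increasing) auto
      finally show "(1 + e / 2) ^ i \<le> 2 ^ (?n - 1)" .
    qed (use e in \<open>auto intro!: power_le_one\<close>)
    also have "\<dots> = e * (?n * 2 ^ (?n - 1))" by simp
    finally have "real (card X) * (e / 2) ^ ?n \<le> e * (?n * 2 ^ (?n - 1))" .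
    moreover have "real (card X) * (e / 2) ^ ?n = e * (real (card X) * e ^ (?n - 1) / 2 ^ ?n)"
      using DIM_positive[where 'a='a] by (simp add: power_divide power_eq_if[of e ?n])
    ultimately have "real (card X) * e ^ (?n - 1) / 2 ^ ?n \<le> ?n * 2 ^ (?n - 1)"
      using e by (simp only: mult_le_cancel_left_pos)
    then have "real (card X) * e ^ (?n - 1) \<le> ?n * (2 ^ (?n - 1) * 2 ^ ?n)"
      by (simp add: field_simps)
    also have "real (?n * (2 ^ (?n - 1) * 2 ^ ?n)) \<le> real (?n * (2 ^ ?n * 2 ^ ?n))"
      by (intro of_nat_mono mult_left_mono mult_right_mono power_increasing) auto
    finally show ?thesis by (simp flip: power_mult_distrib)
  qed
  have "card X \<le> nat \<lfloor>?n * 4 ^ ?n / e ^ (?n - 1)\<rfloor>" if "separated X" for X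
    using bound[OF that] e by (simp add: le_nat_floor field_simps)
  moreover have "separated {}" by (simp add: separated_def)
  ultimately obtain X where X: "separated X" and max: "\<And>Y. separated Y \<Longrightarrow> card Y \<le> card X"
    using ex_has_greatest_nat[of separated "{}" card "nat \<lfloor>?n * 4 ^ ?n / e ^ (?n - 1)\<rfloor> + 1"]
    by (metis add.commute le_imp_less_Suc plus_1_eq_Suc)
  have cover: "?S \<subseteq> (\<Union>x\<in>X. cball x e)"
  proof (rule ccontr)
    assume "\<not> ?thesis"
    then obtain y where y: "y \<in> ?S" "y \<notin> (\<Union>x\<in>X. cball x e)" by blast
    then have y: "y \<in> ?S" "\<And>x. x \<in> X \<Longrightarrow> e < dist x y" by (auto simp: not_le)
    then have "y \<notin> X" using e by force
    moreover have "separated (insert y X)"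
      using X y e by (auto simp: separated_def dist_commute less_imp_le)
    ultimately show False using max[of "insert y X"] X by (auto simp: separated_def)
  qed
  obtain h where h: "bij_betw h {..<card X} X"
    using X bij_betw_from_nat_into_finite unfolding separated_def by blast
  define C where "C j = (if j < card X then cball (h j) e else {})" for j
  have "?S \<subseteq> (\<Union>j. C j)"
  proof
    fix y assume "y \<in> ?S"
    then obtain x where x: "x \<in> X" "y \<in> cball x e" using cover by blast
    from \<open>x \<in> X\<close> have "x \<in> h ` {..<card X}" using h by (simp only: bij_betw_def)
    then obtain j where "j < card X" "h j = x" by (elim imageE) simp
    then show "y \<in> (\<Union>j. C j)" using x by (auto simp: C_def)
  qed
  moreover have "bounded (C j)" "diameter (C j) \<le> \<delta>" for j
    using e assms by (auto simp: C_def)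
  ultimately have "hausdorff_content (?n - 1) \<delta> ?S \<le>
      (\<Sum>j. if C j = {} then 0 else ennreal (unit_ball_vol (real (?n - 1)) * (diameter (C j) / 2) ^ (?n - 1)))"
    unfolding hausdorff_content_def by (intro INF_lower) auto
  also have "\<dots> = (\<Sum>j<card X. ennreal (unit_ball_vol (real (?n - 1)) * e ^ (?n - 1)))"
    using e by (subst suminf_finite[of "{..<card X}"]) (auto simp: C_def intro!: sum.cong)
  also have "\<dots> = ennreal (unit_ball_vol (real (?n - 1)) * (real (card X) * e ^ (?n - 1)))"
    using e by (simp add: ennreal_of_nat_eq_real_of_nat ennreal_mult[symmetric] mult_ac)
  also have "\<dots> \<le> ennreal (unit_ball_vol (real (?n - 1)) * (?n * 4 ^ ?n))"
    using bound[OF X] by (intro ennreal_leI mult_left_mono) auto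
  finally show ?thesis by simp
qed

lemma hausdorff_outer_sphere_finite:
  "hausdorff_outer (DIM('a) - 1) (sphere (0::'a::euclidean_space) 1) < \<infinity>"
proof -
  have "hausdorff_outer (DIM('a) - 1) (sphere (0::'a) 1)
      \<le> ennreal (unit_ball_vol (real (DIM('a) - 1)) * (real DIM('a) * 4 ^ DIM('a)))"
    unfolding hausdorff_outer_def by (intro SUP_least hausdorff_content_sphere_le) auto
  then show ?thesis by (simp add: le_less_trans)
qed

section \<open>The surface measure and its invariance under reflections\<close>

definition surface_measure :: "'a::euclidean_space measure" where
  "surface_measure = restrict_space (hausdorff_measure (DIM('a) - 1)) (sphere 0 1)"

lemma space_surface_measure [simp]: "space surface_measure = sphere 0 1"
  by (simp add: surface_measure_def space_restrict_space)

lemma sets_surface_measure [measurable_cong]: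
  "sets surface_measure = sets (restrict_space borel (sphere 0 1))"
  by (simp add: surface_measure_def sets_restrict_space)

lemma emeasure_surface_measure:
  "emeasure (surface_measure :: 'a::euclidean_space measure) (sphere 0 1) = hausdorff_outer (DIM('a) - 1) (sphere (0::'a) 1)"
  unfolding surface_measure_def
  by (subst emeasure_restrict_space) (auto simp: emeasure_hausdorff_measure)

lemma finite_measure_surface_measure: "finite_measure (surface_measure :: 'a::euclidean_space measure)"
  by (rule finite_measureI)
    (use hausdorff_outer_sphere_finite[where 'a='a] in \<open>simp add: emeasure_surface_measure less_top\<close>)

lemma measure_surface_measure_pos:
  assumes "DIM('a::euclidean_space) \<ge> 2"
  shows "0 < measure (surface_measure :: 'a measure) (sphere 0 1)"
  using hausdorff_outer_sphere_pos[OF assms] hausdorff_outer_sphere_finite[where 'a='a]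
  by (simp add: measure_def emeasure_surface_measure enn2real_positive_iff)

lemma set_integral_sphere_eq:
  fixes f :: "'a::euclidean_space \<Rightarrow> real"
  shows "(LINT x:sphere 0 1|hausdorff_measure (DIM('a) - 1). f x) = integral\<^sup>L surface_measure f"
  unfolding surface_measure_def set_lebesgue_integral_def
  by (subst integral_restrict_space) auto

text \<open>For an involution the one-sided bound for isometric images suffices: applied to a set
  and to its image it gives equality, and the preimage of a set is its image.\<close>

lemma integral_surface_measure_involution:
  fixes f :: "'a::euclidean_space \<Rightarrow> real"
  assumes R: "\<And>x y. dist (R x) (R y) = dist x y" "\<And>x. R (R x) = x" "R 0 = 0"
  assumes [measurable]: "f \<in> borel_measurable borel"
  shows "(LINT x|surface_measure. f (R x)) = integral\<^sup>L surface_measure f"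
proof -
  have "continuous_on UNIV R"
    by (rule continuous_onI) (use R(1) in auto)
  then have Rm [measurable]: "R \<in> borel_measurable borel" by (rule borel_measurable_continuous_onI)
  have normR: "norm (R x) = norm x" for x using R(1)[of x 0] R(3) by simp
  then have Rs [measurable]: "R \<in> surface_measure \<rightarrow>\<^sub>M surface_measure"
    unfolding measurable_cong_sets[OF sets_surface_measure sets_surface_measure]
    by (intro measurable_restrict_space3) auto
  have image: "hausdorff_outer k (R ` A) = hausdorff_outer k A" for k A
  proof (rule antisym)
    have "R ` R ` A = A" by (auto simp: R(2) image_iff)
    then show "hausdorff_outer k A \<le> hausdorff_outer k (R ` A)"
      using hausdorff_outer_isometry_image_le[OF R(1), of k "R ` A"] by simp
  qed (rule hausdorff_outer_isometry_image_le[OF R(1)])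
  have "distr surface_measure surface_measure R = surface_measure"
  proof (rule measure_eqI)
    fix A assume A: "A \<in> sets (distr surface_measure surface_measure R)"
    then have "A \<subseteq> sphere 0 1" "A \<in> sets borel"
      by (auto simp: sets_surface_measure sets_restrict_space)
    have vimage: "R -` A = R ` A"
      using R(2) by (auto simp: image_iff) metis
    moreover have "R ` A \<subseteq> sphere 0 1"
      using \<open>A \<subseteq> sphere 0 1\<close> normR by auto
    ultimately have vim: "R -` A \<inter> space surface_measure = R ` A"
      by auto
    have "R ` A \<in> sets borel"
      using measurable_sets[OF Rm \<open>A \<in> sets borel\<close>] vimage by simp
    have em: "emeasure surface_measure B = hausdorff_outer (DIM('a) - 1) B"
      if "B \<subseteq> sphere 0 1" "B \<in> sets borel" for B :: "'a set"
      unfolding surface_measure_def using that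
      by (subst emeasure_restrict_space) (auto simp: emeasure_hausdorff_measure)
    have "emeasure (distr surface_measure surface_measure R) A = emeasure surface_measure (R ` A)"
      using A Rs by (subst emeasure_distr) (simp_all only: vim sets_distr)
    also have "\<dots> = hausdorff_outer (DIM('a) - 1) A"
      using \<open>A \<subseteq> sphere 0 1\<close> \<open>R ` A \<in> sets borel\<close> normR by (subst em) (auto simp: image)
    finally show "emeasure (distr surface_measure surface_measure R) A = emeasure surface_measure A"
      using em \<open>A \<subseteq> sphere 0 1\<close> \<open>A \<in> sets borel\<close> by simp
  qed simp
  moreover have "f \<in> borel_measurable surface_measure"
    unfolding measurable_cong_sets[OF sets_surface_measure refl] by (intro measurable_restrict_space1) simp
  ultimately show ?thesis
    using integral_distr[OF Rs, of f] by simp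
qed

text \<open>The reflection in the hyperplane orthogonal to \<open>a - b\<close> exchanges the two
  vectors because their norms agree. Both arguments of \<open>F\<close> are swapped at once; this is
  what moves the direction of \<open>z\<close> from the singular factor into the smooth one.\<close>

lemma integral_surface_measure_swap:
  fixes a b :: "'a::euclidean_space" and F :: "real \<Rightarrow> real \<Rightarrow> real"
  assumes "norm a = norm b" and [measurable]: "case_prod F \<in> borel_measurable borel"
  shows "(LINT x|surface_measure. F (a \<bullet> x) (b \<bullet> x)) = (LINT x|surface_measure. F (b \<bullet> x) (a \<bullet> x))"
proof (cases "a = b")
  case False
  define v where "v = a - b"
  define R where "R x = x - (2 * (v \<bullet> x) / (v \<bullet> v)) *\<^sub>R v" for x
  have v: "v \<bullet> v \<noteq> 0" using False by (simp add: v_def)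
  have dot: "R x \<bullet> R y = x \<bullet> y" for x y
    using v by (simp add: R_def inner_diff_left inner_diff_right inner_commute field_simps)
  have diff: "R x - R y = R (x - y)" for x y
    by (simp add: R_def inner_diff_right diff_divide_distrib right_diff_distrib scaleR_left_diff_distrib)
  have ab: "a \<bullet> a = b \<bullet> b" using assms by (simp add: dot_square_norm)
  have "a \<bullet> R x = b \<bullet> x" "b \<bullet> R x = a \<bullet> x" for x
  proof -
    have "v \<bullet> v = 2 * (v \<bullet> a)" "v \<bullet> v = - 2 * (v \<bullet> b)"
      using ab by (simp_all add: v_def inner_diff_left inner_diff_right inner_commute)
    then have va: "v \<bullet> a = v \<bullet> v / 2" and vb: "v \<bullet> b = - (v \<bullet> v) / 2" by simp_all
    have "a \<bullet> R x = a \<bullet> x - 2 * (v \<bullet> x) / (v \<bullet> v) * (v \<bullet> a)"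
      by (simp add: R_def inner_diff_right inner_commute[of a v])
    also have "\<dots> = a \<bullet> x - v \<bullet> x" unfolding va using v by simp
    finally show "a \<bullet> R x = b \<bullet> x" by (simp add: v_def inner_diff_left)
    have "b \<bullet> R x = b \<bullet> x - 2 * (v \<bullet> x) / (v \<bullet> v) * (v \<bullet> b)"
      by (simp add: R_def inner_diff_right inner_commute[of b v])
    also have "\<dots> = b \<bullet> x + v \<bullet> x" unfolding vb using v by simp
    finally show "b \<bullet> R x = a \<bullet> x" by (simp add: v_def inner_diff_left)
  qed
  moreover have "(LINT x|surface_measure. F (a \<bullet> R x) (b \<bullet> R x)) = (LINT x|surface_measure. F (a \<bullet> x) (b \<bullet> x))"
  proof (rule integral_surface_measure_involution[of R "\<lambda>x. F (a \<bullet> x) (b \<bullet> x)"])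
    show "dist (R x) (R y) = dist x y" for x y
      by (simp add: dist_norm diff norm_eq_sqrt_inner dot)
    show "R (R x) = x" for x
    proof -
      have "v \<bullet> R x = - (v \<bullet> x)" using v by (simp add: R_def inner_diff_right)
      then show ?thesis by (simp add: R_def[of "R x"]) (simp add: R_def)
    qed
    have "(\<lambda>x. case_prod F (a \<bullet> x, b \<bullet> x)) \<in> borel_measurable borel" by measurable
    then show "(\<lambda>x. F (a \<bullet> x) (b \<bullet> x)) \<in> borel_measurable borel" by simp
  qed (simp add: R_def)
  ultimately show ?thesis by simp
qed simp

section \<open>The Laplacian of spherical integrals\<close>

text \<open>Dominated convergence for the difference quotients: by the mean value inequality they
  obey the same bound \<open>g\<close> as the derivative. All hypotheses are local in the parameter,
  since the bounds available later hold on small balls only.\<close>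

lemma has_real_derivative_integral:
  fixes f :: "real \<Rightarrow> 'a \<Rightarrow> real"
  assumes "d > 0"
    and f: "\<And>t. \<bar>t - a\<bar> < d \<Longrightarrow> integrable M (f t)"
    and f': "\<And>t x. \<bar>t - a\<bar> < d \<Longrightarrow> x \<in> space M \<Longrightarrow> ((\<lambda>t. f t x) has_real_derivative f' t x) (at t)"
    and bound: "\<And>t x. \<bar>t - a\<bar> < d \<Longrightarrow> x \<in> space M \<Longrightarrow> \<bar>f' t x\<bar> \<le> g x"
    and g: "integrable M g"
    and meas: "f' a \<in> borel_measurable M"
  shows "((\<lambda>t. \<integral>x. f t x \<partial>M) has_real_derivative (\<integral>x. f' a x \<partial>M)) (at a)"
  unfolding has_field_derivative_iff tendsto_at_iff_sequentially
proof (intro allI impI)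
  fix X :: "nat \<Rightarrow> real"
  assume X: "\<forall>i. X i \<in> UNIV - {a}" "X \<longlonglongrightarrow> a"
  then obtain N where N: "\<And>i. i \<ge> N \<Longrightarrow> \<bar>X i - a\<bar> < d"
    using \<open>d > 0\<close> unfolding lim_sequentially dist_real_def by blast
  define Y where "Y i = X (i + N)" for i
  have Y: "Y i \<noteq> a" "\<bar>Y i - a\<bar> < d" for i using X(1) N by (auto simp: Y_def)
  have "Y \<longlonglongrightarrow> a" unfolding Y_def using X(2) by (rule LIMSEQ_ignore_initial_segment)
  have "(\<lambda>i. \<integral>x. (f (Y i) x - f a x) / (Y i - a) \<partial>M) \<longlonglongrightarrow> (\<integral>x. f' a x \<partial>M)"
  proof (rule integral_dominated_convergence)
    show "f' a \<in> borel_measurable M" by fact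
    show "(\<lambda>x. (f (Y i) x - f a x) / (Y i - a)) \<in> borel_measurable M" for i
      using f[OF Y(2)[of i]] f[of a] \<open>d > 0\<close>
      by (intro borel_measurable_integrable Bochner_Integration.integrable_diff integrable_divide) auto
    show "integrable M g" by fact
    show "AE x in M. (\<lambda>i. (f (Y i) x - f a x) / (Y i - a)) \<longlonglongrightarrow> f' a x"
    proof (rule AE_I2)
      fix x assume "x \<in> space M"
      then have "((\<lambda>t. (f t x - f a x) / (t - a)) \<longlongrightarrow> f' a x) (at a)"
        using f'[of a x] \<open>d > 0\<close> by (simp add: has_field_derivative_iff)
      then show "(\<lambda>i. (f (Y i) x - f a x) / (Y i - a)) \<longlonglongrightarrow> f' a x"
        using Y(1) \<open>Y \<longlonglongrightarrow> a\<close> unfolding tendsto_at_iff_sequentially by (auto simp: o_def)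
    qed
    show "AE x in M. norm ((f (Y i) x - f a x) / (Y i - a)) \<le> g x" for i
    proof (rule AE_I2)
      fix x assume x: "x \<in> space M"
      have "norm (f (Y i) x - f a x) \<le> g x * norm (Y i - a)"
      proof (rule field_differentiable_bound[of "ball a d" "\<lambda>t. f t x" "\<lambda>t. f' t x"])
        show "((\<lambda>t. f t x) has_real_derivative f' z x) (at z within ball a d)" if "z \<in> ball a d" for z
          using f'[of z x] x that by (auto simp: dist_real_def abs_minus_commute intro: has_field_derivative_at_within)
        show "norm (f' z x) \<le> g x" if "z \<in> ball a d" for z
          using bound[of z x] x that by (auto simp: dist_real_def abs_minus_commute)
      qed (use Y \<open>d > 0\<close> in \<open>auto simp: dist_real_def abs_minus_commute\<close>)
      then show "norm ((f (Y i) x - f a x) / (Y i - a)) \<le> g x"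
        using Y(1)[of i] by (simp add: field_simps abs_divide)
    qed
  qed
  moreover have "(\<integral>x. (f (Y i) x - f a x) / (Y i - a) \<partial>M) = ((\<integral>x. f (Y i) x \<partial>M) - (\<integral>x. f a x \<partial>M)) / (Y i - a)" for i
    using f[OF Y(2)[of i]] f[of a] \<open>d > 0\<close> by simp
  ultimately have "(\<lambda>i. ((\<integral>x. f (X (i + N)) x \<partial>M) - (\<integral>x. f a x \<partial>M)) / (X (i + N) - a)) \<longlonglongrightarrow> (\<integral>x. f' a x \<partial>M)"
    by (simp only: Y_def)
  then show "((\<lambda>t. ((\<integral>x. f t x \<partial>M) - (\<integral>x. f a x \<partial>M)) / (t - a)) \<circ> X) \<longlonglongrightarrow> (\<integral>x. f' a x \<partial>M)"
    unfolding o_def by (rule LIMSEQ_offset)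
qed

text \<open>\<open>partial\<close> is a \<open>deriv\<close> and by itself does not assert
  differentiability; the relational form does, and so admits sum, product and chain rules.\<close>

definition has_partial :: "'n::finite \<Rightarrow> (real^'n \<Rightarrow> real) \<Rightarrow> real \<Rightarrow> real^'n \<Rightarrow> bool" where
  "has_partial i u D z \<longleftrightarrow> ((\<lambda>t. u (z + t *\<^sub>R axis i 1)) has_real_derivative D) (at 0)"

lemma has_partial_imp_partial: "has_partial i u D z \<Longrightarrow> partial i u z = D"
  unfolding has_partial_def partial_def by (rule DERIV_imp_deriv)

lemma has_partial_line:
  assumes "has_partial i u D (z + t *\<^sub>R axis i 1)"
  shows "((\<lambda>t. u (z + t *\<^sub>R axis i 1)) has_real_derivative D) (at t)"
proof -
  have "((\<lambda>s. u (z + (s + t) *\<^sub>R axis i 1)) has_real_derivative D) (at 0)"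
    using assms unfolding has_partial_def by (simp add: algebra_simps)
  then show ?thesis
    using DERIV_shift[of "\<lambda>t. u (z + t *\<^sub>R axis i 1)" D 0 t] by simp
qed

lemma has_partial_const [intro]: "has_partial i (\<lambda>_. c) 0 z"
  by (simp add: has_partial_def)

lemma has_partial_coord [intro]: "has_partial i (\<lambda>z. z $ i) 1 z"
  unfolding has_partial_def by (auto intro!: derivative_eq_intros)

lemma has_partial_inner [intro]: "has_partial i (\<lambda>z. z \<bullet> \<xi>) (\<xi> $ i) z"
  unfolding has_partial_def
  by (auto intro!: derivative_eq_intros simp: inner_add_left inner_axis')

lemma has_partial_norm [intro]:
  assumes "z \<noteq> 0"
  shows "has_partial i norm (z $ i / norm z) z"
proof -
  have "((\<lambda>t. sqrt ((z + t *\<^sub>R axis i 1) \<bullet> (z + t *\<^sub>R axis i 1))) has_real_derivative z $ i / norm z) (at 0)"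
    using assms
    by (auto intro!: derivative_eq_intros simp: inner_add_left inner_add_right inner_axis' inner_axis
        norm_eq_sqrt_inner divide_simps simp flip: inner_gt_zero_iff)
  then show ?thesis unfolding has_partial_def norm_eq_sqrt_inner .
qed

lemma has_partial_add:
  "has_partial i u D z \<Longrightarrow> has_partial i v E z \<Longrightarrow> has_partial i (\<lambda>z. u z + v z) (D + E) z"
  unfolding has_partial_def by (rule DERIV_add)

lemma has_partial_diff:
  "has_partial i u D z \<Longrightarrow> has_partial i v E z \<Longrightarrow> has_partial i (\<lambda>z. u z - v z) (D - E) z"
  unfolding has_partial_def by (rule DERIV_diff)

lemma has_partial_mult:
  "has_partial i u D z \<Longrightarrow> has_partial i v E z \<Longrightarrow> has_partial i (\<lambda>z. u z * v z) (D * v z + E * u z) z"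
  unfolding has_partial_def by (drule (1) DERIV_mult) simp

lemma has_partial_divide:
  "has_partial i u D z \<Longrightarrow> has_partial i v E z \<Longrightarrow> v z \<noteq> 0 \<Longrightarrow>
    has_partial i (\<lambda>z. u z / v z) ((D * v z - u z * E) / (v z * v z)) z"
  unfolding has_partial_def by (drule (1) DERIV_divide) simp_all

lemma has_partial_compose:
  "(f has_real_derivative f') (at (u z)) \<Longrightarrow> has_partial i u D z \<Longrightarrow> has_partial i (\<lambda>z. f (u z)) (f' * D) z"
  unfolding has_partial_def by (rule DERIV_chain2) auto

text \<open>First partials are demanded on the whole punctured space, second ones at
  \<open>z\<close> only: the outer derivative sees \<open>partial i u\<close> on a short segment
  through \<open>z\<close>, which avoids the origin.\<close>

lemma neg_laplacian_eqI:
  assumes u: "\<And>i z. z \<noteq> 0 \<Longrightarrow> has_partial i u (u1 i z) z"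
    and u1: "\<And>i. has_partial i (u1 i) (u2 i) z" and "z \<noteq> 0"
  shows "neg_laplacian u z = - (\<Sum>i\<in>UNIV. u2 i)"
proof -
  have "partial i (partial i u) z = u2 i" for i
  proof -
    have ev: "\<forall>\<^sub>F t in nhds 0. z + t *\<^sub>R axis i (1::real) \<noteq> 0"
    proof -
      have "open {t. z + t *\<^sub>R axis i (1::real) \<noteq> 0}"
        by (intro open_Collect_neq continuous_intros)
      then show ?thesis using \<open>z \<noteq> 0\<close> by (auto simp: eventually_nhds)
    qed
    have "partial i (partial i u) z = partial i (u1 i) z"
      unfolding partial_def[of i _ z]
      by (rule deriv_cong_ev)
        (use ev in \<open>auto elim!: eventually_mono intro: has_partial_imp_partial[OF u]\<close>)
    then show ?thesis using has_partial_imp_partial[OF u1] by simp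
  qed
  then show ?thesis by (simp add: neg_laplacian_def)
qed

lemma neg_laplacian_cong:
  assumes "\<And>z. z \<noteq> 0 \<Longrightarrow> u z = v z" "z \<noteq> 0"
  shows "neg_laplacian u z = neg_laplacian v z"
proof -
  have ev: "\<forall>\<^sub>F t in nhds 0. y + t *\<^sub>R axis i (1::real) \<noteq> 0" if "y \<noteq> 0" for y :: "real^'a" and i
  proof -
    have "open {t. y + t *\<^sub>R axis i (1::real) \<noteq> 0}"
      by (intro open_Collect_neq continuous_intros)
    then show ?thesis using \<open>y \<noteq> 0\<close> by (auto simp: eventually_nhds)
  qed
  have *: "partial i u y = partial i v y" if "y \<noteq> 0" "\<And>z. z \<noteq> 0 \<Longrightarrow> u z = v z" for y :: "real^'a" and i u v
    unfolding partial_def by (rule deriv_cong_ev) (use that(2) in \<open>auto intro: eventually_mono[OF ev[OF that(1)]]\<close>)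
  show ?thesis unfolding neg_laplacian_def
    using assms by (auto intro!: sum.cong *)
qed

lemma borel_measurable_surface_measureI:
  fixes f :: "'a::euclidean_space \<Rightarrow> real"
  assumes "continuous_on (sphere 0 1) f"
  shows "f \<in> borel_measurable surface_measure"
  unfolding measurable_cong_sets[OF sets_surface_measure refl]
  by (rule borel_measurable_continuous_on_restrict[OF assms])

lemma integrable_surface_measure_mult:
  fixes f :: "'a::euclidean_space \<Rightarrow> real"
  assumes f: "continuous_on (sphere 0 1) f" and w: "integrable surface_measure w"
  shows "integrable surface_measure (\<lambda>x. w x * f x)"
proof -
  have "compact (f ` sphere 0 1)"
    by (intro compact_continuous_image f compact_sphere)
  then obtain B where B: "\<And>x. x \<in> sphere 0 1 \<Longrightarrow> norm (f x) \<le> B"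
    using compact_imp_bounded bounded_iff by (metis imageI)
  show ?thesis
  proof (rule Bochner_Integration.integrable_bound)
    show "integrable surface_measure (\<lambda>x. B * w x)" using w by simp
    show "(\<lambda>x. w x * f x) \<in> borel_measurable surface_measure"
      using borel_measurable_surface_measureI[OF f] w by measurable
    show "AE x in surface_measure. norm (w x * f x) \<le> norm (B * w x)"
      by (rule AE_I2) (use B in \<open>auto simp: abs_mult mult.commute[of B] intro!: mult_left_mono intro: order_trans[OF _ abs_ge_self]\<close>)
  qed
qed

text \<open>The weight \<open>w\<close>, later the singular kernel, is merely integrable but does
  not depend on \<open>z\<close>. The other factor is jointly continuous, hence its derivative is
  bounded on a compact product, and a multiple of \<open>\<bar>w\<bar>\<close> dominates.\<close>

lemma has_partial_surface_integral:
  fixes \<Psi> \<Psi>' :: "real^'n::finite \<Rightarrow> real^'n \<Rightarrow> real"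
  assumes w: "integrable surface_measure w"
    and \<Psi>: "continuous_on ((- {0}) \<times> sphere 0 1) (\<lambda>(z, \<xi>). \<Psi> z \<xi>)"
    and \<Psi>': "continuous_on ((- {0}) \<times> sphere 0 1) (\<lambda>(z, \<xi>). \<Psi>' z \<xi>)"
    and deriv: "\<And>z \<xi>. z \<noteq> 0 \<Longrightarrow> norm \<xi> = 1 \<Longrightarrow> has_partial i (\<lambda>z. \<Psi> z \<xi>) (\<Psi>' z \<xi>) z"
    and "z \<noteq> 0"
  shows "has_partial i (\<lambda>z. LINT \<xi>|surface_measure. w \<xi> * \<Psi> z \<xi>) (LINT \<xi>|surface_measure. w \<xi> * \<Psi>' z \<xi>) z"
  unfolding has_partial_def
proof -
  \<comment> \<open>Half the norm keeps the closed ball \<open>cball z d\<close> away from the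
    origin.\<close>
  define d where "d = norm z / 2"
  have "d > 0" using \<open>z \<noteq> 0\<close> by (simp add: d_def)
  let ?K = "cball z d \<times> sphere (0::real^'n) 1"
  have "cball z d \<subseteq> - {0}"
    using \<open>z \<noteq> 0\<close> by (auto simp: d_def dist_norm)
  then have "compact ((\<lambda>(z, \<xi>). \<Psi>' z \<xi>) ` ?K)"
    by (intro compact_continuous_image continuous_on_subset[OF \<Psi>'] compact_Times) auto
  then obtain B where B: "\<And>y \<xi>. y \<in> cball z d \<Longrightarrow> norm \<xi> = 1 \<Longrightarrow> norm (\<Psi>' y \<xi>) \<le> B"
    using compact_imp_bounded[of "(\<lambda>(z, \<xi>). \<Psi>' z \<xi>) ` ?K"] unfolding bounded_iff by fastforce
  have line: "z + t *\<^sub>R axis i 1 \<in> cball z d" if "\<bar>t - 0\<bar> < d" for t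
    using that by (simp add: dist_norm)
  then have line0: "z + t *\<^sub>R axis i 1 \<noteq> 0" if "\<bar>t - 0\<bar> < d" for t
    using that \<open>cball z d \<subseteq> - {0}\<close> by blast
  have slice: "continuous_on (sphere 0 1) (\<Phi> y)"
    if "continuous_on ((- {0}) \<times> sphere 0 1) (\<lambda>(z, \<xi>). \<Phi> z \<xi>)" "y \<noteq> 0" for \<Phi> :: "real^'n \<Rightarrow> real^'n \<Rightarrow> real" and y
    using continuous_on_compose2[OF that(1) continuous_on_Pair[OF continuous_on_const continuous_on_id], of y "sphere 0 1"] that(2)
    by auto
  have "((\<lambda>t. LINT \<xi>|surface_measure. w \<xi> * \<Psi> (z + t *\<^sub>R axis i 1) \<xi>) has_real_derivative
      (LINT \<xi>|surface_measure. w \<xi> * \<Psi>' (z + 0 *\<^sub>R axis i 1) \<xi>)) (at 0)"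
  proof (rule has_real_derivative_integral[OF \<open>d > 0\<close>])
    show "integrable surface_measure (\<lambda>\<xi>. w \<xi> * \<Psi> (z + t *\<^sub>R axis i 1) \<xi>)" if "\<bar>t - 0\<bar> < d" for t
      using line0[OF that] by (intro integrable_surface_measure_mult slice \<Psi> w)
    show "((\<lambda>t. w \<xi> * \<Psi> (z + t *\<^sub>R axis i 1) \<xi>) has_real_derivative w \<xi> * \<Psi>' (z + t *\<^sub>R axis i 1) \<xi>) (at t)"
      if "\<bar>t - 0\<bar> < d" "\<xi> \<in> space surface_measure" for t \<xi>
      using that by (intro DERIV_cmult has_partial_line deriv line0) auto
    show "\<bar>w \<xi> * \<Psi>' (z + t *\<^sub>R axis i 1) \<xi>\<bar> \<le> \<bar>w \<xi>\<bar> * B"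
      if "\<bar>t - 0\<bar> < d" "\<xi> \<in> space surface_measure" for t \<xi>
      using B[OF line[OF that(1)], of \<xi>] that by (auto simp: abs_mult intro!: mult_left_mono)
    show "integrable surface_measure (\<lambda>\<xi>. \<bar>w \<xi>\<bar> * B)" using w by simp
    show "(\<lambda>\<xi>. w \<xi> * \<Psi>' (z + 0 *\<^sub>R axis i 1) \<xi>) \<in> borel_measurable surface_measure"
      using line0[of 0] \<open>d > 0\<close>
      by (intro borel_measurable_integrable integrable_surface_measure_mult slice \<Psi>' w) auto
  qed
  then show "((\<lambda>t. LINT \<xi>|surface_measure. w \<xi> * \<Psi> (z + t *\<^sub>R axis i 1) \<xi>) has_real_derivative
      (LINT \<xi>|surface_measure. w \<xi> * \<Psi>' z \<xi>)) (at 0)" by simp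
qed

lemma abs_inner_normalized_le:
  fixes z \<xi> :: "'a::real_inner"
  shows "norm \<xi> = 1 \<Longrightarrow> \<bar>z \<bullet> \<xi> / norm z\<bar> \<le> 1"
  using Cauchy_Schwarz_ineq2[of z \<xi>] by (cases "z = 0") (auto simp: abs_divide)

text \<open>With \<open>s = z \<bullet> \<xi> / norm z\<close> the chain rule needs three facts:
  \<open>\<bar>\<nabla>s\<bar>\<^sup>2 = (1 - s\<^sup>2) / \<bar>z\<bar>\<^sup>2\<close>,
  \<open>\<Delta>s = - (n - 1) s / \<bar>z\<bar>\<^sup>2\<close> and
  \<open>z \<bullet> \<nabla>s = 0\<close>. The first two produce the Laplace-Beltrami operator in
  one coordinate, the third removes the cross terms with the radial factor \<open>A\<close>. The
  summand \<open>D\<close> accommodates the radial terms that come from the logarithm in even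
  dimensions.\<close>

lemma neg_laplacian_surface_integral:
  fixes w :: "real^'n::finite \<Rightarrow> real"
  assumes w: "integrable surface_measure w"
    and f: "\<And>t. \<bar>t\<bar> \<le> 1 \<Longrightarrow> (f has_real_derivative f1 t) (at t)"
    and f1: "\<And>t. \<bar>t\<bar> \<le> 1 \<Longrightarrow> (f1 has_real_derivative f2 t) (at t)"
    and f2: "continuous_on {-1..1} f2"
    and A: "\<And>r. r > 0 \<Longrightarrow> (A has_real_derivative A1 r) (at r)" "\<And>r. r > 0 \<Longrightarrow> (A1 has_real_derivative A2 r) (at r)"
    and D: "\<And>r. r > 0 \<Longrightarrow> (D has_real_derivative D1 r) (at r)" "\<And>r. r > 0 \<Longrightarrow> (D1 has_real_derivative D2 r) (at r)"
    and "z \<noteq> 0"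
  shows "neg_laplacian (\<lambda>z. A (norm z) * (LINT \<xi>|surface_measure. w \<xi> * f (z \<bullet> \<xi> / norm z)) + D (norm z)) z =
    - ((A2 (norm z) + (real CARD('n) - 1) / norm z * A1 (norm z)) * (LINT \<xi>|surface_measure. w \<xi> * f (z \<bullet> \<xi> / norm z)) +
       A (norm z) / (norm z)\<^sup>2 * (LINT \<xi>|surface_measure. w \<xi> *
          ((1 - (z \<bullet> \<xi> / norm z)\<^sup>2) * f2 (z \<bullet> \<xi> / norm z) - (real CARD('n) - 1) * (z \<bullet> \<xi> / norm z) * f1 (z \<bullet> \<xi> / norm z))) +
       D2 (norm z) + (real CARD('n) - 1) / norm z * D1 (norm z))"
proof -
  let ?s = "\<lambda>z \<xi>. z \<bullet> \<xi> / norm (z::real^'n)"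
  define s' where "s' i z \<xi> = \<xi> $ i / norm z - ?s z \<xi> * z $ i / (norm z)\<^sup>2" for i and z \<xi> :: "real^'n"
  define s'' where "s'' i z \<xi> = - 2 * \<xi> $ i * z $ i / norm z ^ 3 + 3 * ?s z \<xi> * (z $ i)\<^sup>2 / norm z ^ 4 - ?s z \<xi> / (norm z)\<^sup>2"
    for i and z \<xi> :: "real^'n"
  define I where "I z = (LINT \<xi>|surface_measure. w \<xi> * f (?s z \<xi>))" for z
  define I1 where "I1 i z = (LINT \<xi>|surface_measure. w \<xi> * (f1 (?s z \<xi>) * s' i z \<xi>))" for i z
  define I2 where "I2 i z = (LINT \<xi>|surface_measure. w \<xi> * (f2 (?s z \<xi>) * (s' i z \<xi>)\<^sup>2 + f1 (?s z \<xi>) * s'' i z \<xi>))" for i z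
  have s_le: "\<bar>?s z \<xi>\<bar> \<le> 1" if "norm \<xi> = 1" for z \<xi> :: "real^'n"
    by (rule abs_inner_normalized_le[OF that])
  have ds: "has_partial i (\<lambda>z. ?s z \<xi>) (s' i z \<xi>) z" if "z \<noteq> 0" for i and z \<xi> :: "real^'n"
  proof -
    have "has_partial i (\<lambda>z. ?s z \<xi>) ((\<xi> $ i * norm z - z \<bullet> \<xi> * (z $ i / norm z)) / (norm z * norm z)) z"
      using that by (intro has_partial_divide has_partial_inner has_partial_norm) auto
    then show ?thesis using that by (simp add: s'_def field_simps power2_eq_square)
  qed
  have ds': "has_partial i (\<lambda>z. s' i z \<xi>) (s'' i z \<xi>) z" if "z \<noteq> 0" for i and z \<xi> :: "real^'n"
  proof -
    have "has_partial i (\<lambda>z. s' i z \<xi>)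
      ((0 * norm z - \<xi> $ i * (z $ i / norm z)) / (norm z * norm z) -
       ((s' i z \<xi> * z $ i + 1 * ?s z \<xi>) * (norm z * norm z) -
         ?s z \<xi> * z $ i * (z $ i / norm z * norm z + z $ i / norm z * norm z)) / (norm z * norm z * (norm z * norm z))) z"
      unfolding s'_def[of _ _ \<xi>, THEN ext] power2_eq_square
      using that ds[OF that, of i \<xi>]
      by (intro has_partial_diff has_partial_divide has_partial_mult has_partial_const has_partial_coord has_partial_norm)
        auto
    then show ?thesis
      by (rule back_subst[of "\<lambda>D. has_partial _ _ D _"])
        (use that in \<open>simp add: s''_def s'_def field_simps power2_eq_square power3_eq_cube power4_eq_xxxx\<close>)
  qed
  let ?U = "(- {0}) \<times> sphere (0::real^'n) 1"
  have cs: "continuous_on ?U (\<lambda>(z, \<xi>). g (?s z \<xi>))" if "continuous_on {-1..1} g" for g :: "real \<Rightarrow> real"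
  proof -
    have "continuous_on ?U (\<lambda>(z, \<xi>). ?s z \<xi>)"
      by (auto simp: case_prod_beta intro!: continuous_intros)
    then have "continuous_on ?U (\<lambda>x. g ((\<lambda>(z, \<xi>). ?s z \<xi>) x))"
      by (rule continuous_on_compose2[OF that]) (use s_le in \<open>auto simp: abs_le_iff minus_le_iff simp del: abs_divide\<close>)
    then show ?thesis by (simp add: case_prod_beta)
  qed
  have cf: "continuous_on {-1..1} f" "continuous_on {-1..1} f1"
    by (rule DERIV_continuous_on[OF has_field_derivative_at_within[OF f]]; simp add: abs_le_iff)
      (rule DERIV_continuous_on[OF has_field_derivative_at_within[OF f1]]; simp add: abs_le_iff)
  have cs': "continuous_on ?U (\<lambda>(z, \<xi>). s' i z \<xi>)" "continuous_on ?U (\<lambda>(z, \<xi>). s'' i z \<xi>)" for i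
    unfolding s'_def s''_def case_prod_beta by (intro continuous_intros; auto)+
  have c1: "continuous_on ?U (\<lambda>(z, \<xi>). f1 (?s z \<xi>) * s' i z \<xi>)" for i
    using continuous_on_mult[OF cs[OF cf(2)] cs'(1)[of i]] by (simp add: case_prod_beta)
  have c2: "continuous_on ?U (\<lambda>(z, \<xi>). f2 (?s z \<xi>) * (s' i z \<xi>)\<^sup>2 + f1 (?s z \<xi>) * s'' i z \<xi>)" for i
    using continuous_on_add[OF continuous_on_mult[OF cs[OF f2] continuous_on_power[OF cs'(1)[of i], of 2]]
        continuous_on_mult[OF cs[OF cf(2)] cs'(2)[of i]]]
    by (simp add: case_prod_beta)
  have dI: "has_partial i I (I1 i z) z" if "z \<noteq> 0" for i z
    unfolding I_def[abs_def] I1_def using that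
    by (intro has_partial_surface_integral w cs cf c1 has_partial_compose f ds s_le)
  have dI1: "has_partial i (I1 i) (I2 i z) z" if "z \<noteq> 0" for i z
    unfolding I1_def[of i, THEN ext] I2_def
  proof (rule has_partial_surface_integral[OF w c1 c2 _ that])
    fix z \<xi> :: "real^'n" assume z: "z \<noteq> 0" "norm \<xi> = 1"
    have "has_partial i (\<lambda>z. f1 (?s z \<xi>) * s' i z \<xi>) (f2 (?s z \<xi>) * s' i z \<xi> * s' i z \<xi> + s'' i z \<xi> * f1 (?s z \<xi>)) z"
      using z by (intro has_partial_mult has_partial_compose f1 s_le ds ds') auto
    then show "has_partial i (\<lambda>z. f1 (?s z \<xi>) * s' i z \<xi>) (f2 (?s z \<xi>) * (s' i z \<xi>)\<^sup>2 + f1 (?s z \<xi>) * s'' i z \<xi>) z"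
      by (simp add: power2_eq_square mult_ac)
  qed
  have slice: "continuous_on (sphere 0 1) (\<Phi> z)"
    if "continuous_on ?U (\<lambda>(z, \<xi>). \<Phi> z \<xi>)" for \<Phi> :: "real^'n \<Rightarrow> real^'n \<Rightarrow> real"
    using continuous_on_compose2[OF that continuous_on_Pair[OF continuous_on_const continuous_on_id], of z "sphere 0 1"] \<open>z \<noteq> 0\<close>
    by auto
  have sums: "(\<Sum>i\<in>UNIV. z $ i * z $ i) = (norm z)\<^sup>2" "(\<Sum>i\<in>UNIV. \<xi> $ i * z $ i) = ?s z \<xi> * norm z"
     for \<xi> :: "real^'n"
    using \<open>z \<noteq> 0\<close> by (simp_all add: power2_norm_eq_inner inner_vec_def mult.commute)
  \<comment> \<open>\<open>s\<close> is constant along rays, so its gradient is orthogonal to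
    \<open>z\<close>.\<close>
  have zI1: "(\<Sum>i\<in>UNIV. z $ i * I1 i z) = 0"
  proof -
    have "(\<Sum>i\<in>UNIV. z $ i * I1 i z) = (LINT \<xi>|surface_measure. (\<Sum>i\<in>UNIV. z $ i * (w \<xi> * (f1 (?s z \<xi>) * s' i z \<xi>))))"
      unfolding I1_def using integrable_surface_measure_mult[OF slice[OF c1] w]
      by (subst Bochner_Integration.integral_sum) auto
    also have "\<dots> = (LINT \<xi>|surface_measure. w \<xi> * f1 (?s z \<xi>) * (\<Sum>i\<in>UNIV. z $ i * s' i z \<xi>))"
      by (simp add: sum_distrib_left mult_ac)
    finally have *: "(\<Sum>i\<in>UNIV. z $ i * I1 i z) = \<dots>" .
    have "(\<Sum>i\<in>UNIV. z $ i * s' i z \<xi>) = 0" for \<xi>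
    proof -
      have "(\<Sum>i\<in>UNIV. z $ i * s' i z \<xi>) =
          (\<Sum>i\<in>UNIV. \<xi> $ i * z $ i) / norm z - ?s z \<xi> / (norm z)\<^sup>2 * (\<Sum>i\<in>UNIV. z $ i * z $ i)"
        by (simp add: s'_def sum_subtractf sum_distrib_left sum_divide_distrib algebra_simps)
      then show ?thesis using \<open>z \<noteq> 0\<close> unfolding sums by simp
    qed
    then show ?thesis unfolding * by simp
  qed
  have sI2: "(\<Sum>i\<in>UNIV. I2 i z) = (LINT \<xi>|surface_measure. w \<xi> *
      ((1 - (?s z \<xi>)\<^sup>2) * f2 (?s z \<xi>) - (real CARD('n) - 1) * ?s z \<xi> * f1 (?s z \<xi>))) / (norm z)\<^sup>2"
  proof -
    have "(\<Sum>i\<in>UNIV. I2 i z) = (LINT \<xi>|surface_measure. (\<Sum>i\<in>UNIV. w \<xi> * (f2 (?s z \<xi>) * (s' i z \<xi>)\<^sup>2 + f1 (?s z \<xi>) * s'' i z \<xi>)))"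
      unfolding I2_def using integrable_surface_measure_mult[OF slice[OF c2] w]
      by (subst Bochner_Integration.integral_sum) auto
    also have "\<dots> = (LINT \<xi>|surface_measure. w \<xi> *
      ((1 - (?s z \<xi>)\<^sup>2) * f2 (?s z \<xi>) - (real CARD('n) - 1) * ?s z \<xi> * f1 (?s z \<xi>)) / (norm z)\<^sup>2)"
    proof (rule Bochner_Integration.integral_cong)
      fix \<xi> :: "real^'n" assume "\<xi> \<in> space surface_measure"
      then have x1: "(\<Sum>i\<in>UNIV. \<xi> $ i * \<xi> $ i) = 1"
        using power2_norm_eq_inner[of \<xi>] by (simp add: inner_vec_def)
      define \<rho> where "\<rho> = norm z"
      have "\<rho> \<noteq> 0" using \<open>z \<noteq> 0\<close> by (simp add: \<rho>_def)
      define s where "s = ?s z \<xi>"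
      have s'_eq: "s' i z \<xi> = \<xi> $ i / \<rho> - s * z $ i / \<rho>\<^sup>2"
        and s''_eq: "s'' i z \<xi> = - 2 * \<xi> $ i * z $ i / \<rho> ^ 3 + 3 * s * (z $ i)\<^sup>2 / \<rho> ^ 4 - s / \<rho>\<^sup>2" for i
        by (simp_all add: s'_def s''_def s_def \<rho>_def)
      have sums': "(\<Sum>i\<in>UNIV. z $ i * z $ i) = \<rho>\<^sup>2" "(\<Sum>i\<in>UNIV. \<xi> $ i * z $ i) = s * \<rho>"
        using sums(1) sums(2)[of \<xi>] by (simp_all only: s_def \<rho>_def)
      have "(\<Sum>i\<in>UNIV. (s' i z \<xi>)\<^sup>2) = (\<Sum>i\<in>UNIV. \<xi> $ i * \<xi> $ i) / \<rho>\<^sup>2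
          - 2 * s / \<rho> ^ 3 * (\<Sum>i\<in>UNIV. \<xi> $ i * z $ i) + s\<^sup>2 / \<rho> ^ 4 * (\<Sum>i\<in>UNIV. z $ i * z $ i)"
        unfolding s'_eq sum_distrib_left sum_divide_distrib
          sum_subtractf[symmetric] sum.distrib[symmetric]
        by (rule sum.cong) (use \<open>\<rho> \<noteq> 0\<close> in \<open>auto simp: field_simps power2_eq_square power3_eq_cube power4_eq_xxxx\<close>)
      also have "\<dots> = (1 - s\<^sup>2) / \<rho>\<^sup>2"
        unfolding x1 sums' using \<open>\<rho> \<noteq> 0\<close>
        by (simp add: field_simps power2_eq_square power3_eq_cube power4_eq_xxxx)
      finally have 1: "(\<Sum>i\<in>UNIV. (s' i z \<xi>)\<^sup>2) = (1 - s\<^sup>2) / \<rho>\<^sup>2" .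
      have "(\<Sum>i\<in>UNIV. s'' i z \<xi>) = - 2 / \<rho> ^ 3 * (\<Sum>i\<in>UNIV. \<xi> $ i * z $ i)
          + 3 * s / \<rho> ^ 4 * (\<Sum>i\<in>UNIV. z $ i * z $ i) - (\<Sum>i\<in>(UNIV::'n set). s / \<rho>\<^sup>2)"
        unfolding s''_eq sum_distrib_left sum_divide_distrib
          sum_subtractf[symmetric] sum.distrib[symmetric]
        by (rule sum.cong) (auto simp: power2_eq_square)
      also have "\<dots> = - (real CARD('n) - 1) * s / \<rho>\<^sup>2"
        unfolding sums' using \<open>\<rho> \<noteq> 0\<close>
        by (simp add: field_simps power2_eq_square power3_eq_cube power4_eq_xxxx)
      finally have 2: "(\<Sum>i\<in>UNIV. s'' i z \<xi>) = - (real CARD('n) - 1) * s / \<rho>\<^sup>2" .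
      have "(\<Sum>i\<in>UNIV. w \<xi> * (f2 s * (s' i z \<xi>)\<^sup>2 + f1 s * s'' i z \<xi>)) =
          w \<xi> * (f2 s * (\<Sum>i\<in>UNIV. (s' i z \<xi>)\<^sup>2) + f1 s * (\<Sum>i\<in>UNIV. s'' i z \<xi>))"
        by (simp only: sum_distrib_left[symmetric] sum.distrib)
      also have "\<dots> = w \<xi> * ((1 - s\<^sup>2) * f2 s - (real CARD('n) - 1) * s * f1 s) / \<rho>\<^sup>2"
        unfolding 1 2 using \<open>\<rho> \<noteq> 0\<close> by (simp add: field_simps)
      finally show "(\<Sum>i\<in>UNIV. w \<xi> * (f2 (?s z \<xi>) * (s' i z \<xi>)\<^sup>2 + f1 (?s z \<xi>) * s'' i z \<xi>)) =
        w \<xi> * ((1 - (?s z \<xi>)\<^sup>2) * f2 (?s z \<xi>) - (real CARD('n) - 1) * ?s z \<xi> * f1 (?s z \<xi>)) / (norm z)\<^sup>2"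
        by (simp add: s_def \<rho>_def)
    qed simp
    finally show ?thesis by simp
  qed
  define J where "J = (LINT \<xi>|surface_measure. w \<xi> *
      ((1 - (?s z \<xi>)\<^sup>2) * f2 (?s z \<xi>) - (real CARD('n) - 1) * ?s z \<xi> * f1 (?s z \<xi>)))"
  define u1 where "u1 i z = (A1 (norm z) * (z $ i / norm z)) * I z + I1 i z * A (norm z) + D1 (norm z) * (z $ i / norm z)" for i z
  \<comment> \<open>This is the second partial derivative of \<open>norm\<close> in direction
    \<open>i\<close>; the sum over \<open>i\<close> is \<open>(n - 1) / norm z\<close>.\<close>
  define q where "q i = (1 * norm z - z $ i * (z $ i / norm z)) / (norm z * norm z)" for i
  define u2 where "u2 i = ((A2 (norm z) * (z $ i / norm z)) * (z $ i / norm z) + q i * A1 (norm z)) * I z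
      + I1 i z * (A1 (norm z) * (z $ i / norm z))
      + (I2 i z * A (norm z) + (A1 (norm z) * (z $ i / norm z)) * I1 i z)
      + ((D2 (norm z) * (z $ i / norm z)) * (z $ i / norm z) + q i * D1 (norm z))" for i
  have "neg_laplacian (\<lambda>z. A (norm z) * I z + D (norm z)) z = - (\<Sum>i\<in>UNIV. u2 i)"
  proof (rule neg_laplacian_eqI[where ?u1.0 = u1])
    show "has_partial i (\<lambda>z. A (norm z) * I z + D (norm z)) (u1 i z) z" if "z \<noteq> 0" for i z
      unfolding u1_def using that
      by (intro has_partial_add has_partial_mult has_partial_compose[where u = norm] A D dI has_partial_norm) auto
    show "has_partial i (u1 i) (u2 i) z" for i
      unfolding u1_def[of i, THEN ext] u2_def q_def using \<open>z \<noteq> 0\<close>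
      by (intro has_partial_add has_partial_mult has_partial_compose[where u = norm] A D dI dI1 has_partial_norm
        has_partial_divide has_partial_coord) auto
  qed fact
  also have "(\<Sum>i\<in>UNIV. u2 i) = (A2 (norm z) * I z + D2 (norm z)) / (norm z)\<^sup>2 * (\<Sum>i\<in>UNIV. z $ i * z $ i)
      + (A1 (norm z) * I z + D1 (norm z)) * (\<Sum>i\<in>UNIV. q i)
      + A (norm z) * (\<Sum>i\<in>UNIV. I2 i z) + 2 * A1 (norm z) / norm z * (\<Sum>i\<in>UNIV. z $ i * I1 i z)"
    unfolding sum_distrib_left sum.distrib[symmetric]
    by (rule sum.cong) (use \<open>z \<noteq> 0\<close> in \<open>auto simp: u2_def field_simps power2_eq_square\<close>)
  also have "(\<Sum>i\<in>UNIV. q i) = (real CARD('n) - 1) / norm z"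
  proof -
    have "(\<Sum>i\<in>UNIV. q i) = (\<Sum>i\<in>(UNIV::'n set). 1 / norm z) - 1 / norm z ^ 3 * (\<Sum>i\<in>UNIV. z $ i * z $ i)"
      unfolding sum_distrib_left sum_subtractf[symmetric]
      by (rule sum.cong) (use \<open>z \<noteq> 0\<close> in \<open>auto simp: q_def field_simps power3_eq_cube\<close>)
    then show ?thesis unfolding sums using \<open>z \<noteq> 0\<close>
      by (simp add: field_simps power2_eq_square power3_eq_cube)
  qed
  finally have "neg_laplacian (\<lambda>z. A (norm z) * I z + D (norm z)) z =
    - ((A2 (norm z) + (real CARD('n) - 1) / norm z * A1 (norm z)) * I z + A (norm z) / (norm z)\<^sup>2 * J
       + D2 (norm z) + (real CARD('n) - 1) / norm z * D1 (norm z))"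
    unfolding zI1 sI2 sums(1) J_def[symmetric]
    by (rule trans) (use \<open>z \<noteq> 0\<close> in \<open>simp add: field_simps power2_eq_square\<close>)
  then show ?thesis unfolding I_def J_def .
qed

section \<open>Functions of one coordinate on the sphere\<close>

lemma DERIV_imp_continuous_on: "(\<And>x. (f has_real_derivative f' x) (at x)) \<Longrightarrow> continuous_on A f"
  by (intro continuous_at_imp_continuous_on ballI DERIV_isCont)

primrec times_differentiable :: "nat \<Rightarrow> (real \<Rightarrow> real) \<Rightarrow> bool" where
  "times_differentiable 0 f \<longleftrightarrow> continuous_on UNIV f"
| "times_differentiable (Suc k) f \<longleftrightarrow>
     (\<exists>f'. (\<forall>x. (f has_real_derivative f' x) (at x)) \<and> times_differentiable k f')"

lemma times_differentiable_SucI: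
  "(\<And>x. (f has_real_derivative f' x) (at x)) \<Longrightarrow> times_differentiable k f' \<Longrightarrow> times_differentiable (Suc k) f"
  by auto

definition smooth :: "(real \<Rightarrow> real) \<Rightarrow> bool" where
  "smooth f \<longleftrightarrow> (\<forall>k. times_differentiable k f)"

lemma times_differentiable_Suc_imp: "times_differentiable (Suc k) f \<Longrightarrow> times_differentiable k f"
proof (induction k arbitrary: f)
  case 0
  then show ?case
    by (auto intro: DERIV_imp_continuous_on)
qed auto

lemma smooth_DERIV: "smooth f \<Longrightarrow> (f has_real_derivative deriv f x) (at x)"
  unfolding smooth_def using times_differentiable.simps(2)[of 0 f] by (metis DERIV_imp_deriv)

lemma smoothI:
  assumes "\<And>x. (f has_real_derivative f' x) (at x)" "smooth f'"
  shows "smooth f"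
  unfolding smooth_def
proof
  fix k
  have "times_differentiable (Suc k) f" using assms by (auto simp: smooth_def)
  then show "times_differentiable k f" by (rule times_differentiable_Suc_imp)
qed

lemma smooth_deriv: "smooth f \<Longrightarrow> smooth (deriv f)"
  unfolding smooth_def
proof
  fix k assume "\<forall>k. times_differentiable k f"
  then obtain f' where f': "\<And>x. (f has_real_derivative f' x) (at x)" "times_differentiable k f'"
    using times_differentiable.simps(2)[of k f] by blast
  then have "deriv f = f'" by (auto intro: DERIV_imp_deriv)
  then show "times_differentiable k (deriv f)" using f' by simp
qed

lemma smooth_continuous: "smooth f \<Longrightarrow> continuous_on A f"
  unfolding smooth_def by (metis continuous_on_subset subset_UNIV times_differentiable.simps(1))

lemma smooth_funpow_deriv: "smooth f \<Longrightarrow> smooth ((deriv ^^ k) f)"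
  by (induction k) (auto intro: smooth_deriv)

lemma times_differentiable_const: "times_differentiable k (\<lambda>_. c)"
  by (induction k arbitrary: c) (auto intro!: exI[of _ "\<lambda>_. 0"])

lemma smooth_const [intro, simp]: "smooth (\<lambda>_. c)"
  by (simp add: smooth_def times_differentiable_const)

lemma smooth_ident [intro, simp]: "smooth (\<lambda>x. x)"
  by (rule smoothI[of _ "\<lambda>_. 1"]) auto

lemma times_differentiable_add:
  "times_differentiable k f \<Longrightarrow> times_differentiable k g \<Longrightarrow> times_differentiable k (\<lambda>x. f x + g x)"
proof (induction k arbitrary: f g)
  case (Suc k)
  then obtain f' g' where "\<And>x. (f has_real_derivative f' x) (at x)" "times_differentiable k f'"
    "\<And>x. (g has_real_derivative g' x) (at x)" "times_differentiable k g'" by auto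
  then show ?case using Suc.IH by (auto intro!: exI[of _ "\<lambda>x. f' x + g' x"] derivative_eq_intros)
qed (auto intro: continuous_intros)

lemma times_differentiable_mult:
  "times_differentiable k f \<Longrightarrow> times_differentiable k g \<Longrightarrow> times_differentiable k (\<lambda>x. f x * g x)"
proof (induction k arbitrary: f g)
  case (Suc k)
  then obtain f' g' where "\<And>x. (f has_real_derivative f' x) (at x)" "times_differentiable k f'"
    "\<And>x. (g has_real_derivative g' x) (at x)" "times_differentiable k g'" by auto
  moreover have "times_differentiable k f" "times_differentiable k g"
    using Suc.prems by (auto simp del: times_differentiable.simps intro: times_differentiable_Suc_imp)
  ultimately show ?case
    using Suc.IH by (auto intro!: exI[of _ "\<lambda>x. f' x * g x + f x * g' x"] times_differentiable_add derivative_eq_intros)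
qed (auto intro: continuous_intros)

lemma smooth_add [intro]: "smooth f \<Longrightarrow> smooth g \<Longrightarrow> smooth (\<lambda>x. f x + g x)"
  by (simp add: smooth_def times_differentiable_add)

lemma smooth_mult [intro]: "smooth f \<Longrightarrow> smooth g \<Longrightarrow> smooth (\<lambda>x. f x * g x)"
  by (simp add: smooth_def times_differentiable_mult)

lemma smooth_minus [intro]: "smooth f \<Longrightarrow> smooth (\<lambda>x. - f x)"
  using smooth_mult[of "\<lambda>_. - 1" f] by simp

lemma smooth_diff [intro]: "smooth f \<Longrightarrow> smooth g \<Longrightarrow> smooth (\<lambda>x. f x - g x)"
  using smooth_add[of f "\<lambda>x. - g x"] by auto

lemma smooth_power [intro]: "smooth f \<Longrightarrow> smooth (\<lambda>x. f x ^ n)"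
  by (induction n) auto

lemma smooth_poly: "smooth f \<Longrightarrow> smooth (\<lambda>x. poly P (f x))"
  by (induction P) auto

text \<open>Bootstrapping: if \<open>f\<close> is \<open>k\<close> times differentiable, so is its
  derivative \<open>f * h\<close>, and \<open>f\<close> gains one order. It serves for real powers,
  whose derivative contains the power itself.\<close>

lemma smooth_DERIV_mult_self:
  assumes "\<And>x. (f has_real_derivative f x * h x) (at x)" "smooth h"
  shows "smooth f"
  unfolding smooth_def
proof
  show "times_differentiable k f" for k
  proof (induction k)
    case 0
    then show ?case using DERIV_imp_continuous_on[OF assms(1)] by simp
  next
    case (Suc k)
    then have "times_differentiable k (\<lambda>x. f x * h x)"
      using assms(2) by (intro times_differentiable_mult) (auto simp: smooth_def)
    then show ?case using assms(1) by (intro times_differentiable_SucI)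
  qed
qed

lemma smooth_inverse:
  assumes "smooth g" "\<And>x. g x \<noteq> 0"
  shows "smooth (\<lambda>x. inverse (g x))"
  unfolding smooth_def
proof
  show "times_differentiable k (\<lambda>x. inverse (g x))" for k
  proof (induction k)
    case 0
    then show ?case using assms by (simp add: continuous_on_inverse smooth_continuous)
  next
    case (Suc k)
    have "times_differentiable k (\<lambda>x. (- 1) * deriv g x * (inverse (g x) * inverse (g x)))"
      using Suc smooth_deriv[OF assms(1)]
      by (intro times_differentiable_mult times_differentiable_const) (auto simp: smooth_def)
    moreover have "((\<lambda>x. inverse (g x)) has_real_derivative (- 1) * deriv g x * (inverse (g x) * inverse (g x))) (at x)" for x
      using DERIV_inverse_fun[OF smooth_DERIV[OF assms(1)] assms(2)] by (simp add: mult_ac)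
    ultimately show ?case by (rule times_differentiable_SucI[rotated])
  qed
qed

section \<open>The Euler operator and the spherical Laplacian in one coordinate\<close>

definition euler :: "(real \<Rightarrow> real) \<Rightarrow> real \<Rightarrow> real" where
  "euler f t = t * deriv f t"

text \<open>The Laplace--Beltrami operator of the unit sphere of dimension \<open>N - 1\<close> on functions of one coordinate.\<close>

definition axial_laplacian :: "real \<Rightarrow> (real \<Rightarrow> real) \<Rightarrow> real \<Rightarrow> real" where
  "axial_laplacian N f t = (1 - t\<^sup>2) * deriv (deriv f) t - (N - 1) * t * deriv f t"

lemma smooth_euler: "smooth f \<Longrightarrow> smooth (euler f)"
  unfolding euler_def[abs_def] by (intro smooth_mult smooth_ident smooth_deriv)

lemma smooth_axial_laplacian: "smooth f \<Longrightarrow> smooth (axial_laplacian N f)"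
  unfolding axial_laplacian_def[abs_def]
  by (intro smooth_mult smooth_diff smooth_power smooth_const smooth_ident smooth_deriv)

lemma deriv_add_smooth: "smooth f \<Longrightarrow> smooth g \<Longrightarrow> deriv (\<lambda>x. f x + g x) = (\<lambda>x. deriv f x + deriv g x)"
  by (auto intro!: DERIV_imp_deriv derivative_eq_intros smooth_DERIV)

lemma deriv_cmult_smooth: "smooth f \<Longrightarrow> deriv (\<lambda>x. c * f x) = (\<lambda>x. c * deriv f x)"
  by (auto intro!: DERIV_imp_deriv derivative_eq_intros smooth_DERIV)

lemma euler_funpow_deriv:
  assumes "smooth f"
  shows "t * deriv ((deriv ^^ j) f) t = (deriv ^^ j) (euler f) t - real j * (deriv ^^ j) f t"
proof (induction j arbitrary: t)
  case (Suc j)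
  have "(deriv ^^ j) (euler f) = (\<lambda>t. t * deriv ((deriv ^^ j) f) t + real j * (deriv ^^ j) f t)"
    using Suc by (auto simp: algebra_simps)
  then have "deriv ((deriv ^^ j) (euler f)) = deriv (\<lambda>t. t * deriv ((deriv ^^ j) f) t + real j * (deriv ^^ j) f t)"
    by simp
  also have "\<dots> = (\<lambda>t. deriv ((deriv ^^ j) f) t + t * deriv (deriv ((deriv ^^ j) f)) t + real j * deriv ((deriv ^^ j) f) t)"
    using smooth_funpow_deriv[OF assms, of j]
    by (auto intro!: DERIV_imp_deriv derivative_eq_intros smooth_DERIV smooth_deriv)
  finally show ?case by (simp add: algebra_simps)
qed (simp add: euler_def)

lemma funpow_deriv_add: "smooth f \<Longrightarrow> smooth g \<Longrightarrow> (deriv ^^ j) (\<lambda>x. f x + g x) = (\<lambda>x. (deriv ^^ j) f x + (deriv ^^ j) g x)"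
  by (induction j) (auto simp: deriv_add_smooth smooth_funpow_deriv)

lemma funpow_deriv_cmult: "smooth f \<Longrightarrow> (deriv ^^ j) (\<lambda>x. c * f x) = (\<lambda>x. c * (deriv ^^ j) f x)"
  by (induction j) (auto simp: deriv_cmult_smooth smooth_funpow_deriv)

lemma ex_antiderivative:
  fixes g :: "real \<Rightarrow> real"
  assumes "continuous_on UNIV g"
  shows "\<exists>P. \<forall>t. (P has_real_derivative g t) (at t)"
proof -
  define P where "P t = integral {0..t} g - integral {t..0} g" for t
  have int: "g integrable_on {a..b}" for a b
    using assms by (intro integrable_continuous_interval) (auto intro: continuous_on_subset)
  have P: "P t = integral {- B..t} g - integral {- B..0} g" if "- B \<le> t" "0 \<le> B" for t B
  proof (cases "0 \<le> t")
    case True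
    then show ?thesis
      using Henstock_Kurzweil_Integration.integral_combine[of "- B" 0 t g] int that
      by (cases "t = 0") (auto simp: P_def)
  next
    case False
    then show ?thesis
      using Henstock_Kurzweil_Integration.integral_combine[of "- B" t 0 g] int that by (auto simp: P_def)
  qed
  have "(P has_real_derivative g t) (at t)" for t
  proof -
    define B where "B = \<bar>t\<bar> + 1"
    have B: "- B < t" "t < B" "0 \<le> B" by (auto simp: B_def)
    have "((\<lambda>t. integral {- B..t} g) has_real_derivative g t) (at t within {- B..B})"
      using assms B by (intro integral_has_real_derivative) (auto intro: continuous_on_subset)
    then have "((\<lambda>t. integral {- B..t} g) has_real_derivative g t) (at t)"
      using B by (subst (asm) at_within_interior) auto
    then have "((\<lambda>t. integral {- B..t} g - integral {- B..0} g) has_real_derivative g t - 0) (at t)"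
      by (intro DERIV_diff) auto
    moreover have "\<forall>\<^sub>F s in nhds t. P s = integral {- B..s} g - integral {- B..0} g"
      using eventually_nhds_in_open[of "{- B<..}" t] B by (auto intro: P elim!: eventually_mono)
    ultimately show ?thesis using DERIV_cong_ev[OF refl _ refl] by force
  qed
  then show ?thesis by blast
qed

lemma coord_in_unit: "norm \<xi> = 1 \<Longrightarrow> \<xi> $ p \<in> {-1..1}" for \<xi> :: "real^'n::finite"
  using component_le_norm_cart[of \<xi> p] by (auto simp: abs_le_iff)

text \<open>The plain integral, not divided by the total mass. The dimension of the sphere is
  carried by the type of \<open>p\<close>.\<close>

definition axial_mean :: "'n::finite \<Rightarrow> (real \<Rightarrow> real) \<Rightarrow> real" where
  "axial_mean p f = (LINT \<xi>|(surface_measure :: (real^'n) measure). f (\<xi> $ p))"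

lemma integrable_surface_measure_const: "integrable (surface_measure :: 'a::euclidean_space measure) (\<lambda>_. c::real)"
  using finite_measure.integrable_const[OF finite_measure_surface_measure] .

lemma integrable_axial_mult:
  fixes p :: "'n::finite" and f :: "real \<Rightarrow> real"
  assumes "integrable surface_measure (\<lambda>\<xi>. w (\<xi> $ p))" "continuous_on {-1..1} f"
  shows "integrable (surface_measure :: (real^'n) measure) (\<lambda>\<xi>. w (\<xi> $ p) * f (\<xi> $ p))"
proof (rule integrable_surface_measure_mult[where f = "\<lambda>\<xi>. f (\<xi> $ p)", OF _ assms(1)])
  show "continuous_on (sphere 0 1) (\<lambda>\<xi>::real^'n. f (\<xi> $ p))"
    by (rule continuous_on_compose2[OF assms(2)]) (auto intro!: continuous_intros image_subsetI coord_in_unit simp del: atLeastAtMost_iff)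
qed

lemma integrable_axial:
  fixes p :: "'n::finite" and f :: "real \<Rightarrow> real"
  assumes "continuous_on {-1..1} f"
  shows "integrable (surface_measure :: (real^'n) measure) (\<lambda>\<xi>. f (\<xi> $ p))"
  using integrable_axial_mult[where w = "\<lambda>_. 1" and p = p, OF integrable_surface_measure_const[of 1] assms] by simp

lemma integral_surface_measure_normalized_inner:
  fixes z :: "real^'n::finite" and p :: 'n and f :: "real \<Rightarrow> real"
  assumes "z \<noteq> 0" "continuous_on UNIV f"
  shows "(LINT \<xi>|surface_measure. f (z \<bullet> \<xi> / norm z)) = axial_mean p f"
proof -
  have "(LINT \<xi>|surface_measure. f ((z /\<^sub>R norm z) \<bullet> \<xi>)) = (LINT \<xi>|surface_measure. f (axis p (1::real) \<bullet> \<xi>))"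
  proof (rule integral_surface_measure_swap[where F = "\<lambda>x y. f x"])
    show "norm (z /\<^sub>R norm z) = norm (axis p (1::real))"
      using assms(1) by (simp add: norm_axis_1)
    show "(\<lambda>(x, y::real). f x) \<in> borel_measurable borel"
      by (rule borel_measurable_continuous_onI)
        (auto simp: case_prod_beta intro!: continuous_on_compose2[OF assms(2)] continuous_intros)
  qed
  then show ?thesis by (simp add: axial_mean_def inner_axis' divide_inverse_commute)
qed

lemma neg_laplacian_const: "z \<noteq> 0 \<Longrightarrow> neg_laplacian (\<lambda>_. c) z = 0"
  by (simp add: neg_laplacian_def partial_def)

text \<open>Divergence theorem from rotation invariance: if \<open>P\<close> is an antiderivative of
  \<open>g\<close>, the integral of \<open>P (z \<bullet> \<xi> / norm z)\<close> over
  \<open>\<xi>\<close> is the same for all \<open>z \<noteq> 0\<close>, so its Laplacian is 0.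
  Computed under the integral at \<open>z = e\<^sub>p\<close>, that Laplacian is the left-hand
  side.\<close>

lemma axial_mean_divergence:
  fixes p :: "'n::finite"
  assumes g: "\<And>t. (g has_real_derivative g' t) (at t)" and g': "continuous_on UNIV g'"
  shows "axial_mean p (\<lambda>t. (1 - t\<^sup>2) * g' t - (real CARD('n) - 1) * t * g t) = 0"
proof -
  have gc: "continuous_on UNIV g"
    using g by (auto intro: DERIV_imp_continuous_on)
  then obtain P where P: "\<And>t. (P has_real_derivative g t) (at t)" using ex_antiderivative by blast
  then have Pc: "continuous_on UNIV P"
    by (auto intro: DERIV_imp_continuous_on)
  let ?z = "axis p 1 :: real^'n"
  have "0 = neg_laplacian (\<lambda>_. axial_mean p P) ?z"
    by (simp add: neg_laplacian_const axis_eq_0_iff)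
  also have "\<dots> = neg_laplacian (\<lambda>z. 1 * (LINT \<xi>|surface_measure. 1 * P (z \<bullet> \<xi> / norm z)) + 0) ?z"
    by (rule neg_laplacian_cong)
      (use integral_surface_measure_normalized_inner[OF _ Pc, where p = p] in \<open>auto simp: axis_eq_0_iff\<close>)
  also have "\<dots> = - axial_mean p (\<lambda>t. (1 - t\<^sup>2) * g' t - (real CARD('n) - 1) * t * g t)"
    using continuous_on_subset[OF g', of "{-1..1}"]
    by (subst neg_laplacian_surface_integral[where A = "\<lambda>_. 1" and ?A1.0 = "\<lambda>_. 0" and ?A2.0 = "\<lambda>_. 0"
          and D = "\<lambda>_. 0" and ?D1.0 = "\<lambda>_. 0" and ?D2.0 = "\<lambda>_. 0" and f = P and ?f1.0 = g and ?f2.0 = g'])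
      (auto simp: P g axis_eq_0_iff axial_mean_def inner_axis' integrable_surface_measure_const)
  finally show ?thesis by simp
qed

lemma axial_mean_add:
  assumes "continuous_on {-1..1} f" "continuous_on {-1..1} g"
  shows "axial_mean p (\<lambda>t. f t + g t) = axial_mean p f + axial_mean p g"
  unfolding axial_mean_def by (intro Bochner_Integration.integral_add integrable_axial assms)

lemma axial_mean_diff:
  assumes "continuous_on {-1..1} f" "continuous_on {-1..1} g"
  shows "axial_mean p (\<lambda>t. f t - g t) = axial_mean p f - axial_mean p g"
  unfolding axial_mean_def by (intro Bochner_Integration.integral_diff integrable_axial assms)

lemma axial_mean_cmult: "axial_mean p (\<lambda>t. c * f t) = c * axial_mean p f"
  unfolding axial_mean_def by simp

lemma axial_laplacian_symmetric:
  fixes p :: "'n::finite"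
  assumes f: "smooth f" and g: "smooth g"
  shows "axial_mean p (\<lambda>t. axial_laplacian CARD('n) f t * g t) = axial_mean p (\<lambda>t. f t * axial_laplacian CARD('n) g t)"
proof -
  \<comment> \<open>As in Green's second identity: the divergence of this difference is
    \<open>\<Lambda>f * g - f * \<Lambda>g\<close>.\<close>
  let ?v = "\<lambda>t. deriv f t * g t - f t * deriv g t"
  let ?v' = "\<lambda>t. deriv (deriv f) t * g t - f t * deriv (deriv g) t"
  have sm: "smooth (deriv f)" "smooth (deriv g)" "smooth (deriv (deriv f))" "smooth (deriv (deriv g))"
    using f g by (auto intro: smooth_deriv)
  have "axial_mean p (\<lambda>t. (1 - t\<^sup>2) * ?v' t - (real CARD('n) - 1) * t * ?v t) = 0"
    by (rule axial_mean_divergence)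
      (auto intro!: derivative_eq_intros smooth_DERIV f g sm smooth_continuous)
  then have "axial_mean p (\<lambda>t. axial_laplacian CARD('n) f t * g t - f t * axial_laplacian CARD('n) g t) = 0"
    by (simp add: axial_laplacian_def algebra_simps)
  then show ?thesis
    by (subst (asm) axial_mean_diff)
      (auto intro!: smooth_continuous smooth_mult f g smooth_axial_laplacian)
qed

text \<open>On functions of one coordinate \<open>D\<^sup>2 = \<Lambda> + E (E + N - 2)\<close> with
  \<open>E = euler\<close>, which is the polar form of the Laplacian. \<open>\<Lambda>\<close> is
  moved to the test function \<open>g\<close> by symmetry, while the Euler terms stay on
  \<open>f\<close>, where homogeneity evaluates them.\<close>

lemma axial_mean_deriv2_mult:
  fixes p :: "'n::finite"
  assumes f: "smooth f" and g: "smooth g"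
  shows "axial_mean p (\<lambda>t. deriv (deriv f) t * g t) = axial_mean p (\<lambda>t. f t * axial_laplacian CARD('n) g t)
     + axial_mean p (\<lambda>t. (euler (euler f) t + (real CARD('n) - 2) * euler f t) * g t)"
proof -
  have "deriv (euler f) t = deriv f t + t * deriv (deriv f) t" for t
    unfolding euler_def[abs_def] using f
    by (auto intro!: DERIV_imp_deriv derivative_eq_intros smooth_DERIV smooth_deriv)
  then have "deriv (deriv f) t = axial_laplacian CARD('n) f t + (euler (euler f) t + (real CARD('n) - 2) * euler f t)" for t
    by (simp add: axial_laplacian_def euler_def[of "euler f"] euler_def[of f] algebra_simps power2_eq_square)
  then have "axial_mean p (\<lambda>t. deriv (deriv f) t * g t) =
      axial_mean p (\<lambda>t. axial_laplacian CARD('n) f t * g t + (euler (euler f) t + (real CARD('n) - 2) * euler f t) * g t)"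
    by (simp only: distrib_right)
  also have "\<dots> = axial_mean p (\<lambda>t. axial_laplacian CARD('n) f t * g t)
     + axial_mean p (\<lambda>t. (euler (euler f) t + (real CARD('n) - 2) * euler f t) * g t)"
    by (intro axial_mean_add smooth_continuous smooth_mult smooth_add smooth_const f g smooth_axial_laplacian smooth_euler)
  finally show ?thesis using axial_laplacian_symmetric[OF f g] by simp
qed

text \<open>This is \<open>(E - 2 k) (E - 2 k + N - 2)\<close> for \<open>E = euler\<close>: differentiating \<open>2 k\<close> times turns it into
  \<open>E (E + N - 2)\<close>, because \<open>E D\<^sup>j = D\<^sup>j (E - j)\<close>.\<close>

definition shifted_euler :: "real \<Rightarrow> nat \<Rightarrow> (real \<Rightarrow> real) \<Rightarrow> real \<Rightarrow> real" where
  "shifted_euler N k f t = euler (euler f) t + (N - 2 - 4 * real k) * euler f t - 2 * real k * (N - 2 - 2 * real k) * f t"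

text \<open>Two derivatives of the kernel are traded for a spherical Laplacian of the smooth factor.
  The Euler terms are pulled inside the remaining \<open>2 k\<close> derivatives, so that the same
  statement can be applied to them again.\<close>

lemma axial_mean_deriv_even_step:
  fixes p :: "'n::finite"
  assumes f: "smooth f" and g: "smooth g"
  shows "axial_mean p (\<lambda>t. (deriv ^^ (2 * Suc k)) f t * g t) =
      axial_mean p (\<lambda>t. (deriv ^^ (2 * k)) f t * axial_laplacian CARD('n) g t) +
      axial_mean p (\<lambda>t. (deriv ^^ (2 * k)) (shifted_euler CARD('n) k f) t * g t)"
proof -
  let ?D = "deriv ^^ (2 * k)"
  let ?N = "real CARD('n)"
  have E: "euler (?D h) = (\<lambda>t. ?D (euler h) t + (- 2 * real k) * ?D h t)" if "smooth h" for h
    using euler_funpow_deriv[OF that, of _ "2 * k"] by (auto simp: euler_def[of "?D h"])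
  have EE: "euler (euler (?D f)) t = ?D (euler (euler f)) t - 4 * real k * ?D (euler f) t + 4 * (real k)\<^sup>2 * ?D f t" for t
  proof -
    have "deriv (euler (?D f)) t = deriv (?D (euler f)) t - 2 * real k * deriv (?D f) t"
      unfolding E[OF f] using f
      by (auto intro!: DERIV_imp_deriv derivative_eq_intros smooth_DERIV smooth_funpow_deriv smooth_euler)
    then have "t * deriv (euler (?D f)) t = t * deriv (?D (euler f)) t - 2 * real k * (t * deriv (?D f) t)"
      by (simp only:) (simp add: algebra_simps)
    then have "euler (euler (?D f)) t = euler (?D (euler f)) t - 2 * real k * euler (?D f) t"
      unfolding euler_def[of "euler (?D f)"] euler_def[of "?D (euler f)"] euler_def[of "?D f"] .
    note 1 = this
    show ?thesis
      unfolding 1 unfolding E[OF f] E[OF smooth_euler[OF f]] by (simp add: algebra_simps power2_eq_square)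
  qed
  have "shifted_euler ?N k f = (\<lambda>t. euler (euler f) t + ((?N - 2 - 4 * real k) * euler f t + (- 2 * real k * (?N - 2 - 2 * real k)) * f t))"
    by (auto simp: shifted_euler_def)
  then have "?D (shifted_euler ?N k f) = (\<lambda>t. ?D (euler (euler f)) t +
      ((?N - 2 - 4 * real k) * ?D (euler f) t + (- 2 * real k * (?N - 2 - 2 * real k)) * ?D f t))"
    using f by (simp only: funpow_deriv_add funpow_deriv_cmult smooth_euler smooth_add smooth_mult smooth_const)
  note D = this
  have "euler (euler (?D f)) t + (?N - 2) * euler (?D f) t = ?D (shifted_euler ?N k f) t" for t
    unfolding EE D unfolding E[OF f] by (simp add: algebra_simps power2_eq_square)
  then show ?thesis
    using axial_mean_deriv2_mult[OF smooth_funpow_deriv[OF f, of "2 * k"] g, of p] by simp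
qed

section \<open>Regularized kernels\<close>

text \<open>The kernels \<open>\<bar>t\<bar>\<close> and \<open>ln \<bar>t\<bar>\<close> are the limits for \<open>e \<rightarrow> 0\<close> with \<open>(d, c, P) = (1, 0, 1)\<close> and
  \<open>(d, c, P) = (0, 1, 0)\<close>.  The polynomials \<open>P\<close> in \<open>e\<^sup>2 / (t\<^sup>2 + e\<^sup>2)\<close> make the family closed under \<open>euler\<close>;
  only \<open>P (0)\<close> matters in the limit.\<close>

definition regularized :: "real \<Rightarrow> real \<Rightarrow> real \<Rightarrow> real poly \<Rightarrow> real \<Rightarrow> real" where
  "regularized d e c P t =
     c / 2 * ln (t\<^sup>2 + e\<^sup>2) + (t\<^sup>2 + e\<^sup>2) powr (d / 2) * poly P (e\<^sup>2 / (t\<^sup>2 + e\<^sup>2))"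

text \<open>For \<open>x = e\<^sup>2 / (t\<^sup>2 + e\<^sup>2)\<close> one has
  \<open>t\<^sup>2 / (t\<^sup>2 + e\<^sup>2) = 1 - x\<close> and
  \<open>euler x = - 2 x (1 - x)\<close>. So \<open>euler\<close> multiplies by \<open>1 - x\<close>
  and turns \<open>P\<close> into \<open>d P - 2 x P'\<close>; the logarithm adds
  \<open>c (1 - x)\<close>.\<close>

definition euler_poly :: "real \<Rightarrow> real \<Rightarrow> real poly \<Rightarrow> real poly" where
  "euler_poly d c P = [:1, -1:] * ([:c:] + smult d P - [:0, 2:] * pderiv P)"

lemma poly_euler_poly_0: "poly (euler_poly d c P) 0 = c + d * poly P 0"
  by (simp add: euler_poly_def)

lemma regularized_DERIV:
  assumes "e \<noteq> 0"
  shows "(regularized d e c P has_real_derivative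
     (c * t / (t\<^sup>2 + e\<^sup>2) + (t\<^sup>2 + e\<^sup>2) powr (d / 2) * (d * t / (t\<^sup>2 + e\<^sup>2) * poly P (e\<^sup>2 / (t\<^sup>2 + e\<^sup>2))
       - 2 * t * e\<^sup>2 / (t\<^sup>2 + e\<^sup>2)\<^sup>2 * poly (pderiv P) (e\<^sup>2 / (t\<^sup>2 + e\<^sup>2))))) (at t)"
proof -
  define r where "r = t\<^sup>2 + e\<^sup>2"
  have r: "0 < t\<^sup>2 + e\<^sup>2" using assms by (intro add_nonneg_pos) auto
  then have r': "0 < r" by (simp add: r_def)
  have D1: "((\<lambda>t. c / 2 * ln (t\<^sup>2 + e\<^sup>2)) has_real_derivative c / 2 * ((2 * t) / (t\<^sup>2 + e\<^sup>2))) (at t)"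
    using r by (intro DERIV_cmult) (auto intro!: derivative_eq_intros)
  have D2: "((\<lambda>t. (t\<^sup>2 + e\<^sup>2) powr (d / 2)) has_real_derivative d / 2 * (t\<^sup>2 + e\<^sup>2) powr (d / 2 - 1) * (2 * t)) (at t)"
    using r by (auto intro!: derivative_eq_intros DERIV_fun_powr)
  have D3: "((\<lambda>t. e\<^sup>2 / (t\<^sup>2 + e\<^sup>2)) has_real_derivative - e\<^sup>2 * (2 * t) / (t\<^sup>2 + e\<^sup>2)\<^sup>2) (at t)"
    using r by (auto intro!: derivative_eq_intros simp: power2_eq_square)
  have "(regularized d e c P has_real_derivative
     (c / 2 * ((2 * t) / (t\<^sup>2 + e\<^sup>2)) + ((d / 2 * (t\<^sup>2 + e\<^sup>2) powr (d / 2 - 1) * (2 * t)) * poly P (e\<^sup>2 / (t\<^sup>2 + e\<^sup>2))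
       + poly (pderiv P) (e\<^sup>2 / (t\<^sup>2 + e\<^sup>2)) * (- e\<^sup>2 * (2 * t) / (t\<^sup>2 + e\<^sup>2)\<^sup>2) * (t\<^sup>2 + e\<^sup>2) powr (d / 2)))) (at t)"
    unfolding regularized_def[abs_def] by (intro DERIV_add DERIV_mult D1 D2 DERIV_chain2[OF poly_DERIV D3])
  moreover have "(t\<^sup>2 + e\<^sup>2) powr (d / 2 - 1) = (t\<^sup>2 + e\<^sup>2) powr (d / 2) / (t\<^sup>2 + e\<^sup>2)"
    using r by (simp add: powr_diff)
  ultimately show ?thesis
    using r' unfolding r_def[symmetric] by (simp only:) (simp add: field_simps power2_eq_square)
qed

lemma smooth_regularized:
  assumes "e \<noteq> 0"
  shows "smooth (regularized d e c P)"
proof -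
  have r: "0 < t\<^sup>2 + e\<^sup>2" for t using assms by (intro add_nonneg_pos) auto
  have inv: "smooth (\<lambda>t. inverse (t\<^sup>2 + e\<^sup>2))"
    using assms by (intro smooth_inverse smooth_add smooth_power smooth_ident smooth_const) simp
  have "smooth (\<lambda>t. ln (t\<^sup>2 + e\<^sup>2))"
  proof (rule smoothI[of _ "\<lambda>t. 2 * t * inverse (t\<^sup>2 + e\<^sup>2)"])
    show "((\<lambda>t. ln (t\<^sup>2 + e\<^sup>2)) has_real_derivative 2 * t * inverse (t\<^sup>2 + e\<^sup>2)) (at t)" for t
      using r[of t] by (auto intro!: derivative_eq_intros simp: divide_inverse)
  qed (intro smooth_mult smooth_const smooth_ident inv)
  moreover have "smooth (\<lambda>t. (t\<^sup>2 + e\<^sup>2) powr (d / 2))"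
  proof (rule smooth_DERIV_mult_self[where h = "\<lambda>t. d * t * inverse (t\<^sup>2 + e\<^sup>2)"])
    show "((\<lambda>t. (t\<^sup>2 + e\<^sup>2) powr (d / 2)) has_real_derivative (t\<^sup>2 + e\<^sup>2) powr (d / 2) * (d * t * inverse (t\<^sup>2 + e\<^sup>2))) (at t)" for t
    proof -
      have "regularized d e 0 1 = (\<lambda>t. (t\<^sup>2 + e\<^sup>2) powr (d / 2))"
        by (simp add: regularized_def fun_eq_iff)
      then have "((\<lambda>t. (t\<^sup>2 + e\<^sup>2) powr (d / 2)) has_real_derivative (t\<^sup>2 + e\<^sup>2) powr (d / 2) * (d * t / (t\<^sup>2 + e\<^sup>2))) (at t)"
        using regularized_DERIV[OF assms, of d 0 1 t] by (simp only: pderiv_1 poly_1 poly_0) simp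
      then show ?thesis by (simp only: divide_inverse)
    qed
  qed (intro smooth_mult smooth_const smooth_ident inv)
  moreover have "smooth (\<lambda>t. poly P (e\<^sup>2 * inverse (t\<^sup>2 + e\<^sup>2)))"
    by (intro smooth_poly smooth_mult smooth_const inv)
  ultimately show ?thesis
    unfolding regularized_def[abs_def] divide_inverse[of "e\<^sup>2"]
    by (intro smooth_add smooth_mult smooth_const)
qed

text \<open>The Euler operator makes a term of degree 0 out of the logarithm. It can be absorbed
  into the summand with \<open>(t\<^sup>2 + e\<^sup>2) powr (d / 2)\<close> if \<open>d = 0\<close>,
  and it is absent if \<open>c = 0\<close>.\<close>

lemma euler_regularized:
  assumes "e \<noteq> 0" "d = 0 \<or> c = 0"
  shows "euler (regularized d e c P) = regularized d e 0 (euler_poly d c P)"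
proof
  fix t
  define r where "r = t\<^sup>2 + e\<^sup>2"
  have r: "0 < r" unfolding r_def using assms by (intro add_nonneg_pos) auto
  have "t\<^sup>2 = r - e\<^sup>2" by (simp add: r_def)
  then have 1: "1 - e\<^sup>2 / r = t\<^sup>2 / r" using r by (simp add: diff_divide_distrib)
  have "euler (regularized d e c P) t = c * (t\<^sup>2 / r) + r powr (d / 2) * (d * (t\<^sup>2 / r) * poly P (e\<^sup>2 / r)
       - 2 * (e\<^sup>2 / r) * (t\<^sup>2 / r) * poly (pderiv P) (e\<^sup>2 / r))"
  proof -
    have "euler (regularized d e c P) t = t * (c * t / r + r powr (d / 2) * (d * t / r * poly P (e\<^sup>2 / r)
       - 2 * t * e\<^sup>2 / r\<^sup>2 * poly (pderiv P) (e\<^sup>2 / r)))"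
      unfolding r_def euler_def by (subst DERIV_imp_deriv[OF regularized_DERIV[OF assms(1)]]) (rule refl)
    then show ?thesis by (simp only:) (simp add: power2_eq_square algebra_simps)
  qed
  also have "c * (t\<^sup>2 / r) = r powr (d / 2) * (c * (t\<^sup>2 / r))" using assms(2) r by auto
  finally have 2: "euler (regularized d e c P) t = r powr (d / 2) * (c * (t\<^sup>2 / r)) + r powr (d / 2) * (d * (t\<^sup>2 / r) * poly P (e\<^sup>2 / r)
       - 2 * (e\<^sup>2 / r) * (t\<^sup>2 / r) * poly (pderiv P) (e\<^sup>2 / r))" .
  have "poly (euler_poly d c P) x = (1 - x) * (c + d * poly P x - 2 * x * poly (pderiv P) x)" for x
    by (simp add: euler_poly_def algebra_simps)
  then show "euler (regularized d e c P) t = regularized d e 0 (euler_poly d c P) t"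
    unfolding 2 regularized_def[of d e 0] r_def[symmetric] by (simp only: 1) (simp add: algebra_simps)
qed

definition shifted_euler_poly :: "real \<Rightarrow> nat \<Rightarrow> real \<Rightarrow> real \<Rightarrow> real poly \<Rightarrow> real poly" where
  "shifted_euler_poly N k d c P = euler_poly d 0 (euler_poly d c P) + smult (N - 2 - 4 * real k) (euler_poly d c P)
     - smult (2 * real k * (N - 2 - 2 * real k)) P"

text \<open>On functions homogeneous of degree \<open>d - 2 * k\<close> on an \<open>N\<close>-dimensional space, \<open>\<Delta>\<close> acts as
  \<open>\<bar>x\<bar>\<^sup>-\<^sup>2 (\<Lambda> + radial_eigenvalue N d k)\<close>, where \<open>\<Lambda>\<close> is the spherical Laplacian.\<close>

definition radial_eigenvalue :: "real \<Rightarrow> real \<Rightarrow> nat \<Rightarrow> real" where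
  "radial_eigenvalue N d k = (d - 2 * real k) * (d - 2 * real k + N - 2)"

lemma shifted_euler_regularized:
  assumes "e \<noteq> 0" "d = 0 \<or> c = 0"
  shows "shifted_euler N k (regularized d e c P) =
    regularized d e (radial_eigenvalue N 0 k * c) (shifted_euler_poly N k d c P)"
  unfolding shifted_euler_def[abs_def]
  using assms
  by (auto simp: euler_regularized) (auto simp: regularized_def shifted_euler_poly_def radial_eigenvalue_def fun_eq_iff algebra_simps, simp add: field_simps)

lemma poly_shifted_euler_poly_0:
  assumes "d = 0 \<or> c = 0"
  shows "poly (shifted_euler_poly N k d c P) 0 = radial_eigenvalue N d k * poly P 0 + (N - 2 - 4 * real k) * c"
  using assms by (auto simp: shifted_euler_poly_def poly_euler_poly_0 radial_eigenvalue_def algebra_simps)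

text \<open>Angular part of the iterated Laplacian on functions homogeneous of degree
  \<open>d\<close>: applied to \<open>\<bar>z\<bar>\<^sup>d\<close> times \<open>h\<close> of a
  normalized coordinate, \<open>\<Delta>\<^sup>k\<close> yields \<open>\<bar>z\<bar>\<close> to the
  power \<open>d - 2 * k\<close> times \<open>laplacian_product N d k h\<close>.\<close>

primrec laplacian_product :: "real \<Rightarrow> real \<Rightarrow> nat \<Rightarrow> (real \<Rightarrow> real) \<Rightarrow> real \<Rightarrow> real" where
  "laplacian_product N d 0 h = h"
| "laplacian_product N d (Suc k) h =
     (\<lambda>t. axial_laplacian N (laplacian_product N d k h) t + radial_eigenvalue N d k * laplacian_product N d k h t)"

lemma smooth_laplacian_product: "smooth h \<Longrightarrow> smooth (laplacian_product N d k h)"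
  by (induction k) (simp_all add: smooth_axial_laplacian smooth_add smooth_mult)

lemma axial_laplacian_lincomb:
  assumes "smooth f" "smooth g"
  shows "axial_laplacian N (\<lambda>t. f t + c * g t) = (\<lambda>t. axial_laplacian N f t + c * axial_laplacian N g t)"
proof -
  have "deriv (\<lambda>t. f t + c * g t) = (\<lambda>t. deriv f t + c * deriv g t)" if "smooth f" "smooth g" for f g
    using that by (simp add: deriv_add_smooth deriv_cmult_smooth smooth_mult)
  then show ?thesis using assms smooth_deriv
    by (auto simp: axial_laplacian_def[abs_def] algebra_simps)
qed

lemma laplacian_product_commute:
  "smooth h \<Longrightarrow> laplacian_product N d k (axial_laplacian N h) = axial_laplacian N (laplacian_product N d k h)"
  by (induction k)
    (simp_all add: axial_laplacian_lincomb smooth_laplacian_product smooth_axial_laplacian)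

lemma axial_mean_axial_laplacian:
  fixes p :: "'n::finite"
  assumes "smooth h"
  shows "axial_mean p (axial_laplacian CARD('n) h) = 0"
proof -
  have "axial_laplacian CARD('n) (\<lambda>_. 1) = (\<lambda>_. 0)" by (simp add: axial_laplacian_def[abs_def])
  then show ?thesis
    using axial_laplacian_symmetric[OF smooth_const[of 1] assms, of p] by (simp add: axial_mean_def)
qed

lemma axial_mean_laplacian_product:
  fixes p :: "'n::finite"
  assumes "smooth h"
  shows "axial_mean p (laplacian_product CARD('n) d k h) = (\<Prod>i<k. radial_eigenvalue CARD('n) d i) * axial_mean p h"
proof (induction k)
  case (Suc k)
  have "axial_mean p (laplacian_product CARD('n) d (Suc k) h) =
     radial_eigenvalue CARD('n) d k * axial_mean p (laplacian_product CARD('n) d k h)"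
    using assms(1)
    by (simp add: axial_mean_add axial_mean_cmult axial_mean_axial_laplacian smooth_laplacian_product
        smooth_continuous smooth_axial_laplacian smooth_mult)
  then show ?case using Suc by simp
qed simp

text \<open>The factor \<open>i = 0\<close> vanishes because constants are harmonic. In even
  dimensions this removes nearly all corrections that the logarithm causes.\<close>

lemma prod_radial_eigenvalue_0:
  assumes "k > 0"
  shows "(\<Prod>i<k. radial_eigenvalue N 0 i) = 0"
  using assms by (intro prod_zero bexI[of _ 0]) (auto simp: radial_eigenvalue_def)

lemma axial_mean_laplacian_product_0:
  fixes p :: "'n::finite"
  assumes "smooth h" "k > 0"
  shows "axial_mean p (laplacian_product CARD('n) 0 k h) = 0"
  using assms by (simp add: axial_mean_laplacian_product prod_radial_eigenvalue_0)

section \<open>Integrability of the logarithmic kernel on the sphere\<close>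

lemma ln_regularized_bounds:
  fixes t e :: real
  assumes "t \<noteq> 0" "\<bar>t\<bar> \<le> 1" "0 < e" "e \<le> 1"
  shows "ln \<bar>t\<bar> \<le> ln (t\<^sup>2 + e\<^sup>2) / 2" "ln (t\<^sup>2 + e\<^sup>2) / 2 \<le> ln 2 / 2"
proof -
  have "t\<^sup>2 \<le> 1" using assms(2) by (simp add: abs_square_le_1)
  have "e\<^sup>2 \<le> 1" using assms by (simp add: power_le_one)
  have "0 < t\<^sup>2" "0 < e\<^sup>2" using assms by auto
  have "2 * ln \<bar>t\<bar> = ln (t\<^sup>2)" using assms ln_realpow[of "\<bar>t\<bar>" 2] by simp
  also have "\<dots> \<le> ln (t\<^sup>2 + e\<^sup>2)"
    using \<open>0 < t\<^sup>2\<close> \<open>0 < e\<^sup>2\<close> by (subst ln_le_cancel_iff) linarith+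
  finally show "ln \<bar>t\<bar> \<le> ln (t\<^sup>2 + e\<^sup>2) / 2" by simp
  show "ln (t\<^sup>2 + e\<^sup>2) / 2 \<le> ln 2 / 2"
    using \<open>0 < t\<^sup>2\<close> \<open>0 < e\<^sup>2\<close> \<open>t\<^sup>2 \<le> 1\<close> \<open>e\<^sup>2 \<le> 1\<close>
    by (intro divide_right_mono, subst ln_le_cancel_iff) linarith+
qed

lemma tendsto_inverse_Suc: "(\<lambda>m. 1 / (real m + 1)) \<longlonglongrightarrow> 0"
  using LIMSEQ_inverse_real_of_nat by (simp add: inverse_eq_divide add.commute)

text \<open>The divergence identity for \<open>t ln (t\<^sup>2 + e\<^sup>2) / 2\<close> bounds the means of the functions
  \<open>- (1 - t\<^sup>2) ln (t\<^sup>2 + e\<^sup>2)\<close> uniformly in \<open>e\<close>; Fatou's lemma does the rest.\<close>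

lemma
  fixes p :: "'n::finite"
  shows AE_coord_neq_0: "AE \<xi> in (surface_measure :: (real^'n) measure). \<xi> $ p \<noteq> 0"
    and integrable_ln_coord: "integrable (surface_measure :: (real^'n) measure) (\<lambda>\<xi>. ln \<bar>\<xi> $ p\<bar>)"
proof -
  let ?M = "surface_measure :: (real^'n) measure"
  let ?N = "real CARD('n)"
  define L where "L m t = ln (t\<^sup>2 + (1 / (real m + 1))\<^sup>2) / 2" for m t
  \<comment> \<open>\<open>K\<close> is \<open>1 + 1 + (N - 1)\<close>, the sum of the bounds for
    the three terms that remain after the cancellation below.\<close>
  define K where "K = 1 + ?N"
  define G where "G m t = (1 - t\<^sup>2) * (ln 2 / 2 - L m t)" for m t
  have pos: "0 < t\<^sup>2 + (1 / (real m + 1))\<^sup>2" for t m by (intro add_nonneg_pos) auto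
  have Lc: "continuous_on A (L m)" for m A
    unfolding L_def using pos less_irrefl by (intro continuous_intros) fastforce+
  have G0: "0 \<le> G m t" if "t \<in> {-1..1}" for m t
  proof -
    have "t\<^sup>2 \<le> 1" "(1 / (real m + 1))\<^sup>2 \<le> 1" using that by (auto simp: abs_square_le_1 abs_le_iff field_simps power_le_one)
    then have "ln (t\<^sup>2 + (1 / (real m + 1))\<^sup>2) \<le> ln 2"
      using pos[of t m] by (subst ln_le_cancel_iff) linarith+
    then have "L m t \<le> ln 2 / 2" by (simp add: L_def)
    then show ?thesis using \<open>t\<^sup>2 \<le> 1\<close> by (simp add: G_def)
  qed
  have Gc: "continuous_on A (G m)" for m A unfolding G_def by (intro continuous_intros Lc)
  have Fc: "continuous_on A (\<lambda>t. (1 - t\<^sup>2) * (L m t + t\<^sup>2 / (t\<^sup>2 + (1 / (real m + 1))\<^sup>2)) - (?N - 1) * t * (t * L m t))" for m A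
    using pos less_irrefl by (intro continuous_intros Lc) fastforce+
  have mean: "axial_mean p (G m) \<le> axial_mean p (\<lambda>_. K)" for m
  proof -
    let ?e = "1 / (real m + 1)"
    have "axial_mean p (\<lambda>t. (1 - t\<^sup>2) * (L m t + t\<^sup>2 / (t\<^sup>2 + ?e\<^sup>2)) - (?N - 1) * t * (t * L m t)) = 0"
    proof (rule axial_mean_divergence)
      show "((\<lambda>t. t * L m t) has_real_derivative L m t + t\<^sup>2 / (t\<^sup>2 + ?e\<^sup>2)) (at t)" for t
        unfolding L_def using pos[of t m]
        by (auto intro!: derivative_eq_intros simp: field_simps power2_eq_square)
      show "continuous_on UNIV (\<lambda>t. L m t + t\<^sup>2 / (t\<^sup>2 + ?e\<^sup>2))"
        using pos less_irrefl by (intro continuous_intros Lc) fastforce+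
    qed
    \<comment> \<open>Adding the integrand of mean 0 cancels the singular
      \<open>(1 - t\<^sup>2) * L m t\<close>. What is left contains \<open>L m t\<close> only with
      the factor \<open>t\<^sup>2\<close>, which tames it uniformly in \<open>m\<close>.\<close>
    then have "axial_mean p (G m) = axial_mean p (\<lambda>t. G m t + ((1 - t\<^sup>2) * (L m t + t\<^sup>2 / (t\<^sup>2 + ?e\<^sup>2)) - (?N - 1) * t * (t * L m t)))"
      by (subst axial_mean_add[OF Gc Fc]) simp
    also have "\<dots> \<le> axial_mean p (\<lambda>_. K)"
      unfolding axial_mean_def
    proof (rule integral_mono)
      show "integrable ?M (\<lambda>\<xi>. G m (\<xi> $ p) + ((1 - (\<xi> $ p)\<^sup>2) * (L m (\<xi> $ p) + (\<xi> $ p)\<^sup>2 / ((\<xi> $ p)\<^sup>2 + ?e\<^sup>2)) - (?N - 1) * \<xi> $ p * (\<xi> $ p * L m (\<xi> $ p))))"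
        by (rule integrable_axial[OF continuous_on_add[OF Gc Fc]])
      fix \<xi> :: "real^'n" assume "\<xi> \<in> space ?M"
      define t where "t = \<xi> $ p"
      have t: "\<bar>t\<bar> \<le> 1" using \<open>\<xi> \<in> space ?M\<close> coord_in_unit[of \<xi> p] by (auto simp: t_def abs_le_iff)
      then have t2: "t\<^sup>2 \<le> 1" by (simp add: abs_square_le_1)
      have "ln (2::real) / 2 \<le> 1 / 2" using ln_le_minus_one[of "2::real"] by simp
      then have 1: "(1 - t\<^sup>2) * (ln 2 / 2) \<le> 1 * 1" using t2 by (intro mult_mono) auto
      have "t\<^sup>2 / (t\<^sup>2 + ?e\<^sup>2) \<le> 1" using pos[of t m] by (simp add: divide_le_eq)
      then have 2: "(1 - t\<^sup>2) * (t\<^sup>2 / (t\<^sup>2 + ?e\<^sup>2)) \<le> 1 * 1" using t2 pos[of t m] by (intro mult_mono) auto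
      have 3: "- (t\<^sup>2 * L m t) \<le> 1"
      proof (cases "t = 0")
        case False
        have "- L m t \<le> - ln \<bar>t\<bar>"
          using ln_regularized_bounds(1)[OF False t, of ?e] by (simp add: L_def field_simps)
        also have "- ln \<bar>t\<bar> = ln (1 / \<bar>t\<bar>)" using False by (simp add: ln_div)
        also have "\<dots> \<le> 1 / \<bar>t\<bar>" using False ln_bound[of "1 / \<bar>t\<bar>"] by simp
        finally have "t\<^sup>2 * - L m t \<le> t\<^sup>2 * (1 / \<bar>t\<bar>)" by (intro mult_left_mono) auto
        also have "\<dots> = \<bar>t\<bar>" using False by (simp add: field_simps power2_eq_square)
        finally show ?thesis using t by simp
      qed simp
      have 4: "(?N - 1) * - (t\<^sup>2 * L m t) \<le> (?N - 1) * 1"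
        using 3 by (intro mult_left_mono) (auto simp: Suc_le_eq)
      have "(1 - t\<^sup>2) * (ln 2 / 2) + (1 - t\<^sup>2) * (t\<^sup>2 / (t\<^sup>2 + ?e\<^sup>2)) + (?N - 1) * - (t\<^sup>2 * L m t) \<le> 1 * 1 + 1 * 1 + (?N - 1) * 1"
        by (intro add_mono 1 2 4)
      also have "\<dots> = K" by (simp add: K_def)
      finally have 5: "(1 - t\<^sup>2) * (ln 2 / 2) + (1 - t\<^sup>2) * (t\<^sup>2 / (t\<^sup>2 + ?e\<^sup>2)) + (?N - 1) * - (t\<^sup>2 * L m t) \<le> K" .
      have "(1 - t\<^sup>2) * (ln 2 / 2) + (1 - t\<^sup>2) * A + (?N - 1) * - (t\<^sup>2 * L m t) =
          G m t + ((1 - t\<^sup>2) * (L m t + A) - (?N - 1) * t * (t * L m t))" for A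
        by (simp add: G_def algebra_simps power2_eq_square)
      from this[of "t\<^sup>2 / (t\<^sup>2 + ?e\<^sup>2)"] 5 have "G m t + ((1 - t\<^sup>2) * (L m t + t\<^sup>2 / (t\<^sup>2 + ?e\<^sup>2)) - (?N - 1) * t * (t * L m t)) \<le> K" by (simp only:)
      then show "G m (\<xi> $ p) + ((1 - (\<xi> $ p)\<^sup>2) * (L m (\<xi> $ p) + (\<xi> $ p)\<^sup>2 / ((\<xi> $ p)\<^sup>2 + ?e\<^sup>2)) - (?N - 1) * \<xi> $ p * (\<xi> $ p * L m (\<xi> $ p))) \<le> K"
        by (simp add: t_def)
    qed (rule integrable_surface_measure_const)
    finally show ?thesis .
  qed
  have meas: "(\<lambda>\<xi>. G m (\<xi> $ p)) \<in> borel_measurable ?M" for m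
    using integrable_axial[OF Gc] by (rule borel_measurable_integrable)
  have meas': "(\<lambda>\<xi>. ennreal (G m (\<xi> $ p))) \<in> borel_measurable ?M" for m
    by (rule measurable_compose[OF meas measurable_ennreal])
  have bound: "(\<integral>\<^sup>+\<xi>. ennreal (G m (\<xi> $ p)) \<partial>?M) \<le> ennreal (axial_mean p (\<lambda>_. K))" for m
  proof -
    have "(\<integral>\<^sup>+\<xi>. ennreal (G m (\<xi> $ p)) \<partial>?M) = ennreal (axial_mean p (G m))"
      unfolding axial_mean_def
      by (rule nn_integral_eq_integral[OF integrable_axial[OF Gc]])
        (auto intro!: AE_I2 G0 coord_in_unit simp del: atLeastAtMost_iff)
    then show ?thesis using mean by (simp add: ennreal_leI)
  qed
  have "(\<integral>\<^sup>+\<xi>. liminf (\<lambda>m. ennreal (G m (\<xi> $ p))) \<partial>?M) \<le> liminf (\<lambda>m. \<integral>\<^sup>+\<xi>. ennreal (G m (\<xi> $ p)) \<partial>?M)"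
    by (intro nn_integral_liminf meas')
  also have "\<dots> \<le> liminf (\<lambda>_::nat. ennreal (axial_mean p (\<lambda>_. K)))"
    by (intro Liminf_mono always_eventually allI bound)
  also have "\<dots> = ennreal (axial_mean p (\<lambda>_. K))" by (simp add: Liminf_const)
  finally have fatou: "(\<integral>\<^sup>+\<xi>. liminf (\<lambda>m. ennreal (G m (\<xi> $ p))) \<partial>?M) \<le> ennreal (axial_mean p (\<lambda>_. K))" .
  then have "(\<integral>\<^sup>+\<xi>. liminf (\<lambda>m. ennreal (G m (\<xi> $ p))) \<partial>?M) \<noteq> \<infinity>"
    by (metis ennreal_neq_top infinity_ennreal_def neq_top_trans)
  then have "AE \<xi> in ?M. liminf (\<lambda>m. ennreal (G m (\<xi> $ p))) \<noteq> \<infinity>"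
    by (intro nn_integral_noteq_infinite borel_measurable_liminf meas')
  \<comment> \<open>On the equator the integrands tend to infinity, so the finite bound from Fatou's
    lemma forces the equator to be a null set.\<close>
  moreover have "liminf (\<lambda>m. ennreal (G m 0)) = \<infinity>"
  proof -
    have "filterlim (\<lambda>m. G m 0) at_top sequentially"
    proof -
      have "G m 0 = ln 2 / 2 + ln (real (Suc m))" for m
        using ln_realpow[of "real m + 1" 2] by (simp add: G_def L_def power_divide ln_div add.commute)
      moreover have "filterlim (\<lambda>m. ln 2 / 2 + ln (real (Suc m))) at_top sequentially"
        by (intro filterlim_tendsto_add_at_top[OF tendsto_const] filterlim_compose[OF ln_at_top]
            filterlim_compose[OF filterlim_real_sequentially filterlim_Suc])
      ultimately show ?thesis by simp
    qed
    then have "(\<lambda>m. ennreal (G m 0)) \<longlonglongrightarrow> \<infinity>"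
      by (simp add: ennreal_tendsto_top_eq_at_top)
    then show ?thesis by (intro lim_imp_Liminf) auto
  qed
  ultimately show nz: "AE \<xi> in ?M. \<xi> $ p \<noteq> 0" by (auto elim!: eventually_mono) 
  have lim: "(\<lambda>m. ennreal (G m t)) \<longlonglongrightarrow> ennreal ((1 - t\<^sup>2) * (ln 2 / 2 - ln \<bar>t\<bar>))" if "t \<noteq> 0" for t
  proof -
    have "(\<lambda>m. G m t) \<longlonglongrightarrow> (1 - t\<^sup>2) * (ln 2 / 2 - ln (t\<^sup>2 + 0\<^sup>2) / 2)"
      unfolding G_def L_def using that by (intro tendsto_intros tendsto_inverse_Suc) auto
    moreover have "ln (t\<^sup>2 + 0\<^sup>2) / 2 = ln \<bar>t\<bar>" using that ln_realpow[of "\<bar>t\<bar>" 2] by simp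
    ultimately show ?thesis by (intro tendsto_ennrealI) simp
  qed
  show "integrable ?M (\<lambda>\<xi>. ln \<bar>\<xi> $ p\<bar>)"
  proof -
    let ?H = "\<lambda>t::real. (1 - t\<^sup>2) * (ln 2 / 2 - ln \<bar>t\<bar>)"
    have [measurable]: "(\<lambda>\<xi>. \<xi> $ p) \<in> borel_measurable ?M"
      by (rule borel_measurable_integrable[OF integrable_axial]) auto
    have "(\<integral>\<^sup>+\<xi>. ennreal (?H (\<xi> $ p)) \<partial>?M) = (\<integral>\<^sup>+\<xi>. liminf (\<lambda>m. ennreal (G m (\<xi> $ p))) \<partial>?M)"
      by (rule nn_integral_cong_AE) (use nz in \<open>auto elim!: eventually_mono simp: lim_imp_Liminf[OF sequentially_bot lim]\<close>)
    also have "\<dots> < \<infinity>" using fatou by (simp add: le_less_trans)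
    finally have "integrable ?M (\<lambda>\<xi>. ?H (\<xi> $ p))"
    proof (intro integrableI_nonneg AE_I2)
      fix \<xi> :: "real^'n" assume "\<xi> \<in> space ?M"
      then have t: "\<bar>\<xi> $ p\<bar> \<le> 1" using coord_in_unit[of \<xi> p] by (auto simp: abs_le_iff)
      then have "(\<xi> $ p)\<^sup>2 \<le> 1" by (simp add: abs_square_le_1)
      moreover have "ln \<bar>\<xi> $ p\<bar> \<le> 0" using t by (cases "\<xi> $ p = 0") auto
      moreover have "0 \<le> ln (2::real)" by simp
      ultimately show "0 \<le> ?H (\<xi> $ p)" by (intro mult_nonneg_nonneg) linarith+
    qed measurable
    \<comment> \<open>The factor \<open>1 - t\<^sup>2\<close> in \<open>?H\<close> degenerates at
      the poles. For \<open>\<bar>t\<bar> \<le> 1 / 2\<close> it is at least \<open>1 / 4\<close>,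
      hence the factor 4; for larger \<open>\<bar>t\<bar>\<close> the logarithm is at most 2 in
      absolute value and the summand 4 suffices.\<close>
    then have int: "integrable ?M (\<lambda>\<xi>. 4 * ?H (\<xi> $ p) + 4)"
      by (intro Bochner_Integration.integrable_add integrable_surface_measure_const integrable_mult_right)
    show ?thesis
    proof (rule Bochner_Integration.integrable_bound[OF int])
      show "(\<lambda>\<xi>. ln \<bar>\<xi> $ p\<bar>) \<in> borel_measurable ?M" by measurable
      show "AE \<xi> in ?M. norm (ln \<bar>\<xi> $ p\<bar>) \<le> norm (4 * ?H (\<xi> $ p) + 4)"
      proof (rule AE_I2)
        fix \<xi> :: "real^'n" assume "\<xi> \<in> space ?M"
        define t where "t = \<bar>\<xi> $ p\<bar>"
        have t: "0 \<le> t" "t \<le> 1" using \<open>\<xi> \<in> space ?M\<close> coord_in_unit[of \<xi> p] by (auto simp: abs_le_iff t_def)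
        have le0: "ln t \<le> 0" using t by (cases "t = 0") auto
        have ln2: "0 \<le> ln (2::real)" by simp
        have t2: "t\<^sup>2 \<le> 1" using t by (simp add: power_le_one)
        have "- ln t \<le> 4 * ((1 - t\<^sup>2) * (ln 2 / 2 - ln t)) + 4"
        proof (cases "t \<le> 1 / 2")
          case True
          then have "t\<^sup>2 \<le> (1 / 2)\<^sup>2" using t by (intro power_mono) auto
          then have "1 / 4 \<le> 1 - t\<^sup>2" by (simp add: power2_eq_square)
          then have "1 / 4 * (- ln t) \<le> (1 - t\<^sup>2) * (ln 2 / 2 - ln t)"
            using le0 ln2 t2 by (intro mult_mono) linarith+
          then show ?thesis by simp
        next
          case False
          then have "- ln t = ln (1 / t)" by (simp add: ln_div)
          also have "\<dots> \<le> 1 / t" using False by (intro ln_bound) auto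
          also have "\<dots> \<le> 2" using False by (simp add: field_simps)
          moreover have "0 \<le> (1 - t\<^sup>2) * (ln 2 / 2 - ln t)"
            using t2 le0 ln2 by (intro mult_nonneg_nonneg) linarith+
          ultimately show ?thesis by linarith
        qed
        then show "norm (ln \<bar>\<xi> $ p\<bar>) \<le> norm (4 * ?H (\<xi> $ p) + 4)"
          using le0 by (simp add: t_def)
      qed
    qed
  qed
qed

section \<open>Limits of the regularized integrals\<close>

definition power_weight :: "real \<Rightarrow> real \<Rightarrow> real" where
  "power_weight d t = (if d = 0 then 1 else \<bar>t\<bar>)"

lemma continuous_on_power_weight: "continuous_on A (power_weight d)"
  by (cases "d = 0") (auto simp: power_weight_def[abs_def] intro: continuous_intros)

text \<open>Here and below, \<open>d\<close> is the degree of homogeneity of the function to which John's formula applies powers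
  of the Laplacian: \<open>d = 1\<close> in odd and \<open>d = 0\<close> (the logarithm) in even dimensions.\<close>

definition kernel_weight :: "real \<Rightarrow> real \<Rightarrow> real" where
  "kernel_weight d t = (if d = 0 then ln \<bar>t\<bar> else \<bar>t\<bar>)"

lemma integrable_kernel_weight:
  "integrable (surface_measure :: (real^'n::finite) measure) (\<lambda>\<xi>. kernel_weight d (\<xi> $ p))"
  unfolding kernel_weight_def using integrable_ln_coord[of p] integrable_axial[OF continuous_on_rabs[OF continuous_on_id], of p]
  by (cases "d = 0") auto

lemma axial_mean_weighted_lincomb:
  fixes p :: "'n::finite"
  assumes w: "integrable (surface_measure :: (real^'n) measure) (\<lambda>\<xi>. w (\<xi> $ p))"
    and "continuous_on {-1..1} f" "continuous_on {-1..1} g"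
  shows "axial_mean p (\<lambda>t. w t * (f t + c * g t)) = axial_mean p (\<lambda>t. w t * f t) + c * axial_mean p (\<lambda>t. w t * g t)"
proof -
  have "axial_mean p (\<lambda>t. w t * (f t + c * g t)) =
      (LINT \<xi>|(surface_measure :: (real^'n) measure). w (\<xi> $ p) * f (\<xi> $ p) + c * (w (\<xi> $ p) * g (\<xi> $ p)))"
    unfolding axial_mean_def by (simp add: algebra_simps)
  also have "\<dots> = (LINT \<xi>|(surface_measure :: (real^'n) measure). w (\<xi> $ p) * f (\<xi> $ p)) +
      (LINT \<xi>|(surface_measure :: (real^'n) measure). c * (w (\<xi> $ p) * g (\<xi> $ p)))"
    using assms by (intro Bochner_Integration.integral_add integrable_mult_right integrable_axial_mult)
  finally show ?thesis by (simp add: axial_mean_def)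
qed

lemma continuous_on_bounded_interval:
  fixes f :: "real \<Rightarrow> real"
  assumes "continuous_on {a..b} f"
  obtains B where "0 \<le> B" "\<And>t. t \<in> {a..b} \<Longrightarrow> \<bar>f t\<bar> \<le> B"
proof -
  have "bounded (f ` {a..b})"
    by (intro compact_imp_bounded compact_continuous_image assms) auto
  then obtain B where "\<forall>t\<in>{a..b}. \<bar>f t\<bar> \<le> B" by (auto simp: bounded_iff)
  then show thesis by (intro that[of "\<bar>B\<bar>"]) force+
qed

text \<open>Dominated convergence off the equator, where
  \<open>e\<^sup>2 / (t\<^sup>2 + e\<^sup>2)\<close> tends to 0. The integrable bound comes from
  \<open>ln \<bar>t\<bar> \<le> ln (t\<^sup>2 + e\<^sup>2) / 2 \<le> ln 2 / 2\<close>, valid for all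
  \<open>e \<le> 1\<close>.\<close>

lemma regularized_limit_0:
  fixes p :: "'n::finite"
  assumes d: "d = 0 \<or> d = 1" and h: "smooth h"
  shows "(\<lambda>m. axial_mean p (\<lambda>t. regularized d (1 / (real m + 1)) c P t * h t)) \<longlonglongrightarrow>
    c * axial_mean p (\<lambda>t. ln \<bar>t\<bar> * h t) + poly P 0 * axial_mean p (\<lambda>t. power_weight d t * h t)"
proof -
  let ?M = "surface_measure :: (real^'n) measure"
  let ?f = "\<lambda>t. c * (ln \<bar>t\<bar> * h t) + poly P 0 * (power_weight d t * h t)"
  obtain B where B: "0 \<le> B" "\<And>x. x \<in> {0..1} \<Longrightarrow> \<bar>poly P x\<bar> \<le> B"
    using continuous_on_bounded_interval[OF continuous_on_poly[OF continuous_on_id], of 0 1 P] by blast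
  obtain H where H: "0 \<le> H" "\<And>t. t \<in> {-1..1} \<Longrightarrow> \<bar>h t\<bar> \<le> H"
    using continuous_on_bounded_interval[OF smooth_continuous[OF h]] by blast
  have iln: "integrable ?M (\<lambda>\<xi>. ln \<bar>\<xi> $ p\<bar> * h (\<xi> $ p))"
    by (intro integrable_axial_mult[where w = "\<lambda>t. ln \<bar>t\<bar>"] integrable_ln_coord smooth_continuous h)
  have ipw: "integrable ?M (\<lambda>\<xi>. power_weight d (\<xi> $ p) * h (\<xi> $ p))"
    by (rule integrable_axial[OF continuous_on_mult[OF continuous_on_power_weight smooth_continuous[OF h]]])
  have "(\<lambda>m. LINT \<xi>|?M. regularized d (1 / (real m + 1)) c P (\<xi> $ p) * h (\<xi> $ p)) \<longlonglongrightarrow> (LINT \<xi>|?M. ?f (\<xi> $ p))"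
  proof (rule integral_dominated_convergence)
    show "(\<lambda>\<xi>. ?f (\<xi> $ p)) \<in> borel_measurable ?M"
      by (intro borel_measurable_integrable Bochner_Integration.integrable_add integrable_mult_right iln ipw)
    show "(\<lambda>\<xi>. regularized d (1 / (real m + 1)) c P (\<xi> $ p) * h (\<xi> $ p)) \<in> borel_measurable ?M" for m
      by (intro borel_measurable_integrable integrable_axial smooth_continuous smooth_mult smooth_regularized h) simp
    show "integrable ?M (\<lambda>\<xi>. (\<bar>c\<bar> * (\<bar>ln \<bar>\<xi> $ p\<bar>\<bar> + 1) + 2 * B) * H)"
      by (intro integrable_mult_left Bochner_Integration.integrable_add integrable_mult_right
          integrable_surface_measure_const integrable_abs integrable_ln_coord)
    show "AE \<xi> in ?M. (\<lambda>m. regularized d (1 / (real m + 1)) c P (\<xi> $ p) * h (\<xi> $ p)) \<longlonglongrightarrow> ?f (\<xi> $ p)"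
      using AE_coord_neq_0[of p]
    proof eventually_elim
      case (elim \<xi>)
      define t where "t = \<xi> $ p"
      have "t \<noteq> 0" using elim by (simp add: t_def)
      have "(\<lambda>m. (1 / (real m + 1))\<^sup>2 / (t\<^sup>2 + (1 / (real m + 1))\<^sup>2)) \<longlonglongrightarrow> 0\<^sup>2 / (t\<^sup>2 + 0\<^sup>2)"
        using \<open>t \<noteq> 0\<close> by (intro tendsto_intros tendsto_inverse_Suc) auto
      then have pl: "(\<lambda>m. poly P ((1 / (real m + 1))\<^sup>2 / (t\<^sup>2 + (1 / (real m + 1))\<^sup>2))) \<longlonglongrightarrow> poly P 0"
        by (intro isCont_tendsto_compose[OF poly_isCont]) simp
      have "(\<lambda>m. regularized d (1 / (real m + 1)) c P t * h t) \<longlonglongrightarrow>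
          (c / 2 * ln (t\<^sup>2 + 0\<^sup>2) + (t\<^sup>2 + 0\<^sup>2) powr (d / 2) * poly P 0) * h t"
        unfolding regularized_def using \<open>t \<noteq> 0\<close>
        by (intro tendsto_mult tendsto_add tendsto_const tendsto_ln tendsto_powr tendsto_power tendsto_inverse_Suc pl) auto
      moreover have "ln (t\<^sup>2) = 2 * ln \<bar>t\<bar>" using \<open>t \<noteq> 0\<close> ln_realpow[of "\<bar>t\<bar>" 2] by simp
      moreover have "(t\<^sup>2) powr (d / 2) = power_weight d t"
        using \<open>t \<noteq> 0\<close> d by (auto simp: power_weight_def powr_half_sqrt)
      ultimately show ?case by (simp add: t_def[symmetric] algebra_simps)
    qed
    show "AE \<xi> in ?M. norm (regularized d (1 / (real m + 1)) c P (\<xi> $ p) * h (\<xi> $ p)) \<le> (\<bar>c\<bar> * (\<bar>ln \<bar>\<xi> $ p\<bar>\<bar> + 1) + 2 * B) * H" for m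
      using AE_coord_neq_0[of p] AE_space
    proof eventually_elim
      case (elim \<xi>)
      define t where "t = \<xi> $ p"
      define e where "e = 1 / (real m + 1)"
      have e: "0 < e" "e \<le> 1" by (auto simp: e_def)
      have t: "t \<noteq> 0" "t \<in> {-1..1}" using elim coord_in_unit[of \<xi> p] by (auto simp: t_def)
      then have t1: "\<bar>t\<bar> \<le> 1" by auto
      have t2: "0 < t\<^sup>2" "t\<^sup>2 \<le> 1" using t(1) t1 by (simp_all add: abs_square_le_1)
      have e2: "0 < e\<^sup>2" "e\<^sup>2 \<le> 1" using e by (simp_all add: power_le_one)
      have "ln (2::real) \<le> 2" using ln_le_minus_one[of "2::real"] by simp
      then have "\<bar>ln (t\<^sup>2 + e\<^sup>2) / 2\<bar> \<le> \<bar>ln \<bar>t\<bar>\<bar> + 1"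
        using ln_regularized_bounds[OF t(1) t1 e] by linarith
      then have "\<bar>c\<bar> * \<bar>ln (t\<^sup>2 + e\<^sup>2) / 2\<bar> \<le> \<bar>c\<bar> * (\<bar>ln \<bar>t\<bar>\<bar> + 1)" by (intro mult_left_mono) auto
      then have 1: "\<bar>c / 2 * ln (t\<^sup>2 + e\<^sup>2)\<bar> \<le> \<bar>c\<bar> * (\<bar>ln \<bar>t\<bar>\<bar> + 1)" by (simp add: abs_mult)
      have "(t\<^sup>2 + e\<^sup>2) powr (d / 2) \<le> 2"
      proof (cases "d = 0")
        case False
        then have "(t\<^sup>2 + e\<^sup>2) powr (d / 2) = sqrt (t\<^sup>2 + e\<^sup>2)" using d t2 e2 by (simp add: powr_half_sqrt)
        also have "\<dots> \<le> sqrt 4" using t2 e2 by (intro real_sqrt_le_mono) linarith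
        finally show ?thesis by simp
      qed (use t2 e2 in auto)
      moreover have "\<bar>poly P (e\<^sup>2 / (t\<^sup>2 + e\<^sup>2))\<bar> \<le> B"
        using t2 e2 add_pos_pos[OF t2(1) e2(1)] by (intro B) (auto simp: divide_le_eq)
      ultimately have 2: "\<bar>(t\<^sup>2 + e\<^sup>2) powr (d / 2) * poly P (e\<^sup>2 / (t\<^sup>2 + e\<^sup>2))\<bar> \<le> 2 * B"
        unfolding abs_mult using B(1) by (intro mult_mono) auto
      have "\<bar>regularized d e c P t\<bar> \<le> \<bar>c\<bar> * (\<bar>ln \<bar>t\<bar>\<bar> + 1) + 2 * B"
        unfolding regularized_def by (rule order_trans[OF abs_triangle_ineq add_mono[OF 1 2]])
      then have "\<bar>regularized d e c P t * h t\<bar> \<le> (\<bar>c\<bar> * (\<bar>ln \<bar>t\<bar>\<bar> + 1) + 2 * B) * H"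
        unfolding abs_mult using H(1) H(2)[OF t(2)] B(1) by (intro mult_mono) auto
      then show ?case by (simp add: t_def e_def)
    qed
  qed
  also have "(LINT \<xi>|?M. ?f (\<xi> $ p)) = c * axial_mean p (\<lambda>t. ln \<bar>t\<bar> * h t) + poly P 0 * axial_mean p (\<lambda>t. power_weight d t * h t)"
    unfolding axial_mean_def using iln ipw by simp
  finally show ?thesis by (simp add: axial_mean_def)
qed

text \<open>The last summand stems from \<open>euler ln = 1\<close>: the logarithm is homogeneous only up to a constant.\<close>

primrec log_limit :: "'n::finite \<Rightarrow> nat \<Rightarrow> (real \<Rightarrow> real) \<Rightarrow> real" where
  "log_limit p 0 h = axial_mean p (\<lambda>t. ln \<bar>t\<bar> * h t)"
| "log_limit p (Suc k) h = log_limit p k (axial_laplacian CARD('n) h) + radial_eigenvalue CARD('n) 0 k * log_limit p k h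
     + (real CARD('n) - 2 - 4 * real k) * axial_mean p (laplacian_product CARD('n) 0 k h)"

text \<open>Induction over \<open>k\<close> for all \<open>c\<close>, \<open>P\<close> and
  \<open>h\<close> at once, because trading two derivatives leads to another member
  \<open>(c, P)\<close> of the family and to the spherical Laplacian of \<open>h\<close>. The
  derivatives of the kernel themselves have no integrable limit in general; only the integrals
  converge.\<close>

lemma regularized_limit:
  fixes p :: "'n::finite"
  assumes d: "d = 0 \<or> d = 1" and c: "d = 0 \<or> c = 0" and h: "smooth h"
  shows "(\<lambda>m. axial_mean p (\<lambda>t. (deriv ^^ (2 * k)) (regularized d (1 / (real m + 1)) c P) t * h t)) \<longlonglongrightarrow>
    c * log_limit p k h + poly P 0 * axial_mean p (\<lambda>t. power_weight d t * laplacian_product CARD('n) d k h t)"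
  using c h
proof (induction k arbitrary: c P h)
  case 0
  then show ?case using regularized_limit_0[OF d, of h p c P] by simp
next
  case (Suc k)
  let ?N = "real CARD('n)"
  let ?c = "radial_eigenvalue ?N 0 k * c"
  let ?P = "shifted_euler_poly ?N k d c P"
  let ?W = "\<lambda>h. axial_mean p (\<lambda>t. power_weight d t * h t)"
  have "(\<lambda>m. axial_mean p (\<lambda>t. (deriv ^^ (2 * k)) (regularized d (1 / (real m + 1)) c P) t * axial_laplacian ?N h t) +
      axial_mean p (\<lambda>t. (deriv ^^ (2 * k)) (regularized d (1 / (real m + 1)) ?c ?P) t * h t)) \<longlonglongrightarrow>
    (c * log_limit p k (axial_laplacian ?N h) + poly P 0 * ?W (laplacian_product ?N d k (axial_laplacian ?N h))) +
    (?c * log_limit p k h + poly ?P 0 * ?W (laplacian_product ?N d k h))"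
    using Suc.prems by (intro tendsto_add Suc.IH smooth_axial_laplacian) auto
  moreover have "axial_mean p (\<lambda>t. (deriv ^^ (2 * k)) (regularized d (1 / (real m + 1)) c P) t * axial_laplacian ?N h t) +
      axial_mean p (\<lambda>t. (deriv ^^ (2 * k)) (regularized d (1 / (real m + 1)) ?c ?P) t * h t) =
      axial_mean p (\<lambda>t. (deriv ^^ (2 * Suc k)) (regularized d (1 / (real m + 1)) c P) t * h t)" for m
    using Suc.prems by (subst axial_mean_deriv_even_step) (simp_all add: smooth_regularized shifted_euler_regularized)
  moreover have "(c * log_limit p k (axial_laplacian ?N h) + poly P 0 * ?W (laplacian_product ?N d k (axial_laplacian ?N h))) +
    (?c * log_limit p k h + poly ?P 0 * ?W (laplacian_product ?N d k h)) =
     c * log_limit p (Suc k) h + poly P 0 * ?W (laplacian_product ?N d (Suc k) h)"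
  proof -
    have sm: "smooth (laplacian_product ?N d k h)" using Suc.prems by (intro smooth_laplacian_product) auto
    have "integrable (surface_measure :: (real^'n) measure) (\<lambda>\<xi>. power_weight d (\<xi> $ p))"
      by (rule integrable_axial[OF continuous_on_power_weight])
    then have "?W (laplacian_product ?N d (Suc k) h) =
        ?W (axial_laplacian ?N (laplacian_product ?N d k h)) + radial_eigenvalue ?N d k * ?W (laplacian_product ?N d k h)"
      unfolding laplacian_product.simps
      by (intro axial_mean_weighted_lincomb smooth_continuous sm smooth_axial_laplacian)
    moreover have "c * axial_mean p (laplacian_product ?N 0 k h) = c * ?W (laplacian_product ?N d k h)"
      using Suc.prems(1) by (auto simp: power_weight_def)
    ultimately show ?thesis
      using Suc.prems
      by (cases "c = 0") (simp_all add: poly_shifted_euler_poly_0 laplacian_product_commute algebra_simps)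
  qed
  ultimately show ?case by simp
qed

text \<open>In dimension \<open>N\<close> and for \<open>k > 0\<close>,
  \<open>\<Delta>\<^sup>k\<close> maps \<open>ln \<bar>z\<bar>\<close> to this constant times the
  power \<open>- 2 * k\<close> of \<open>\<bar>z\<bar>\<close>. The term \<open>N - 2\<close> comes
  from the first Laplacian, the later factors are radial eigenvalues.\<close>

primrec log_coefficient :: "real \<Rightarrow> nat \<Rightarrow> real" where
  "log_coefficient N 0 = 0"
| "log_coefficient N (Suc k) = radial_eigenvalue N 0 k * log_coefficient N k + (if k = 0 then N - 2 else 0)"

text \<open>For \<open>k > 0\<close> the correction in the recursion of \<open>log_limit\<close>
  contains the mean of \<open>laplacian_product N 0 k h\<close>, which is 0. So only the correction
  from \<open>k = 0\<close> survives, multiplied by the later radial eigenvalues.\<close>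

lemma log_limit_eq:
  fixes p :: "'n::finite"
  assumes "smooth h"
  shows "log_limit p k h = axial_mean p (\<lambda>t. ln \<bar>t\<bar> * laplacian_product CARD('n) 0 k h t)
    + log_coefficient CARD('n) k * axial_mean p h"
  using assms
proof (induction k arbitrary: h)
  case (Suc k)
  let ?N = "real CARD('n)"
  have sm: "smooth (laplacian_product ?N 0 k h)" using Suc.prems by (rule smooth_laplacian_product)
  have "axial_mean p (\<lambda>t. ln \<bar>t\<bar> * laplacian_product ?N 0 (Suc k) h t) =
      axial_mean p (\<lambda>t. ln \<bar>t\<bar> * axial_laplacian ?N (laplacian_product ?N 0 k h) t)
      + radial_eigenvalue ?N 0 k * axial_mean p (\<lambda>t. ln \<bar>t\<bar> * laplacian_product ?N 0 k h t)"
    unfolding laplacian_product.simps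
    by (intro axial_mean_weighted_lincomb[where w = "\<lambda>t. ln \<bar>t\<bar>"] integrable_ln_coord smooth_continuous sm smooth_axial_laplacian)
  moreover have "(?N - 2 - 4 * real k) * axial_mean p (laplacian_product ?N 0 k h) = (if k = 0 then ?N - 2 else 0) * axial_mean p h"
    using axial_mean_laplacian_product_0[OF Suc.prems, of k p] by auto
  ultimately show ?case
    using Suc.IH[OF Suc.prems] Suc.IH[OF smooth_axial_laplacian[OF Suc.prems], of ?N]
    by (simp add: laplacian_product_commute[OF Suc.prems] axial_mean_axial_laplacian[OF Suc.prems] algebra_simps)
qed simp

text \<open>The functional \<open>T\<close> in the form in which the iterated Laplacian delivers it.
  The next lemma exhibits the same number as a limit of integrals against smooth kernels, the form
  in which homogeneity can be used.\<close>

definition axial_value :: "'n::finite \<Rightarrow> real \<Rightarrow> nat \<Rightarrow> (real \<Rightarrow> real) \<Rightarrow> real" where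
  "axial_value p d k h = axial_mean p (\<lambda>t. kernel_weight d t * laplacian_product CARD('n) d k h t)
    + (if d = 0 then log_coefficient CARD('n) k * axial_mean p h else 0)"

lemma axial_value_limit:
  fixes p :: "'n::finite"
  assumes d: "d = 0 \<or> d = 1" and h: "smooth h"
  shows "(\<lambda>m. axial_mean p (\<lambda>t. (deriv ^^ (2 * k))
      (regularized d (1 / (real m + 1)) (if d = 0 then 1 else 0) (if d = 0 then 0 else 1)) t * h t)) \<longlonglongrightarrow> axial_value p d k h"
  using regularized_limit[OF d _ h, of "if d = 0 then 1 else 0" p k "if d = 0 then 0 else 1"]
    log_limit_eq[OF h, of p k]
  by (cases "d = 0") (auto simp: axial_value_def kernel_weight_def power_weight_def)

text \<open>\<open>scaling_operator h\<close> is the restriction to the sphere of \<open>\<xi>\<^sub>p \<partial>\<^sub>p H\<close>, where \<open>H\<close> is the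
  extension of \<open>h (\<xi>\<^sub>p)\<close> that is homogeneous of degree \<open>-4\<close>.\<close>

definition scaling_operator :: "(real \<Rightarrow> real) \<Rightarrow> real \<Rightarrow> real" where
  "scaling_operator h t = t * (1 - t\<^sup>2) * deriv h t - 4 * t\<^sup>2 * h t"

lemma smooth_scaling_operator: "smooth h \<Longrightarrow> smooth (scaling_operator h)"
  unfolding scaling_operator_def[abs_def]
  by (intro smooth_mult smooth_diff smooth_power smooth_const smooth_ident smooth_deriv)

text \<open>For a kernel \<open>X\<close> with \<open>t X' = (4 - n) X\<close> the divergence
  identity for \<open>X t h\<close> is exactly the claim. Here \<open>X\<close> stands for the
  \<open>2 k\<close>-th derivative of a kernel of degree \<open>d\<close>, and the hypothesis on
  \<open>k\<close> says \<open>d - 2 k = 4 - n\<close>.\<close>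

lemma axial_value_scaling:
  fixes p :: "'n::finite"
  assumes d: "d = 0 \<or> d = 1" and h: "smooth h" and k: "0 < k" "2 * real k = real CARD('n) - 4 + d"
  shows "axial_value p d k (scaling_operator h) = (real CARD('n) - 5) * axial_value p d k h"
proof -
  let ?N = "real CARD('n)"
  let ?c = "if d = 0 then 1 else 0 :: real" and ?P = "if d = 0 then 0 else 1 :: real poly"
  \<comment> \<open>\<open>?R\<close> describes \<open>d - euler\<close> applied to the regularized
    kernel, its defect of homogeneity. \<open>poly ?R 0 = - ?c\<close>, so for \<open>d = 1\<close>
    the defect disappears in the limit. For \<open>d = 0\<close> a constant kernel remains, and its
    contribution is 0 since \<open>k > 0\<close>.\<close>
  let ?R = "smult d ?P - euler_poly d ?c ?P"
  let ?u = "\<lambda>t. (1 - t\<^sup>2) * h t"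
  have u: "smooth ?u" by (intro smooth_mult smooth_diff smooth_const smooth_power smooth_ident h)
  have c: "d = 0 \<or> ?c = 0" by auto
  have step: "axial_mean p (\<lambda>t. (deriv ^^ (2 * k)) (regularized d e ?c ?P) t * scaling_operator h t) =
      (?N - 5) * axial_mean p (\<lambda>t. (deriv ^^ (2 * k)) (regularized d e ?c ?P) t * h t) +
      axial_mean p (\<lambda>t. (deriv ^^ (2 * k)) (regularized d e 0 ?R) t * ?u t)" if "e \<noteq> 0" for e
  proof -
    let ?D = "deriv ^^ (2 * k)"
    let ?r = "regularized d e ?c ?P"
    have r: "smooth ?r" "smooth (regularized d e 0 Q)" for Q using that by (auto intro: smooth_regularized)
    let ?g' = "\<lambda>t. deriv (?D ?r) t * (t * h t) + ?D ?r t * (h t + t * deriv h t)"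
    have "axial_mean p (\<lambda>t. (1 - t\<^sup>2) * ?g' t - (?N - 1) * t * (?D ?r t * (t * h t))) = 0"
    proof (rule axial_mean_divergence)
      show "((\<lambda>t. ?D ?r t * (t * h t)) has_real_derivative ?g' t) (at t)" for t
        using DERIV_mult[OF smooth_DERIV[OF smooth_funpow_deriv[OF r(1)]] DERIV_mult[OF DERIV_ident smooth_DERIV[OF h]], of "2 * k" t]
        by (simp only: mult_1 mult.commute[of _ "?D ?r t"] mult.commute[of _ t] add.commute[of _ "t * _"])
      show "continuous_on UNIV ?g'"
        by (intro smooth_continuous smooth_add smooth_mult smooth_deriv smooth_funpow_deriv r h smooth_ident)
    qed
    moreover have "(1 - t\<^sup>2) * ?g' t - (?N - 1) * t * (?D ?r t * (t * h t)) =
        ?D ?r t * scaling_operator h t - ((?N - 5) * (?D ?r t * h t) + ?D (regularized d e 0 ?R) t * ?u t)" for t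
    proof -
      have collect: "d * X - (Y + (?N - 4 + d) * X) = - Y - (?N - 4) * X" for X Y
        by (simp add: algebra_simps)
      have "d * ?c = 0" by auto
      then have R: "regularized d e 0 ?R = (\<lambda>t. d * ?r t + (- 1) * euler ?r t)"
        unfolding euler_regularized[OF that c] by (auto simp: regularized_def fun_eq_iff algebra_simps)
      have "?D (regularized d e 0 ?R) t = ?D (\<lambda>t. d * ?r t) t + ?D (\<lambda>t. (- 1) * euler ?r t) t"
        unfolding R by (subst funpow_deriv_add) (intro smooth_mult smooth_const smooth_euler r refl)+
      also have "\<dots> = d * ?D ?r t + (- 1) * ?D (euler ?r) t"
        by (simp only: funpow_deriv_cmult r(1) smooth_euler[OF r(1)])
      finally have "?D (regularized d e 0 ?R) t = d * ?D ?r t - ?D (euler ?r) t" by simp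
      moreover have "?D (euler ?r) t = t * deriv (?D ?r) t + 2 * real k * ?D ?r t"
        using euler_funpow_deriv[OF r(1), of t "2 * k"] by simp
      ultimately have Z: "?D (regularized d e 0 ?R) t = - (t * deriv (?D ?r) t) - (?N - 4) * ?D ?r t"
        unfolding k(2) by (simp only: collect)
      have algebra: "(1 - t\<^sup>2) * (X' * (t * h0) + X * (h0 + t * h1)) - (N - 1) * t * (X * (t * h0)) =
        X * (t * (1 - t\<^sup>2) * h1 - 4 * t\<^sup>2 * h0) - ((N - 5) * (X * h0) + (- (t * X') - (N - 4) * X) * ((1 - t\<^sup>2) * h0))"
        for X X' h0 h1 N :: real
        by (simp add: algebra_simps power2_eq_square)
      show ?thesis
        unfolding Z scaling_operator_def by (rule algebra)
    qed
    ultimately have "axial_mean p (\<lambda>t. ?D ?r t * scaling_operator h t - ((?N - 5) * (?D ?r t * h t) + ?D (regularized d e 0 ?R) t * ?u t)) = 0"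
      by (simp only:)
    moreover have "axial_mean p (\<lambda>t. ?D ?r t * scaling_operator h t - ((?N - 5) * (?D ?r t * h t) + ?D (regularized d e 0 ?R) t * ?u t)) =
        axial_mean p (\<lambda>t. ?D ?r t * scaling_operator h t) -
        ((?N - 5) * axial_mean p (\<lambda>t. ?D ?r t * h t) + axial_mean p (\<lambda>t. ?D (regularized d e 0 ?R) t * ?u t))"
    proof -
      have sm: "smooth (\<lambda>t. ?D ?r t * scaling_operator h t)" "smooth (\<lambda>t. (?N - 5) * (?D ?r t * h t))"
        "smooth (\<lambda>t. ?D (regularized d e 0 ?R) t * ?u t)"
        by (intro smooth_mult smooth_const smooth_funpow_deriv r h smooth_scaling_operator smooth_diff smooth_power smooth_ident)+
      show ?thesis
        unfolding axial_mean_diff[OF smooth_continuous[OF sm(1)] smooth_continuous[OF smooth_add[OF sm(2,3)]]]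
          axial_mean_add[OF smooth_continuous[OF sm(2)] smooth_continuous[OF sm(3)]] axial_mean_cmult ..
    qed
    ultimately show ?thesis by linarith
  qed
  have nz: "1 / (real m + 1) \<noteq> 0" for m by simp
  have "(\<lambda>m. axial_mean p (\<lambda>t. (deriv ^^ (2 * k)) (regularized d (1 / (real m + 1)) 0 ?R) t * ?u t)) \<longlonglongrightarrow>
      0 * log_limit p k ?u + poly ?R 0 * axial_mean p (\<lambda>t. power_weight d t * laplacian_product ?N d k ?u t)"
    by (rule regularized_limit[OF d _ u]) simp
  also have "poly ?R 0 * axial_mean p (\<lambda>t. power_weight d t * laplacian_product ?N d k ?u t) = 0"
    using axial_mean_laplacian_product_0[OF u k(1), of p]
    by (cases "d = 0") (auto simp: poly_euler_poly_0 power_weight_def)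
  finally have "(\<lambda>m. (?N - 5) * axial_mean p (\<lambda>t. (deriv ^^ (2 * k)) (regularized d (1 / (real m + 1)) ?c ?P) t * h t) +
      axial_mean p (\<lambda>t. (deriv ^^ (2 * k)) (regularized d (1 / (real m + 1)) 0 ?R) t * ?u t)) \<longlonglongrightarrow>
     (?N - 5) * axial_value p d k h + (0 * log_limit p k ?u + 0)"
    by (intro tendsto_add tendsto_mult tendsto_const axial_value_limit[OF d h])
  moreover have "(\<lambda>m. axial_mean p (\<lambda>t. (deriv ^^ (2 * k)) (regularized d (1 / (real m + 1)) ?c ?P) t * scaling_operator h t))
      \<longlonglongrightarrow> axial_value p d k (scaling_operator h)"
    by (intro axial_value_limit[OF d] smooth_scaling_operator h)
  ultimately have "(?N - 5) * axial_value p d k h + (0 * log_limit p k ?u + 0) = axial_value p d k (scaling_operator h)"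
    unfolding step[OF nz] by (rule LIMSEQ_unique)
  then show ?thesis by simp
qed

section \<open>A trigonometric family of quartics\<close>

definition quartic :: "real \<Rightarrow> real \<Rightarrow> real" where
  "quartic \<theta> t = t ^ 4 + 2 * cos \<theta> * t\<^sup>2 * (1 - t\<^sup>2) + (1 - t\<^sup>2)\<^sup>2"

lemma quartic_alt: "quartic \<theta> t = 1 - 2 * (1 - cos \<theta>) * (t\<^sup>2 * (1 - t\<^sup>2))"
  by (simp add: quartic_def algebra_simps power2_eq_square power4_eq_xxxx)

lemma cos_gt_minus_one:
  assumes "\<theta> \<in> {-pi<..<pi}"
  shows "-1 < cos \<theta>"
proof -
  have "cos pi < cos \<bar>\<theta>\<bar>" using assms by (intro cos_monotone_0_pi) auto
  then show ?thesis by (simp add: abs_if split: if_splits)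
qed

text \<open>\<open>t\<^sup>2 (1 - t\<^sup>2) \<le> 1 / 4\<close> holds for every real
  \<open>t\<close>, not only on \<open>{-1..1}\<close>. Hence the reciprocal is smooth on the whole
  line, as \<open>smooth\<close> demands.\<close>

lemma quartic_pos:
  assumes "\<theta> \<in> {-pi<..<pi}"
  shows "0 < quartic \<theta> t"
proof -
  have "0 \<le> (2 * t\<^sup>2 - 1)\<^sup>2" by simp
  then have "t\<^sup>2 * (1 - t\<^sup>2) \<le> 1 / 4" by (simp add: power2_eq_square algebra_simps)
  then have "2 * (1 - cos \<theta>) * (t\<^sup>2 * (1 - t\<^sup>2)) \<le> 2 * (1 - cos \<theta>) * (1 / 4)"
    by (intro mult_left_mono) auto
  then show ?thesis using cos_gt_minus_one[OF assms] by (simp add: quartic_alt)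
qed

text \<open>An algebra closed, for \<open>\<bar>\<theta>\<bar> < \<pi>\<close>, under both partial
  derivatives and containing \<open>sin \<theta> / Q\<^sub>\<theta>\<close>. Joint continuity,
  smoothness in \<open>t\<close> and differentiability in \<open>\<theta>\<close> can thus be
  settled once for all functions that arise from repeated differentiation.\<close>

inductive trig_rational :: "(real \<Rightarrow> real \<Rightarrow> real) \<Rightarrow> bool" where
  const: "trig_rational (\<lambda>\<theta> t. c)"
| coord: "trig_rational (\<lambda>\<theta> t. t)"
| cos: "trig_rational (\<lambda>\<theta> t. cos \<theta>)"
| sin: "trig_rational (\<lambda>\<theta> t. sin \<theta>)"
| inv: "trig_rational (\<lambda>\<theta> t. inverse (quartic \<theta> t))"
| add: "trig_rational F \<Longrightarrow> trig_rational G \<Longrightarrow> trig_rational (\<lambda>\<theta> t. F \<theta> t + G \<theta> t)"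
| mult: "trig_rational F \<Longrightarrow> trig_rational G \<Longrightarrow> trig_rational (\<lambda>\<theta> t. F \<theta> t * G \<theta> t)"

lemma trig_rational_minus: "trig_rational F \<Longrightarrow> trig_rational (\<lambda>\<theta> t. - F \<theta> t)"
  using trig_rational.mult[OF trig_rational.const[of "-1"], of F] by simp

lemma trig_rational_diff: "trig_rational F \<Longrightarrow> trig_rational G \<Longrightarrow> trig_rational (\<lambda>\<theta> t. F \<theta> t - G \<theta> t)"
  using trig_rational.add[OF _ trig_rational_minus, of F G] by simp

lemma trig_rational_power: "trig_rational F \<Longrightarrow> trig_rational (\<lambda>\<theta> t. F \<theta> t ^ m)"
  by (induction m) (auto intro: trig_rational.const trig_rational.mult)

lemmas trig_rational_intros = trig_rational.intros trig_rational_minus trig_rational_diff trig_rational_power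

lemma quartic_DERIV:
  "((\<lambda>t. quartic \<theta> t) has_real_derivative - 4 * (1 - cos \<theta>) * t * (1 - 2 * t\<^sup>2)) (at t)"
  "((\<lambda>\<theta>. quartic \<theta> t) has_real_derivative - 2 * sin \<theta> * (t\<^sup>2 * (1 - t\<^sup>2))) (at \<theta>)"
  unfolding quartic_alt[abs_def]
  by (auto intro!: derivative_eq_intros simp: algebra_simps power2_eq_square power3_eq_cube)

text \<open>\<open>M\<close> is the second derivative in both orders, so that the symmetry of mixed
  derivatives becomes part of the induction over \<open>trig_rational\<close>.\<close>

definition mixed_derivs ::
  "(real \<Rightarrow> real \<Rightarrow> real) \<Rightarrow> (real \<Rightarrow> real \<Rightarrow> real) \<Rightarrow> (real \<Rightarrow> real \<Rightarrow> real) \<Rightarrow> (real \<Rightarrow> real \<Rightarrow> real) \<Rightarrow> bool" where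
  "mixed_derivs F G H M \<longleftrightarrow>
    (\<forall>\<theta>\<in>{-pi<..<pi}. \<forall>t. ((\<lambda>t. F \<theta> t) has_real_derivative G \<theta> t) (at t) \<and>
       ((\<lambda>\<theta>. F \<theta> t) has_real_derivative H \<theta> t) (at \<theta>) \<and>
       ((\<lambda>\<theta>. G \<theta> t) has_real_derivative M \<theta> t) (at \<theta>) \<and>
       ((\<lambda>t. H \<theta> t) has_real_derivative M \<theta> t) (at t))"

lemma mixed_derivsD:
  assumes "mixed_derivs F G H M" "\<theta> \<in> {-pi<..<pi}"
  shows "((\<lambda>t. F \<theta> t) has_real_derivative G \<theta> t) (at t)"
    "((\<lambda>\<theta>. F \<theta> t) has_real_derivative H \<theta> t) (at \<theta>)"
    "((\<lambda>\<theta>. G \<theta> t) has_real_derivative M \<theta> t) (at \<theta>)"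
    "((\<lambda>t. H \<theta> t) has_real_derivative M \<theta> t) (at t)"
  using assms by (auto simp: mixed_derivs_def)

lemma mixed_derivsI:
  assumes "\<And>\<theta> t. \<theta> \<in> {-pi<..<pi} \<Longrightarrow> ((\<lambda>t. F \<theta> t) has_real_derivative G \<theta> t) (at t)"
    "\<And>\<theta> t. \<theta> \<in> {-pi<..<pi} \<Longrightarrow> ((\<lambda>\<theta>. F \<theta> t) has_real_derivative H \<theta> t) (at \<theta>)"
    "\<And>\<theta> t. \<theta> \<in> {-pi<..<pi} \<Longrightarrow> ((\<lambda>\<theta>. G \<theta> t) has_real_derivative M \<theta> t) (at \<theta>)"
    "\<And>\<theta> t. \<theta> \<in> {-pi<..<pi} \<Longrightarrow> ((\<lambda>t. H \<theta> t) has_real_derivative M \<theta> t) (at t)"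
  shows "mixed_derivs F G H M"
  unfolding mixed_derivs_def using assms by (intro ballI allI conjI)

lemma ex_mixed_derivsI:
  "mixed_derivs F G H M \<Longrightarrow> trig_rational G \<Longrightarrow> trig_rational H \<Longrightarrow> trig_rational M \<Longrightarrow>
    \<exists>G H M. trig_rational G \<and> trig_rational H \<and> trig_rational M \<and> mixed_derivs F G H M"
  by blast

lemma trig_rational_derivs:
  assumes "trig_rational F"
  shows "\<exists>G H M. trig_rational G \<and> trig_rational H \<and> trig_rational M \<and> mixed_derivs F G H M"
  using assms
proof induction
  case (const c)
  have "mixed_derivs (\<lambda>_ _. c) (\<lambda>_ _. 0) (\<lambda>_ _. 0) (\<lambda>_ _. 0)"
    by (rule mixed_derivsI) auto
  then show ?case by (rule ex_mixed_derivsI) (rule trig_rational.const)+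
next
  case coord
  have "mixed_derivs (\<lambda>_ t. t) (\<lambda>_ _. 1) (\<lambda>_ _. 0) (\<lambda>_ _. 0)"
    by (rule mixed_derivsI) auto
  then show ?case by (rule ex_mixed_derivsI) (rule trig_rational.const)+
next
  case cos
  have "mixed_derivs (\<lambda>\<theta> _. cos \<theta>) (\<lambda>_ _. 0) (\<lambda>\<theta> _. - sin \<theta>) (\<lambda>_ _. 0)"
    by (rule mixed_derivsI) (auto intro!: derivative_eq_intros)
  then show ?case
    by (rule ex_mixed_derivsI) (rule trig_rational.const trig_rational_minus[OF trig_rational.sin])+
next
  case sin
  have "mixed_derivs (\<lambda>\<theta> _. sin \<theta>) (\<lambda>_ _. 0) (\<lambda>\<theta> _. cos \<theta>) (\<lambda>_ _. 0)"
    by (rule mixed_derivsI) (auto intro!: derivative_eq_intros)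
  then show ?case by (rule ex_mixed_derivsI) (rule trig_rational.const trig_rational.cos)+
next
  case inv
  let ?i = "\<lambda>\<theta> t. inverse (quartic \<theta> t)"
  define qt where "qt \<theta> t = - 4 * (1 - cos \<theta>) * t * (1 - 2 * t\<^sup>2)" for \<theta> t :: real
  define q\<theta> where "q\<theta> \<theta> t = - 2 * sin \<theta> * (t\<^sup>2 * (1 - t\<^sup>2))" for \<theta> t :: real
  define q2 where "q2 \<theta> t = - 4 * sin \<theta> * t * (1 - 2 * t\<^sup>2)" for \<theta> t :: real
  let ?G = "\<lambda>\<theta> t. - (qt \<theta> t * (?i \<theta> t)\<^sup>2)"
  let ?H = "\<lambda>\<theta> t. - (q\<theta> \<theta> t * (?i \<theta> t)\<^sup>2)"
  let ?M = "\<lambda>\<theta> t. 2 * qt \<theta> t * q\<theta> \<theta> t * (?i \<theta> t) ^ 3 - q2 \<theta> t * (?i \<theta> t)\<^sup>2"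
  have tr: "trig_rational qt" "trig_rational q\<theta>" "trig_rational q2"
    unfolding qt_def[abs_def] q\<theta>_def[abs_def] q2_def[abs_def] by (intro trig_rational_intros)+
  have 3: "((\<lambda>\<theta>. qt \<theta> t) has_real_derivative q2 \<theta> t) (at \<theta>)"
    "((\<lambda>t. q\<theta> \<theta> t) has_real_derivative q2 \<theta> t) (at t)" for \<theta> t
    unfolding qt_def q\<theta>_def q2_def
    by (auto intro!: derivative_eq_intros simp: algebra_simps power2_eq_square)
  have 1: "((\<lambda>t. ?i \<theta> t) has_real_derivative ?G \<theta> t) (at t)" if "\<theta> \<in> {-pi<..<pi}" for \<theta> t
    using DERIV_inverse_fun[OF quartic_DERIV(1)[of \<theta> t, folded qt_def]] quartic_pos[OF that, of t]
    by (simp add: power2_eq_square mult_ac)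
  have 2: "((\<lambda>\<theta>. ?i \<theta> t) has_real_derivative ?H \<theta> t) (at \<theta>)" if "\<theta> \<in> {-pi<..<pi}" for \<theta> t
    using DERIV_inverse_fun[OF quartic_DERIV(2)[of t \<theta>, folded q\<theta>_def]] quartic_pos[OF that, of t]
    by (simp add: power2_eq_square mult_ac)
  have 4: "((\<lambda>\<theta>. ?G \<theta> t) has_real_derivative
      - (q2 \<theta> t * (?i \<theta> t)\<^sup>2 + (of_nat 2 * (?H \<theta> t * (?i \<theta> t) ^ (2 - Suc 0))) * qt \<theta> t)) (at \<theta>)"
    if "\<theta> \<in> {-pi<..<pi}" for \<theta> t
    by (intro DERIV_minus DERIV_mult 3 DERIV_power 2 that)
  have 5: "((\<lambda>t. ?H \<theta> t) has_real_derivative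
      - (q2 \<theta> t * (?i \<theta> t)\<^sup>2 + (of_nat 2 * (?G \<theta> t * (?i \<theta> t) ^ (2 - Suc 0))) * q\<theta> \<theta> t)) (at t)"
    if "\<theta> \<in> {-pi<..<pi}" for \<theta> t
    by (intro DERIV_minus DERIV_mult 3 DERIV_power 1 that)
  have alg: "- (c * i\<^sup>2 + (of_nat 2 * (- (b * i\<^sup>2) * i ^ (2 - Suc 0))) * a) = 2 * a * b * i ^ 3 - c * i\<^sup>2"
    "- (c * i\<^sup>2 + (of_nat 2 * (- (a * i\<^sup>2) * i ^ (2 - Suc 0))) * b) = 2 * a * b * i ^ 3 - c * i\<^sup>2" for a b c i :: real
    by (simp_all add: power2_eq_square power3_eq_cube algebra_simps)
  have "mixed_derivs ?i ?G ?H ?M"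
    by (rule mixed_derivsI) (rule 1 2 4[unfolded alg(1)] 5[unfolded alg(2)], assumption)+
  moreover have "trig_rational ?G" "trig_rational ?H" "trig_rational ?M"
    by (intro trig_rational_intros tr)+
  ultimately show ?case by (rule ex_mixed_derivsI)
next
  case (add F F')
  from add.IH(1) obtain G H M where tr1: "trig_rational G" "trig_rational H" "trig_rational M"
    and D1: "mixed_derivs F G H M" by (elim exE conjE) (rule that)
  from add.IH(2) obtain G' H' M' where tr2: "trig_rational G'" "trig_rational H'" "trig_rational M'"
    and D2: "mixed_derivs F' G' H' M'" by (elim exE conjE) (rule that)
  note tr = tr1 tr2 and D = D1 D2
  have "mixed_derivs (\<lambda>\<theta> t. F \<theta> t + F' \<theta> t) (\<lambda>\<theta> t. G \<theta> t + G' \<theta> t) (\<lambda>\<theta> t. H \<theta> t + H' \<theta> t) (\<lambda>\<theta> t. M \<theta> t + M' \<theta> t)"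
    by (rule mixed_derivsI; intro DERIV_add mixed_derivsD[OF D(1)] mixed_derivsD[OF D(2)])
  then show ?case by (rule ex_mixed_derivsI) (intro trig_rational.add tr)+
next
  case (mult F F')
  from mult.IH(1) obtain G H M where tr1: "trig_rational G" "trig_rational H" "trig_rational M"
    and D1: "mixed_derivs F G H M" by (elim exE conjE) (rule that)
  from mult.IH(2) obtain G' H' M' where tr2: "trig_rational G'" "trig_rational H'" "trig_rational M'"
    and D2: "mixed_derivs F' G' H' M'" by (elim exE conjE) (rule that)
  note tr = tr1 tr2 and D = D1 D2
  let ?G = "\<lambda>\<theta> t. G \<theta> t * F' \<theta> t + G' \<theta> t * F \<theta> t"
  let ?H = "\<lambda>\<theta> t. H \<theta> t * F' \<theta> t + H' \<theta> t * F \<theta> t"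
  let ?M = "\<lambda>\<theta> t. (M \<theta> t * F' \<theta> t + H' \<theta> t * G \<theta> t) + (M' \<theta> t * F \<theta> t + H \<theta> t * G' \<theta> t)"
  have M: "(M \<theta> t * F' \<theta> t + G' \<theta> t * H \<theta> t) + (M' \<theta> t * F \<theta> t + G \<theta> t * H' \<theta> t) = ?M \<theta> t" for \<theta> t
    by (simp add: algebra_simps)
  have "mixed_derivs (\<lambda>\<theta> t. F \<theta> t * F' \<theta> t) ?G ?H ?M"
  proof (rule mixed_derivsI)
    fix \<theta> t :: real assume \<theta>: "\<theta> \<in> {-pi<..<pi}"
    note D = mixed_derivsD[OF D(1) \<theta>] mixed_derivsD[OF D(2) \<theta>]
    show "((\<lambda>t. F \<theta> t * F' \<theta> t) has_real_derivative ?G \<theta> t) (at t)"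
      "((\<lambda>\<theta>. F \<theta> t * F' \<theta> t) has_real_derivative ?H \<theta> t) (at \<theta>)"
      "((\<lambda>\<theta>. ?G \<theta> t) has_real_derivative ?M \<theta> t) (at \<theta>)"
      by (intro DERIV_add DERIV_mult D)+
    show "((\<lambda>t. ?H \<theta> t) has_real_derivative ?M \<theta> t) (at t)"
      unfolding M[symmetric] by (intro DERIV_add DERIV_mult D)
  qed
  moreover have "trig_rational ?G" "trig_rational ?H" "trig_rational ?M"
    by (intro trig_rational.add trig_rational.mult tr mult)+
  ultimately show ?case by (rule ex_mixed_derivsI)
qed

lemma trig_rational_continuous:
  assumes "trig_rational F"
  shows "continuous_on ({-pi<..<pi} \<times> UNIV) (\<lambda>(\<theta>, t). F \<theta> t)"
  using assms
proof induction
  case inv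
  have "continuous_on ({-pi<..<pi} \<times> UNIV) (\<lambda>x. inverse (quartic (fst x) (snd x)))"
  proof (rule continuous_on_inverse)
    show "continuous_on ({-pi<..<pi} \<times> UNIV) (\<lambda>x. quartic (fst x) (snd x))"
      unfolding quartic_def by (intro continuous_intros)
    show "\<forall>x\<in>{-pi<..<pi} \<times> UNIV. quartic (fst x) (snd x) \<noteq> 0"
    proof
      fix x :: "real \<times> real" assume "x \<in> {-pi<..<pi} \<times> UNIV"
      then have "0 < quartic (fst x) (snd x)" by (intro quartic_pos) auto
      then show "quartic (fst x) (snd x) \<noteq> 0" by simp
    qed
  qed
  then show ?case by (simp add: case_prod_beta)
qed (auto simp: case_prod_beta intro!: continuous_intros)

lemma smooth_trig_rational:
  assumes "trig_rational F" "\<theta> \<in> {-pi<..<pi}"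
  shows "smooth (F \<theta>)"
proof -
  have "times_differentiable k (F \<theta>)" if "trig_rational F" for k F
    using that
  proof (induction k arbitrary: F)
    case 0
    obtain G where "\<And>t. (F \<theta> has_real_derivative G \<theta> t) (at t)"
      using trig_rational_derivs[OF 0] mixed_derivsD(1)[OF _ assms(2)] by blast
    then show ?case using DERIV_imp_continuous_on[of "F \<theta>" "G \<theta>"] by simp
  next
    case (Suc k)
    obtain G where "trig_rational G" "\<And>t. (F \<theta> has_real_derivative G \<theta> t) (at t)"
      using trig_rational_derivs[OF Suc.prems] mixed_derivsD(1)[OF _ assms(2)] by blast
    then show ?case using Suc.IH[of G] by (intro times_differentiable_SucI)
  qed
  then show ?thesis using assms(1) by (simp add: smooth_def)
qed

definition param_deriv :: "(real \<Rightarrow> real \<Rightarrow> real) \<Rightarrow> (real \<Rightarrow> real \<Rightarrow> real) \<Rightarrow> bool" where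
  "param_deriv F H \<longleftrightarrow> trig_rational F \<and> trig_rational H \<and>
     (\<forall>\<theta>\<in>{-pi<..<pi}. \<forall>t. ((\<lambda>\<theta>. F \<theta> t) has_real_derivative H \<theta> t) (at \<theta>))"

text \<open>Equality of mixed derivatives: differentiating a family and its
  \<open>\<theta>\<close>-derivative in \<open>t\<close> gives such a pair again. This lets
  \<open>\<theta>\<close>-derivatives pass through the spherical Laplacians in
  \<open>laplacian_product\<close>.\<close>

lemma param_deriv_deriv:
  assumes "param_deriv F H"
  obtains G M where "param_deriv G M" "\<And>\<theta>. \<theta> \<in> {-pi<..<pi} \<Longrightarrow> deriv (F \<theta>) = G \<theta>"
    "\<And>\<theta>. \<theta> \<in> {-pi<..<pi} \<Longrightarrow> deriv (H \<theta>) = M \<theta>"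
proof -
  obtain G H' M where tr: "trig_rational G" "trig_rational M" and D: "mixed_derivs F G H' M"
    using trig_rational_derivs[of F] assms unfolding param_deriv_def by blast
  have H: "H \<theta> = H' \<theta>" if "\<theta> \<in> {-pi<..<pi}" for \<theta>
    using assms mixed_derivsD(2)[OF D that] that DERIV_unique unfolding param_deriv_def by blast
  show ?thesis
  proof (rule that)
    show "param_deriv G M" using tr mixed_derivsD(3)[OF D] by (simp add: param_deriv_def)
    fix \<theta> assume \<theta>: "\<theta> \<in> {-pi<..<pi}"
    show "deriv (F \<theta>) = G \<theta>" by (intro ext DERIV_imp_deriv mixed_derivsD(1)[OF D \<theta>])
    show "deriv (H \<theta>) = M \<theta>" unfolding H[OF \<theta>] by (intro ext DERIV_imp_deriv mixed_derivsD(4)[OF D \<theta>])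
  qed
qed

lemma param_deriv_add: "param_deriv F H \<Longrightarrow> param_deriv F' H' \<Longrightarrow> param_deriv (\<lambda>\<theta> t. F \<theta> t + F' \<theta> t) (\<lambda>\<theta> t. H \<theta> t + H' \<theta> t)"
  by (auto simp: param_deriv_def intro!: trig_rational.add DERIV_add)

lemma param_deriv_mult:
  assumes "param_deriv F H" "trig_rational (\<lambda>_. a)"
  shows "param_deriv (\<lambda>\<theta> t. a t * F \<theta> t) (\<lambda>\<theta> t. a t * H \<theta> t)"
  using assms by (auto simp: param_deriv_def intro!: trig_rational.mult DERIV_cmult)

lemma param_deriv_axial_laplacian:
  assumes "param_deriv F H"
  obtains L K where "param_deriv L K" "\<And>\<theta>. \<theta> \<in> {-pi<..<pi} \<Longrightarrow> axial_laplacian N (F \<theta>) = L \<theta>"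
    "\<And>\<theta>. \<theta> \<in> {-pi<..<pi} \<Longrightarrow> axial_laplacian N (H \<theta>) = K \<theta>"
proof -
  obtain G M where 1: "param_deriv G M" "\<And>\<theta>. \<theta> \<in> {-pi<..<pi} \<Longrightarrow> deriv (F \<theta>) = G \<theta>"
    "\<And>\<theta>. \<theta> \<in> {-pi<..<pi} \<Longrightarrow> deriv (H \<theta>) = M \<theta>" using param_deriv_deriv[OF assms] by blast
  obtain G2 M2 where 2: "param_deriv G2 M2" "\<And>\<theta>. \<theta> \<in> {-pi<..<pi} \<Longrightarrow> deriv (G \<theta>) = G2 \<theta>"
    "\<And>\<theta>. \<theta> \<in> {-pi<..<pi} \<Longrightarrow> deriv (M \<theta>) = M2 \<theta>" using param_deriv_deriv[OF 1(1)] by blast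
  show ?thesis
  proof (rule that)
    show "param_deriv (\<lambda>\<theta> t. (1 - t\<^sup>2) * G2 \<theta> t + (- ((N - 1) * t)) * G \<theta> t)
        (\<lambda>\<theta> t. (1 - t\<^sup>2) * M2 \<theta> t + (- ((N - 1) * t)) * M \<theta> t)"
      by (intro param_deriv_add param_deriv_mult 1 2 trig_rational_intros)
  qed (simp_all add: axial_laplacian_def fun_eq_iff 1 2)
qed

lemma param_deriv_laplacian_product:
  assumes "param_deriv F H"
  shows "\<exists>L K. param_deriv L K \<and> (\<forall>\<theta>\<in>{-pi<..<pi}. laplacian_product N d k (F \<theta>) = L \<theta> \<and> laplacian_product N d k (H \<theta>) = K \<theta>)"
proof (induction k)
  case 0
  then show ?case using assms by auto
next
  case (Suc k)
  then obtain L K where 1: "param_deriv L K"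
    "\<And>\<theta>. \<theta> \<in> {-pi<..<pi} \<Longrightarrow> laplacian_product N d k (F \<theta>) = L \<theta>"
    "\<And>\<theta>. \<theta> \<in> {-pi<..<pi} \<Longrightarrow> laplacian_product N d k (H \<theta>) = K \<theta>" by blast
  obtain L' K' where 2: "param_deriv L' K'" "\<And>\<theta>. \<theta> \<in> {-pi<..<pi} \<Longrightarrow> axial_laplacian N (L \<theta>) = L' \<theta>"
    "\<And>\<theta>. \<theta> \<in> {-pi<..<pi} \<Longrightarrow> axial_laplacian N (K \<theta>) = K' \<theta>"
    using param_deriv_axial_laplacian[OF 1(1)] by blast
  have "param_deriv (\<lambda>\<theta> t. L' \<theta> t + radial_eigenvalue N d k * L \<theta> t) (\<lambda>\<theta> t. K' \<theta> t + radial_eigenvalue N d k * K \<theta> t)"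
    by (intro param_deriv_add param_deriv_mult 1 2 trig_rational_intros)
  then show ?case
    by (intro exI[of _ "\<lambda>\<theta> t. L' \<theta> t + radial_eigenvalue N d k * L \<theta> t"]
        exI[of _ "\<lambda>\<theta> t. K' \<theta> t + radial_eigenvalue N d k * K \<theta> t"]) (simp add: 1 2)
qed

lemma axial_mean_param_DERIV:
  fixes p :: "'n::finite"
  assumes FH: "param_deriv F H" and \<theta>: "\<theta> \<in> {-pi<..<pi}"
    and w: "integrable (surface_measure :: (real^'n) measure) (\<lambda>\<xi>. w (\<xi> $ p))"
  shows "((\<lambda>\<theta>. axial_mean p (\<lambda>t. w t * F \<theta> t)) has_real_derivative axial_mean p (\<lambda>t. w t * H \<theta> t)) (at \<theta>)"
  unfolding axial_mean_def
proof -
  \<comment> \<open>Half the distance from \<open>\<theta>\<close> to the ends of the interval, so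
    that \<open>cball \<theta> d\<close> is a compact subset on which \<open>H\<close> is
    bounded.\<close>
  define d where "d = (pi - \<bar>\<theta>\<bar>) / 2"
  have d: "d > 0" using \<theta> by (auto simp: d_def abs_if)
  have ball: "s \<in> {-pi<..<pi}" "s \<in> cball \<theta> d" if "\<bar>s - \<theta>\<bar> \<le> d" for s
    using that \<theta> by (auto simp: d_def dist_real_def abs_if split: if_splits)
  have tr: "trig_rational F" "trig_rational H" using FH by (auto simp: param_deriv_def)
  have "cball \<theta> d \<times> {-1..1} \<subseteq> {-pi<..<pi} \<times> (UNIV :: real set)"
    using ball by (auto simp: dist_real_def abs_minus_commute)
  then have "compact ((\<lambda>(\<theta>, t). H \<theta> t) ` (cball \<theta> d \<times> {-1..1}))"
    by (intro compact_continuous_image continuous_on_subset[OF trig_rational_continuous[OF tr(2)]] compact_Times) auto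
  then obtain B where B: "\<And>s t. s \<in> cball \<theta> d \<Longrightarrow> t \<in> {-1..1} \<Longrightarrow> \<bar>H s t\<bar> \<le> B"
    using compact_imp_bounded[of "(\<lambda>(\<theta>, t). H \<theta> t) ` (cball \<theta> d \<times> {-1..1})"] unfolding bounded_iff by fastforce
  have int: "integrable (surface_measure :: (real^'n) measure) (\<lambda>\<xi>. w (\<xi> $ p) * G s (\<xi> $ p))"
    if "trig_rational G" "s \<in> {-pi<..<pi}" for G s
    by (intro integrable_axial_mult w smooth_continuous smooth_trig_rational that)
  show "((\<lambda>s. LINT \<xi>|(surface_measure :: (real^'n) measure). w (\<xi> $ p) * F s (\<xi> $ p)) has_real_derivative
      (LINT \<xi>|(surface_measure :: (real^'n) measure). w (\<xi> $ p) * H \<theta> (\<xi> $ p))) (at \<theta>)"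
  proof (rule has_real_derivative_integral[OF d])
    show "integrable (surface_measure :: (real^'n) measure) (\<lambda>\<xi>. w (\<xi> $ p) * F s (\<xi> $ p))" if "\<bar>s - \<theta>\<bar> < d" for s
      using that by (intro int tr ball) auto
    show "((\<lambda>s. w (\<xi> $ p) * F s (\<xi> $ p)) has_real_derivative w (\<xi> $ p) * H s (\<xi> $ p)) (at s)" if "\<bar>s - \<theta>\<bar> < d" for s and \<xi> :: "real^'n"
      using that FH ball(1)[of s] by (intro DERIV_cmult) (auto simp: param_deriv_def)
    show "\<bar>w (\<xi> $ p) * H s (\<xi> $ p)\<bar> \<le> \<bar>w (\<xi> $ p)\<bar> * B"
      if "\<bar>s - \<theta>\<bar> < d" "\<xi> \<in> space surface_measure" for s and \<xi> :: "real^'n"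
      unfolding abs_mult using that by (intro mult_left_mono B ball coord_in_unit) auto
    show "integrable (surface_measure :: (real^'n) measure) (\<lambda>\<xi>. \<bar>w (\<xi> $ p)\<bar> * B)" using w by simp
    show "(\<lambda>\<xi>. w (\<xi> $ p) * H \<theta> (\<xi> $ p)) \<in> borel_measurable (surface_measure :: (real^'n) measure)"
      using int[OF tr(2) \<theta>] by (rule borel_measurable_integrable)
  qed
qed

lemma axial_value_param_DERIV:
  fixes p :: "'n::finite"
  assumes FH: "param_deriv F H" and \<theta>: "\<theta> \<in> {-pi<..<pi}"
  shows "((\<lambda>\<theta>. axial_value p d k (F \<theta>)) has_real_derivative axial_value p d k (H \<theta>)) (at \<theta>)"
proof -
  obtain L K where LK: "param_deriv L K"
    "\<And>\<theta>. \<theta> \<in> {-pi<..<pi} \<Longrightarrow> laplacian_product CARD('n) d k (F \<theta>) = L \<theta>"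
    "\<And>\<theta>. \<theta> \<in> {-pi<..<pi} \<Longrightarrow> laplacian_product CARD('n) d k (H \<theta>) = K \<theta>"
    using param_deriv_laplacian_product[OF FH] by blast
  define c where "c = (if d = 0 then log_coefficient CARD('n) k else 0)"
  have eq: "axial_value p d k (G \<theta>) = axial_mean p (\<lambda>t. kernel_weight d t * laplacian_product CARD('n) d k (G \<theta>) t) + c * axial_mean p (\<lambda>t. 1 * G \<theta> t)" for G \<theta>
    by (simp add: axial_value_def c_def)
  have "((\<lambda>\<theta>. axial_mean p (\<lambda>t. kernel_weight d t * L \<theta> t) + c * axial_mean p (\<lambda>t. 1 * F \<theta> t)) has_real_derivative
      axial_mean p (\<lambda>t. kernel_weight d t * K \<theta> t) + c * axial_mean p (\<lambda>t. 1 * H \<theta> t)) (at \<theta>)"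
    by (intro DERIV_add DERIV_cmult axial_mean_param_DERIV[OF LK(1) \<theta> integrable_kernel_weight]
        axial_mean_param_DERIV[OF FH \<theta>, of "\<lambda>_. 1"] integrable_surface_measure_const)
  then have "((\<lambda>\<theta>. axial_mean p (\<lambda>t. kernel_weight d t * L \<theta> t) + c * axial_mean p (\<lambda>t. 1 * F \<theta> t)) has_real_derivative
      axial_value p d k (H \<theta>)) (at \<theta>)"
    unfolding eq LK(3)[OF \<theta>] .
  then show ?thesis
    by (rule has_field_derivative_transform_within_open[of _ _ _ "{-pi<..<pi}"])
      (use \<theta> in \<open>auto simp: eq LK(2)\<close>)
qed

section \<open>The oscillator equation in the angle\<close>

lemma laplacian_product_lincomb:
  "smooth f \<Longrightarrow> smooth g \<Longrightarrow> laplacian_product N d k (\<lambda>t. f t + c * g t) =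
    (\<lambda>t. laplacian_product N d k f t + c * laplacian_product N d k g t)"
  by (induction k) (simp_all add: axial_laplacian_lincomb smooth_laplacian_product algebra_simps)

lemma axial_value_lincomb:
  fixes p :: "'n::finite"
  assumes "smooth f" "smooth g"
  shows "axial_value p d k (\<lambda>t. f t + c * g t) = axial_value p d k f + c * axial_value p d k g"
proof -
  have "axial_mean p (\<lambda>t. kernel_weight d t * laplacian_product CARD('n) d k (\<lambda>t. f t + c * g t) t) =
      axial_mean p (\<lambda>t. kernel_weight d t * laplacian_product CARD('n) d k f t)
      + c * axial_mean p (\<lambda>t. kernel_weight d t * laplacian_product CARD('n) d k g t)"
    unfolding laplacian_product_lincomb[OF assms]
    by (intro axial_mean_weighted_lincomb integrable_kernel_weight smooth_continuous smooth_laplacian_product assms)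
  moreover have "axial_mean p (\<lambda>t. f t + c * g t) = axial_mean p f + c * axial_mean p g"
    using axial_mean_weighted_lincomb[of "\<lambda>_. 1" p f g c] assms
    by (simp add: integrable_surface_measure_const smooth_continuous)
  ultimately show ?thesis by (simp add: axial_value_def algebra_simps)
qed

text \<open>\<open>?c\<close> and \<open>?s\<close> are the coordinates of
  \<open>(y, y' / \<omega>)\<close> in a frame that rotates with the flow, hence constant along
  every solution. Rotating back recovers \<open>y\<close>.\<close>

lemma harmonic_oscillator_unique:
  fixes y y1 :: "real \<Rightarrow> real"
  assumes y: "\<And>\<theta>. \<theta> \<in> {a<..<b} \<Longrightarrow> (y has_real_derivative y1 \<theta>) (at \<theta>)"
    and y1: "\<And>\<theta>. \<theta> \<in> {a<..<b} \<Longrightarrow> (y1 has_real_derivative - \<omega>\<^sup>2 * y \<theta>) (at \<theta>)"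
    and "\<omega> \<noteq> 0" "y 0 = 0" "0 \<in> {a<..<b}" "\<theta> \<in> {a<..<b}"
  shows "y \<theta> = y1 0 * sin (\<omega> * \<theta>) / \<omega>"
proof -
  let ?c = "\<lambda>\<theta>. y \<theta> * cos (\<omega> * \<theta>) - y1 \<theta> / \<omega> * sin (\<omega> * \<theta>)"
  let ?s = "\<lambda>\<theta>. y \<theta> * sin (\<omega> * \<theta>) + y1 \<theta> / \<omega> * cos (\<omega> * \<theta>)"
  have "(?c has_real_derivative 0) (at \<theta>)" "(?s has_real_derivative 0) (at \<theta>)" if "\<theta> \<in> {a<..<b}" for \<theta>
    using \<open>\<omega> \<noteq> 0\<close> by (auto intro!: derivative_eq_intros y[OF that] y1[OF that] simp: power2_eq_square field_simps)
  then have "?c \<theta> = ?c 0" "?s \<theta> = ?s 0"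
    using assms(5,6) DERIV_isconst3[of a b \<theta> 0 ?c] DERIV_isconst3[of a b \<theta> 0 ?s] by auto
  then have "?c \<theta> = 0" "?s \<theta> = y1 0 / \<omega>" using \<open>y 0 = 0\<close> by auto
  moreover have "?c \<theta> * cos (\<omega> * \<theta>) + ?s \<theta> * sin (\<omega> * \<theta>) = y \<theta> * ((sin (\<omega> * \<theta>))\<^sup>2 + (cos (\<omega> * \<theta>))\<^sup>2)"
  proof -
    have "(Y * c - A * s) * c + (Y * s + A * c) * s = Y * (s\<^sup>2 + c\<^sup>2)" for Y A c s :: real
      by (simp add: algebra_simps power2_eq_square)
    then show ?thesis .
  qed
  ultimately show ?thesis by simp
qed

lemma axial_value_cmult:
  fixes p :: "'n::finite"
  assumes "smooth f"
  shows "axial_value p d k (\<lambda>t. c * f t) = c * axial_value p d k f"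
proof -
  have "axial_value p d k (\<lambda>_. 0 + 1 * 0) = axial_value p d k (\<lambda>_. 0) + 1 * axial_value p d k (\<lambda>_. 0)"
    by (rule axial_value_lincomb) auto
  then have "axial_value p d k (\<lambda>_. 0) = 0" by simp
  moreover have "axial_value p d k (\<lambda>t. 0 + c * f t) = axial_value p d k (\<lambda>_. 0) + c * axial_value p d k f"
    by (rule axial_value_lincomb) (auto intro: assms)
  ultimately show ?thesis by simp
qed

lemma inverse_quartic_DERIV:
  assumes "\<theta> \<in> {-pi<..<pi}"
  shows "((\<lambda>t. inverse (quartic \<theta> t)) has_real_derivative 4 * (1 - cos \<theta>) * t * (1 - 2 * t\<^sup>2) * (inverse (quartic \<theta> t))\<^sup>2) (at t)"
    "((\<lambda>\<theta>. inverse (quartic \<theta> t)) has_real_derivative 2 * sin \<theta> * (t\<^sup>2 * (1 - t\<^sup>2)) * (inverse (quartic \<theta> t))\<^sup>2) (at \<theta>)"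
proof -
  have q: "quartic \<theta> t \<noteq> 0" using quartic_pos[OF assms, of t] by simp
  have alg: "- (inverse q * (- 4 * a * b * c) * inverse q) = 4 * a * b * c * (inverse q)\<^sup>2"
    "- (inverse q * (- 2 * a * b) * inverse q) = 2 * a * b * (inverse q)\<^sup>2" for q a b c :: real
    by (simp_all add: power2_eq_square)
  show "((\<lambda>t. inverse (quartic \<theta> t)) has_real_derivative 4 * (1 - cos \<theta>) * t * (1 - 2 * t\<^sup>2) * (inverse (quartic \<theta> t))\<^sup>2) (at t)"
    using DERIV_inverse'[OF quartic_DERIV(1)[of \<theta> t] q] unfolding alg .
  show "((\<lambda>\<theta>. inverse (quartic \<theta> t)) has_real_derivative 2 * sin \<theta> * (t\<^sup>2 * (1 - t\<^sup>2)) * (inverse (quartic \<theta> t))\<^sup>2) (at \<theta>)"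
    using DERIV_inverse'[OF quartic_DERIV(2)[of t \<theta>] q] unfolding alg .
qed

text \<open>The functions \<open>g = sin \<theta> / quartic \<theta>\<close> satisfy \<open>4 \<partial>\<^sub>\<theta>\<^sup>2 g = - (2 + scaling_operator)\<^sup>2 g\<close>; in the proof,
  \<open>m = (2 + scaling_operator) g\<close>.\<close>

lemma axial_value_quartic:
  fixes p :: "'n::finite"
  assumes d: "d = 0 \<or> d = 1" and k: "0 < k" "2 * real k = real CARD('n) - 4 + d"
    and n: "CARD('n) \<ge> 4" and \<theta>: "\<theta> \<in> {-pi<..<pi}"
  defines "\<omega> \<equiv> (real CARD('n) - 3) / 2"
  shows "sin \<theta> * axial_value p d k (\<lambda>t. inverse (quartic \<theta> t)) = axial_value p d k (\<lambda>_. 1) * sin (\<omega> * \<theta>) / \<omega>"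
proof -
  let ?i = "\<lambda>\<theta> t. inverse (quartic \<theta> t)"
  let ?v = "\<lambda>t::real. t\<^sup>2 * (1 - t\<^sup>2)"
  define g where "g \<theta> t = sin \<theta> * ?i \<theta> t" for \<theta> t
  define g1 where "g1 \<theta> t = cos \<theta> * ?i \<theta> t + 2 * (sin \<theta>)\<^sup>2 * ?v t * (?i \<theta> t)\<^sup>2" for \<theta> t
  define g2 where "g2 \<theta> t = sin \<theta> * (- ?i \<theta> t + 6 * cos \<theta> * ?v t * (?i \<theta> t)\<^sup>2 + 8 * (sin \<theta>)\<^sup>2 * (?v t)\<^sup>2 * (?i \<theta> t) ^ 3)" for \<theta> t
  \<comment> \<open>The function
    \<open>F = 1 / (\<tau>\<^sup>2 + exp (-i \<theta>) r\<^sup>2)\<close> satisfies \<open>(2 +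
    \<tau> \<partial>\<^sub>\<tau>) F = - 2 i \<partial>\<^sub>\<theta> F\<close>. Since
    \<open>r\<close> is constant for \<open>\<tau> \<partial>\<^sub>\<tau>\<close>, dividing the
    imaginary part by \<open>r\<^sup>2\<close> gives \<open>(2 + \<tau> \<partial>\<^sub>\<tau>) g =
    2 sin \<theta> (r\<^sup>4 - \<tau>\<^sup>4) / Q\<^sup>2\<close>, which on the sphere is
    \<open>m\<close>. A second application yields
    \<open>- 4 \<partial>\<^sub>\<theta>\<^sup>2 g\<close>.\<close>
  define m where "m \<theta> t = 2 * sin \<theta> * ((1 - 2 * t\<^sup>2) * (?i \<theta> t)\<^sup>2)" for \<theta> t
  have tr: "trig_rational g" "trig_rational g1" "trig_rational g2" "trig_rational m"
    unfolding g_def[abs_def] g1_def[abs_def] g2_def[abs_def] m_def[abs_def] by (intro trig_rational_intros)+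
  have D1: "((\<lambda>\<theta>. g \<theta> t) has_real_derivative g1 \<theta> t) (at \<theta>)" if "\<theta> \<in> {-pi<..<pi}" for \<theta> t
    using DERIV_mult[OF DERIV_sin inverse_quartic_DERIV(2)[OF that, of t]]
    by (simp add: g_def[abs_def] g1_def power2_eq_square algebra_simps)
  have D2: "((\<lambda>\<theta>. g1 \<theta> t) has_real_derivative g2 \<theta> t) (at \<theta>)" if "\<theta> \<in> {-pi<..<pi}" for \<theta> t
  proof -
    note I = inverse_quartic_DERIV(2)[OF that, of t]
    have "((\<lambda>\<theta>. cos \<theta> * ?i \<theta> t + (2 * (sin \<theta>)\<^sup>2 * ?v t) * (?i \<theta> t)\<^sup>2) has_real_derivative
       (- sin \<theta> * ?i \<theta> t + 2 * sin \<theta> * ?v t * (?i \<theta> t)\<^sup>2 * cos \<theta>) +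
       ((2 * (of_nat 2 * (cos \<theta> * sin \<theta> ^ (2 - Suc 0))) * ?v t) * (?i \<theta> t)\<^sup>2 +
        (of_nat 2 * (2 * sin \<theta> * ?v t * (?i \<theta> t)\<^sup>2 * ?i \<theta> t ^ (2 - Suc 0))) * (2 * (sin \<theta>)\<^sup>2 * ?v t))) (at \<theta>)"
      by (intro DERIV_add DERIV_mult DERIV_cmult DERIV_cmult_right DERIV_power DERIV_sin DERIV_cos I)
    moreover have "(- s * i + 2 * s * v * i\<^sup>2 * c) + ((2 * (of_nat 2 * (c * s ^ (2 - Suc 0))) * v) * i\<^sup>2 +
        (of_nat 2 * (2 * s * v * i\<^sup>2 * i ^ (2 - Suc 0))) * (2 * s\<^sup>2 * v)) =
        s * (- i + 6 * c * v * i\<^sup>2 + 8 * s\<^sup>2 * v\<^sup>2 * i ^ 3)" for s c i v :: real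
      by (simp add: power2_eq_square power3_eq_cube algebra_simps)
    ultimately show ?thesis unfolding g1_def g2_def by (simp only:)
  qed
  have pd: "param_deriv g g1" "param_deriv g1 g2" using tr D1 D2 by (auto simp: param_deriv_def)
  have sm: "smooth (g \<theta>)" "smooth (m \<theta>)" "smooth (?i \<theta>)" if "\<theta> \<in> {-pi<..<pi}" for \<theta>
    using tr that trig_rational.inv by (auto intro: smooth_trig_rational)
  have Sg: "scaling_operator (g \<theta>) = (\<lambda>t. m \<theta> t + (- 2) * g \<theta> t)" if "\<theta> \<in> {-pi<..<pi}" for \<theta>
  proof
    fix t
    define i where "i = ?i \<theta> t"
    have q: "quartic \<theta> t * i = 1" using quartic_pos[OF that, of t] by (simp add: i_def)
    then have i: "i = quartic \<theta> t * i\<^sup>2" by (simp add: power2_eq_square)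
    have "deriv (g \<theta>) t = sin \<theta> * (4 * (1 - cos \<theta>) * t * (1 - 2 * t\<^sup>2) * i\<^sup>2)"
      unfolding g_def[abs_def] i_def by (intro DERIV_imp_deriv DERIV_cmult inverse_quartic_DERIV that)
    note deriv = this
    have "scaling_operator (g \<theta>) t + 2 * g \<theta> t = 2 * sin \<theta> * (1 - 2 * t\<^sup>2) * (i + 2 * (1 - cos \<theta>) * ?v t * i\<^sup>2)"
      unfolding scaling_operator_def deriv by (simp add: g_def i_def[symmetric] algebra_simps power2_eq_square)
    also have "i + 2 * (1 - cos \<theta>) * ?v t * i\<^sup>2 = (quartic \<theta> t + 2 * (1 - cos \<theta>) * ?v t) * i\<^sup>2"
      using i by (simp add: distrib_right)
    also have "\<dots> = i\<^sup>2" unfolding quartic_alt by simp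
    finally show "scaling_operator (g \<theta>) t = m \<theta> t + (- 2) * g \<theta> t" by (simp add: m_def i_def)
  qed
  have Sm: "scaling_operator (m \<theta>) t + 2 * m \<theta> t = - 4 * g2 \<theta> t" if "\<theta> \<in> {-pi<..<pi}" for \<theta> t
  proof -
    define i where "i = ?i \<theta> t"
    define c where "c = cos \<theta>"
    define s where "s = sin \<theta>"
    have s2: "s\<^sup>2 = 1 - c\<^sup>2" by (simp add: s_def c_def sin_squared_eq)
    define Q where "Q = quartic \<theta> t"
    have "Q * i = 1" using quartic_pos[OF that, of t] by (simp add: i_def Q_def)
    \<comment> \<open>With all terms brought to the common factor \<open>i ^ 3\<close>, the claim
      becomes a polynomial identity in \<open>c\<close>, \<open>s\<close> and
      \<open>t\<^sup>2 (1 - t\<^sup>2)\<close>.\<close>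
    then have i1: "i = Q\<^sup>2 * i ^ 3" and i2: "i\<^sup>2 = Q * i ^ 3"
      by (simp_all add: power2_eq_square power3_eq_cube algebra_simps)
    have Q: "Q = 1 - 2 * (1 - c) * ?v t" by (simp add: Q_def c_def quartic_alt)
    have "((\<lambda>t. (1 - 2 * t\<^sup>2) * (?i \<theta> t)\<^sup>2) has_real_derivative
        (0 - 2 * (of_nat 2 * (1 * t ^ (2 - Suc 0)))) * i\<^sup>2 + (of_nat 2 * (4 * (1 - c) * t * (1 - 2 * t\<^sup>2) * i\<^sup>2 * i ^ (2 - Suc 0))) * (1 - 2 * t\<^sup>2)) (at t)"
      unfolding i_def c_def
      by (intro DERIV_mult DERIV_diff DERIV_const DERIV_cmult DERIV_power DERIV_ident inverse_quartic_DERIV(1) that)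
    then have "deriv (m \<theta>) t = 2 * s * ((0 - 2 * (of_nat 2 * (1 * t ^ (2 - Suc 0)))) * i\<^sup>2 +
        (of_nat 2 * (4 * (1 - c) * t * (1 - 2 * t\<^sup>2) * i\<^sup>2 * i ^ (2 - Suc 0))) * (1 - 2 * t\<^sup>2))"
      unfolding m_def[abs_def] s_def by (intro DERIV_imp_deriv DERIV_cmult)
    note deriv = this
    have "scaling_operator (m \<theta>) t + 2 * m \<theta> t =
        s * (4 * (1 - 2 * t\<^sup>2)\<^sup>2 * i\<^sup>2 - 8 * ?v t * i\<^sup>2 + 16 * (1 - c) * ?v t * (1 - 2 * t\<^sup>2)\<^sup>2 * i ^ 3)"
      unfolding scaling_operator_def deriv
      by (simp add: m_def i_def[symmetric] s_def[symmetric] algebra_simps power2_eq_square power3_eq_cube)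
    also have "(1 - 2 * t\<^sup>2)\<^sup>2 = 1 - 4 * ?v t" by (simp add: power2_eq_square algebra_simps)
    also have "s * (4 * (1 - 4 * ?v t) * i\<^sup>2 - 8 * ?v t * i\<^sup>2 + 16 * (1 - c) * ?v t * (1 - 4 * ?v t) * i ^ 3) =
        - 4 * (s * (- i + 6 * c * ?v t * i\<^sup>2 + 8 * s\<^sup>2 * (?v t)\<^sup>2 * i ^ 3))"
    proof -
      have alg: "s * (4 * (1 - 4 * v) * (q * j) - 8 * v * (q * j) + 16 * (1 - c) * v * (1 - 4 * v) * j) =
        - 4 * (s * (- (q\<^sup>2 * j) + 6 * c * v * (q * j) + 8 * (1 - c\<^sup>2) * v\<^sup>2 * j))"
        if "q = 1 - 2 * (1 - c) * v" for v q j :: real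
        unfolding that by (simp add: power2_eq_square algebra_simps)
      show ?thesis
        unfolding s2 using alg[OF Q, of "i ^ 3"] i1 i2 by (simp only:)
    qed
    finally show ?thesis by (simp add: g2_def i_def c_def s_def)
  qed
  define y where "y \<theta> = axial_value p d k (g \<theta>)" for \<theta>
  define y1 where "y1 \<theta> = axial_value p d k (g1 \<theta>)" for \<theta>
  have lin: "axial_value p d k (scaling_operator (g \<theta>)) = axial_value p d k (m \<theta>) + (- 2) * axial_value p d k (g \<theta>)"
    if "\<theta> \<in> {-pi<..<pi}" for \<theta>
    unfolding Sg[OF that] by (intro axial_value_lincomb sm that)
  have m1: "axial_value p d k (m \<theta>) = (real CARD('n) - 3) * y \<theta>" if "\<theta> \<in> {-pi<..<pi}" for \<theta>
    using lin[OF that] axial_value_scaling[OF d sm(1)[OF that] k, of p] by (simp add: y_def algebra_simps)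
  have m2: "- 4 * axial_value p d k (g2 \<theta>) = (real CARD('n) - 3) * axial_value p d k (m \<theta>)" if "\<theta> \<in> {-pi<..<pi}" for \<theta>
  proof -
    have "(\<lambda>t. - 4 * g2 \<theta> t) = (\<lambda>t. scaling_operator (m \<theta>) t + 2 * m \<theta> t)"
      using Sm[OF that] by auto
    moreover have "axial_value p d k (\<lambda>t. - 4 * g2 \<theta> t) = - 4 * axial_value p d k (g2 \<theta>)"
      by (intro axial_value_cmult smooth_trig_rational tr that)
    moreover have "axial_value p d k (\<lambda>t. scaling_operator (m \<theta>) t + 2 * m \<theta> t) =
        axial_value p d k (scaling_operator (m \<theta>)) + 2 * axial_value p d k (m \<theta>)"
      by (intro axial_value_lincomb smooth_scaling_operator sm that)
    ultimately show ?thesis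
      using axial_value_scaling[OF d sm(2)[OF that] k, of p] by (simp add: algebra_simps)
  qed
  have osc: "axial_value p d k (g2 \<theta>) = - \<omega>\<^sup>2 * y \<theta>" if "\<theta> \<in> {-pi<..<pi}" for \<theta>
  proof -
    have "- 4 * axial_value p d k (g2 \<theta>) = (real CARD('n) - 3) * ((real CARD('n) - 3) * y \<theta>)"
      using m1[OF that] m2[OF that] by (simp only:)
    then show ?thesis by (simp add: \<omega>_def power2_eq_square field_simps)
  qed
  have y0: "y 0 = 0"
    using axial_value_cmult[OF smooth_const[of 1], of p d k 0] by (simp add: y_def g_def[abs_def])
  \<comment> \<open>\<open>quartic 0\<close> is identically 1, so the initial velocity is the value
    belonging to \<open>(-\<Delta>)\<^sup>2\<close>.\<close>
  have y10: "y1 0 = axial_value p d k (\<lambda>_. 1)"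
    by (simp add: y1_def g1_def[abs_def] quartic_alt)
  have "y \<theta> = y1 0 * sin (\<omega> * \<theta>) / \<omega>"
  proof (rule harmonic_oscillator_unique[where a = "-pi" and b = pi])
    show "(y has_real_derivative y1 \<theta>) (at \<theta>)" if "\<theta> \<in> {-pi<..<pi}" for \<theta>
      unfolding y_def[abs_def] y1_def by (intro axial_value_param_DERIV pd that)
    show "(y1 has_real_derivative - \<omega>\<^sup>2 * y \<theta>) (at \<theta>)" if "\<theta> \<in> {-pi<..<pi}" for \<theta>
      unfolding y1_def[abs_def] osc[OF that, symmetric] by (intro axial_value_param_DERIV pd that)
    show "\<omega> \<noteq> 0" using n by (simp add: \<omega>_def)
  qed (use \<theta> y0 in auto)
  moreover have "y \<theta> = sin \<theta> * axial_value p d k (\<lambda>t. inverse (quartic \<theta> t))"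
    unfolding y_def g_def[abs_def] by (intro axial_value_cmult sm \<theta>)
  ultimately show ?thesis by (simp add: y10)
qed

section \<open>Signs for the square of the Laplacian\<close>

lemma laplacian_product_const:
  "laplacian_product N d k (\<lambda>_. c) = (\<lambda>_. c * (\<Prod>i<k. radial_eigenvalue N d i))"
  by (induction k) (simp_all add: axial_laplacian_def[abs_def] mult_ac)

text \<open>The divergence identity for \<open>g t = t\<close> gives \<open>n\<close> times this
  mean as the total mass. The result later bounds the mean of \<open>\<bar>t\<bar>\<close> from
  below.\<close>

lemma axial_mean_coord_sq:
  fixes p :: "'n::finite"
  assumes "CARD('n) \<ge> 2"
  shows "0 < axial_mean p (\<lambda>t. t\<^sup>2)"
proof -
  have "real CARD('n) * axial_mean p (\<lambda>t. t\<^sup>2) = axial_mean p (\<lambda>_. 1)"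
  proof -
    have "axial_mean p (\<lambda>t. (1 - t\<^sup>2) * 1 - (real CARD('n) - 1) * t * t) = 0"
      by (rule axial_mean_divergence) (auto intro: continuous_intros)
    moreover have "axial_mean p (\<lambda>t. (1 - t\<^sup>2) * 1 - (real CARD('n) - 1) * t * t) = axial_mean p (\<lambda>t. 1 - real CARD('n) * t\<^sup>2)"
      by (simp add: algebra_simps power2_eq_square)
    moreover have "axial_mean p (\<lambda>t. 1 - real CARD('n) * t\<^sup>2) = axial_mean p (\<lambda>_. 1) - real CARD('n) * axial_mean p (\<lambda>t. t\<^sup>2)"
      by (subst axial_mean_diff) (auto intro!: continuous_intros simp: axial_mean_cmult)
    ultimately show ?thesis by simp
  qed
  moreover have "0 < axial_mean p (\<lambda>_. 1)"
    using measure_surface_measure_pos[where 'a = "real^'n"] assms by (simp add: axial_mean_def)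
  ultimately show ?thesis by (metis of_nat_0_le_iff zero_less_mult_pos less_eq_real_def mult_zero_left)
qed

text \<open>The factor \<open>i = 0\<close> is \<open>N - 1 > 0\<close>. For
  \<open>0 < i < k\<close> the factor is \<open>(1 - 2 i) (N - 1 - 2 i)\<close>, negative because
  \<open>2 i < N - 3\<close>. So exactly \<open>k - 1\<close> factors are negative.\<close>

lemma prod_radial_eigenvalue_sign:
  assumes "0 < k" "2 * real k = N - 3"
  shows "(-1) ^ k * (\<Prod>i<k. radial_eigenvalue N 1 i) < 0"
proof -
  have "(-1) ^ j * (\<Prod>i<j. radial_eigenvalue N 1 i) < 0" if "0 < j" "j \<le> k" for j
    using that
  proof (induction j)
    case (Suc j)
    have "real j + 1 \<le> real k" using Suc.prems by linarith
    then have pos: "0 < 1 - 2 * real j + N - 2" using assms by linarith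
    show ?case
    proof (cases "j = 0")
      case True
      then show ?thesis using pos by (simp add: radial_eigenvalue_def)
    next
      case False
      then have "1 - 2 * real j < 0" by (simp add: Suc_le_eq)
      then have "radial_eigenvalue N 1 j < 0"
        unfolding radial_eigenvalue_def using pos by (intro mult_neg_pos)
      moreover have "(-1) ^ j * (\<Prod>i<j. radial_eigenvalue N 1 i) < 0" using Suc False by simp
      ultimately have "0 < ((-1) ^ j * (\<Prod>i<j. radial_eigenvalue N 1 i)) * radial_eigenvalue N 1 j"
        by (rule mult_neg_neg[rotated])
      then show ?thesis by (simp add: mult_ac)
    qed
  qed simp
  then show ?thesis using assms by simp
qed

text \<open>The same count: \<open>N - 2\<close> is positive and the \<open>k - 1\<close> later
  eigenvalues \<open>- 2 i (N - 2 - 2 i)\<close> are negative.\<close>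

lemma log_coefficient_sign:
  assumes "0 < k" "2 * real k = N - 4"
  shows "(-1) ^ k * log_coefficient N k < 0"
proof -
  have "(-1) ^ j * log_coefficient N j < 0" if "0 < j" "j \<le> k" for j
    using that
  proof (induction j)
    case (Suc j)
    have "real j + 1 \<le> real k" using Suc.prems by linarith
    then have pos: "0 < 0 - 2 * real j + N - 2" using assms by linarith
    show ?case
    proof (cases "j = 0")
      case True
      then show ?thesis using pos by simp
    next
      case False
      then have "0 - 2 * real j < 0" by simp
      then have "radial_eigenvalue N 0 j < 0"
        unfolding radial_eigenvalue_def using pos by (intro mult_neg_pos)
      moreover have "(-1) ^ j * log_coefficient N j < 0" using Suc False by simp
      ultimately have "0 < radial_eigenvalue N 0 j * ((-1) ^ j * log_coefficient N j)"
        by (rule mult_neg_neg)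
      then show ?thesis using False by (simp add: mult_ac)
    qed
  qed simp
  then show ?thesis using assms by simp
qed

text \<open>For \<open>d = 0\<close> the integral against the logarithm drops out, because the
  product of the radial eigenvalues contains 0, and the logarithmic coefficient decides. For
  \<open>d = 1\<close> the product itself decides, since the mean of \<open>\<bar>t\<bar>\<close> is
  positive.\<close>

lemma axial_value_1_sign:
  fixes p :: "'n::finite"
  assumes d: "d = 0 \<or> d = 1" and k: "0 < k" "2 * real k = real CARD('n) - 4 + d" and n: "CARD('n) \<ge> 2"
  shows "(-1) ^ k * axial_value p d k (\<lambda>_. 1) < 0"
proof (cases "d = 0")
  case True
  have "axial_value p d k (\<lambda>_. 1) = log_coefficient CARD('n) k * axial_mean p (\<lambda>_. 1)"
    using True k(1)
    by (simp add: axial_value_def laplacian_product_const prod_radial_eigenvalue_0) (simp add: axial_mean_def)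
  moreover have "0 < axial_mean p (\<lambda>_. 1)"
    using measure_surface_measure_pos[where 'a = "real^'n"] n by (simp add: axial_mean_def)
  moreover have "(-1) ^ k * log_coefficient CARD('n) k < 0" using k True by (intro log_coefficient_sign) auto
  ultimately show ?thesis by (metis mult.assoc mult_neg_pos)
next
  case False
  then have "axial_value p d k (\<lambda>_. 1) = (\<Prod>i<k. radial_eigenvalue CARD('n) 1 i) * axial_mean p abs"
    using d axial_mean_cmult[of p "\<Prod>i<k. radial_eigenvalue CARD('n) 1 i" abs]
    by (auto simp: axial_value_def laplacian_product_const kernel_weight_def mult.commute)
  moreover have "axial_mean p (\<lambda>t. t\<^sup>2) \<le> axial_mean p abs"
    unfolding axial_mean_def
  proof (rule integral_mono)
    show "integrable (surface_measure :: (real^'n) measure) (\<lambda>\<xi>. (\<xi> $ p)\<^sup>2)"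
      by (rule integrable_axial) (intro continuous_intros)
    show "integrable (surface_measure :: (real^'n) measure) (\<lambda>\<xi>. \<bar>\<xi> $ p\<bar>)"
      by (rule integrable_axial) (intro continuous_intros)
    fix \<xi> :: "real^'n" assume "\<xi> \<in> space surface_measure"
    then have "\<bar>\<xi> $ p\<bar> \<le> 1" using coord_in_unit[of \<xi> p] by (auto simp: abs_le_iff)
    then have "\<bar>\<xi> $ p\<bar> * \<bar>\<xi> $ p\<bar> \<le> \<bar>\<xi> $ p\<bar> * 1" by (intro mult_left_mono) auto
    then show "(\<xi> $ p)\<^sup>2 \<le> \<bar>\<xi> $ p\<bar>" by (simp add: power2_eq_square)
  qed
  moreover have "(-1) ^ k * (\<Prod>i<k. radial_eigenvalue CARD('n) 1 i) < 0"
    using k False d by (intro prod_radial_eigenvalue_sign) auto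
  ultimately show ?thesis
    using axial_mean_coord_sq[OF n, of p] by (metis less_le_trans mult.assoc mult_neg_pos)
qed

section \<open>Iterated Laplacians of the kernel\<close>

definition spherical_integral :: "'n::finite \<Rightarrow> real \<Rightarrow> (real \<Rightarrow> real) \<Rightarrow> real^'n \<Rightarrow> real" where
  "spherical_integral p d h z = (LINT \<xi>|surface_measure. kernel_weight d (\<xi> $ p) * h (z \<bullet> \<xi> / norm z))"

text \<open>Angular factor of \<open>\<Delta>\<^sup>k\<close> applied to the kernel integral, for
  \<open>k > 0\<close>; it depends on the direction of \<open>z\<close> only. The summand for
  \<open>d = 0\<close> is what \<open>\<Delta>\<^sup>k\<close> makes of
  \<open>axial_mean p h * ln (norm z)\<close>.\<close>

definition spherical_potential :: "'n::finite \<Rightarrow> real \<Rightarrow> nat \<Rightarrow> (real \<Rightarrow> real) \<Rightarrow> real^'n \<Rightarrow> real" where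
  "spherical_potential p d k h z = spherical_integral p d (laplacian_product CARD('n) d k h) z
     + (if d = 0 then log_coefficient CARD('n) k * axial_mean p h else 0)"

lemma spherical_integral_lincomb:
  assumes "smooth f" "smooth g"
  shows "spherical_integral p d (\<lambda>t. f t + c * g t) z = spherical_integral p d f z + c * spherical_integral p d g z"
proof -
  have c: "continuous_on A (\<lambda>\<xi>. z \<bullet> \<xi> / norm z)" for A
    unfolding divide_inverse by (intro continuous_on_mult continuous_on_inner continuous_on_const continuous_on_id)
  have int: "integrable surface_measure (\<lambda>\<xi>. kernel_weight d (\<xi> $ p) * h (z \<bullet> \<xi> / norm z))" if "smooth h" for h
    by (intro integrable_surface_measure_mult integrable_kernel_weight
        continuous_on_compose2[OF smooth_continuous[OF that, of UNIV]] c) auto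
  show ?thesis
    unfolding spherical_integral_def using int[OF assms(1)] int[OF assms(2)]
    by (simp add: distrib_left mult.left_commute[of _ c])
qed

lemma neg_laplacian_spherical_integral:
  fixes p :: "'n::finite"
  assumes h: "smooth h" and "z \<noteq> 0"
    and A: "\<And>r. r > 0 \<Longrightarrow> (A has_real_derivative A1 r) (at r)" "\<And>r. r > 0 \<Longrightarrow> (A1 has_real_derivative A2 r) (at r)"
    and D: "\<And>r. r > 0 \<Longrightarrow> (D has_real_derivative D1 r) (at r)" "\<And>r. r > 0 \<Longrightarrow> (D1 has_real_derivative D2 r) (at r)"
  shows "neg_laplacian (\<lambda>z. A (norm z) * spherical_integral p d h z + D (norm z)) z =
    - ((A2 (norm z) + (real CARD('n) - 1) / norm z * A1 (norm z)) * spherical_integral p d h z +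
       A (norm z) / (norm z)\<^sup>2 * spherical_integral p d (axial_laplacian CARD('n) h) z +
       D2 (norm z) + (real CARD('n) - 1) / norm z * D1 (norm z))"
  unfolding spherical_integral_def axial_laplacian_def
  by (rule neg_laplacian_surface_integral[OF integrable_kernel_weight smooth_DERIV[OF h] smooth_DERIV[OF smooth_deriv[OF h]]
        smooth_continuous[OF smooth_deriv[OF smooth_deriv[OF h]]] A D \<open>z \<noteq> 0\<close>])

text \<open>For \<open>d = 0\<close> the function becomes homogeneous only after one Laplacian has
  removed the logarithm, hence the hypothesis on \<open>k\<close>; that first Laplacian is computed
  in the next lemma.\<close>

lemma neg_laplacian_spherical_potential:
  fixes p :: "'n::finite"
  assumes h: "smooth h" and z: "z \<noteq> 0" and k: "d = 0 \<longrightarrow> 0 < k"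
  shows "neg_laplacian (\<lambda>z. s * (norm z powr (d - 2 * real k) * spherical_potential p d k h z)) z =
    - s * (norm z powr (d - 2 * real (Suc k)) * spherical_potential p d (Suc k) h z)"
proof -
  let ?N = "real CARD('n)"
  define a where "a = d - 2 * real k"
  define C where "C = (if d = 0 then log_coefficient ?N k * axial_mean p h else 0)"
  let ?h = "laplacian_product ?N d k h"
  let ?e = "radial_eigenvalue ?N d k"
  have sm: "smooth ?h" by (rule smooth_laplacian_product[OF h])
  have e: "?e = a * (a - 1) + (?N - 1) * a" by (simp add: radial_eigenvalue_def a_def algebra_simps)
  have "(\<lambda>z. s * (norm z powr a * spherical_potential p d k h z)) =
      (\<lambda>z. (s * norm z powr a) * spherical_integral p d ?h z + s * C * norm z powr a)"
    by (simp add: spherical_potential_def C_def algebra_simps)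
  then have "neg_laplacian (\<lambda>z. s * (norm z powr a * spherical_potential p d k h z)) z =
    - ((s * a * (a - 1) * norm z powr (a - 1 - 1) + (?N - 1) / norm z * (s * a * norm z powr (a - 1))) * spherical_integral p d ?h z +
       (s * norm z powr a) / (norm z)\<^sup>2 * spherical_integral p d (axial_laplacian ?N ?h) z +
       s * C * a * (a - 1) * norm z powr (a - 1 - 1) + (?N - 1) / norm z * (s * C * a * norm z powr (a - 1)))"
    by (simp only:)
      (rule neg_laplacian_spherical_integral[OF sm z, where A = "\<lambda>r. s * r powr a" and ?A1.0 = "\<lambda>r. s * a * r powr (a - 1)"
          and D = "\<lambda>r. s * C * r powr a" and ?D1.0 = "\<lambda>r. s * C * a * r powr (a - 1)"];
        auto intro!: derivative_eq_intros has_real_derivative_powr simp: algebra_simps)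
  also have "\<dots> = - s * (norm z powr (a - 2) * (spherical_integral p d (axial_laplacian ?N ?h) z + ?e * spherical_integral p d ?h z + ?e * C))"
  proof -
    have pw: "norm z powr (a - 1) = norm z * norm z powr (a - 2)" "norm z powr a = (norm z)\<^sup>2 * norm z powr (a - 2)"
      "norm z powr (a - 1 - 1) = norm z powr (a - 2)"
      using z powr_mult_base[of "norm z" "a - 2"] powr_mult_base[of "norm z" "a - 1"]
      by (simp_all add: power2_eq_square mult_ac)
    show ?thesis unfolding pw e using z by (simp add: field_simps power2_eq_square)
  qed
  also have "spherical_integral p d (axial_laplacian ?N ?h) z + ?e * spherical_integral p d ?h z =
      spherical_integral p d (laplacian_product ?N d (Suc k) h) z"
    using spherical_integral_lincomb[OF smooth_axial_laplacian[OF sm] sm, of p d ?N ?e z] by simp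
  also have "spherical_integral p d (laplacian_product ?N d (Suc k) h) z + ?e * C = spherical_potential p d (Suc k) h z"
    using k by (cases "d = 0") (auto simp: spherical_potential_def C_def)
  finally show ?thesis by (simp add: a_def algebra_simps)
qed

lemma neg_laplacian_log_spherical_integral:
  fixes p :: "'n::finite"
  assumes h: "smooth h" and z: "z \<noteq> 0"
  shows "neg_laplacian (\<lambda>z. spherical_integral p 0 h z + axial_mean p h * ln (norm z)) z =
    - 1 * (norm z powr (0 - 2 * real (Suc 0)) * spherical_potential p 0 (Suc 0) h z)"
proof -
  let ?N = "real CARD('n)"
  have "neg_laplacian (\<lambda>z. 1 * spherical_integral p 0 h z + axial_mean p h * ln (norm z)) z =
    - ((0 + (?N - 1) / norm z * 0) * spherical_integral p 0 h z + 1 / (norm z)\<^sup>2 * spherical_integral p 0 (axial_laplacian ?N h) z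
      + axial_mean p h * (- 1 / (norm z)\<^sup>2) + (?N - 1) / norm z * (axial_mean p h * (1 / norm z)))"
  proof (rule neg_laplacian_spherical_integral[OF h z, where A = "\<lambda>_. 1" and ?A1.0 = "\<lambda>_. 0" and ?A2.0 = "\<lambda>_. 0"
        and D = "\<lambda>r. axial_mean p h * ln r" and ?D1.0 = "\<lambda>r. axial_mean p h * (1 / r)" and ?D2.0 = "\<lambda>r. axial_mean p h * (- 1 / r\<^sup>2)"])
    show "((\<lambda>r. axial_mean p h * ln r) has_real_derivative axial_mean p h * (1 / r)) (at r)" if "r > 0" for r
      by (rule DERIV_cmult[OF DERIV_ln_divide[OF that]])
    have "((\<lambda>r. 1 / r) has_real_derivative - 1 / r\<^sup>2) (at r)" if "r > 0" for r :: real
      using that by (auto intro!: derivative_eq_intros simp: power2_eq_square)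
    then show "((\<lambda>r. axial_mean p h * (1 / r)) has_real_derivative axial_mean p h * (- 1 / r\<^sup>2)) (at r)" if "r > 0" for r
      using that by (intro DERIV_cmult)
  qed auto
  also have "\<dots> = - 1 * ((spherical_integral p 0 (axial_laplacian ?N h) z + (?N - 2) * axial_mean p h) / (norm z)\<^sup>2)"
  proof -
    have "- ((0 + (N - 1) / r * 0) * S + 1 / r\<^sup>2 * L + c * (- 1 / r\<^sup>2) + (N - 1) / r * (c * (1 / r))) =
      - 1 * ((L + (N - 2) * c) / r\<^sup>2)" if "r \<noteq> 0" for r S L c N :: real
      using that by (simp add: field_simps power2_eq_square)
    from this[of "norm z"] show ?thesis using z by simp
  qed
  also have "spherical_integral p 0 (axial_laplacian ?N h) z + (?N - 2) * axial_mean p h = spherical_potential p 0 (Suc 0) h z"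
    by (simp add: spherical_potential_def radial_eigenvalue_def)
  also have "spherical_potential p 0 (Suc 0) h z / (norm z)\<^sup>2 = norm z powr (0 - 2 * real (Suc 0)) * spherical_potential p 0 (Suc 0) h z"
  proof -
    have "norm z powr (0 - 2 * real (Suc 0)) = inverse (norm z powr 2)" by (simp add: powr_minus)
    also have "\<dots> = inverse ((norm z)\<^sup>2)" using z by simp
    finally show ?thesis by (simp add: divide_inverse mult.commute)
  qed
  finally show ?thesis by (simp only: mult_1)
qed

lemma funpow_neg_laplacian_kernel:
  fixes p :: "'n::finite"
  assumes h: "smooth h" and z: "z \<noteq> 0" and d: "d = 0 \<or> d = 1" and k: "0 < k"
    and u: "\<And>z. z \<noteq> 0 \<Longrightarrow> u z = (if d = 0 then spherical_integral p 0 h z + axial_mean p h * ln (norm z)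
      else norm z * spherical_integral p 1 h z)"
  shows "(neg_laplacian ^^ k) u z = (-1) ^ k * (norm z powr (d - 2 * real k) * spherical_potential p d k h z)"
proof -
  have f1: "(neg_laplacian ^^ Suc 0) u = neg_laplacian u" by simp
  have "(neg_laplacian ^^ Suc j) u z = (-1) ^ Suc j * (norm z powr (d - 2 * real (Suc j)) * spherical_potential p d (Suc j) h z)"
    if "z \<noteq> 0" for j z
    using that
  proof (induction j arbitrary: z)
    case 0
    show ?case
    proof (cases "d = 0")
      case True
      have "neg_laplacian u z = neg_laplacian (\<lambda>z. spherical_integral p 0 h z + axial_mean p h * ln (norm z)) z"
      proof (rule neg_laplacian_cong[OF _ 0])
        fix z :: "real^'n" assume z: "z \<noteq> 0"
        show "u z = spherical_integral p 0 h z + axial_mean p h * ln (norm z)"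
          unfolding u[OF z] using True by simp
      qed
      then show ?thesis
        unfolding neg_laplacian_log_spherical_integral[OF h 0] True by (simp only: f1 power_Suc0_right)
    next
      case False
      then have "d = 1" using d by simp
      have "neg_laplacian u z = neg_laplacian (\<lambda>z. 1 * (norm z powr (d - 2 * real 0) * spherical_potential p d 0 h z)) z"
      proof (rule neg_laplacian_cong[OF _ 0])
        fix z :: "real^'n" assume z: "z \<noteq> 0"
        then show "u z = 1 * (norm z powr (d - 2 * real 0) * spherical_potential p d 0 h z)"
          unfolding u[OF z] using \<open>d = 1\<close> by (simp add: spherical_potential_def)
      qed
      also have "\<dots> = - 1 * (norm z powr (d - 2 * real (Suc 0)) * spherical_potential p d (Suc 0) h z)"
        by (rule neg_laplacian_spherical_potential[OF h 0]) (use False in simp)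
      finally show ?thesis by (simp only: f1 power_Suc0_right)
    qed
  next
    case (Suc j)
    have "(neg_laplacian ^^ Suc (Suc j)) u z =
        neg_laplacian (\<lambda>z. (-1) ^ Suc j * (norm z powr (d - 2 * real (Suc j)) * spherical_potential p d (Suc j) h z)) z"
      unfolding funpow.simps(2)[of "Suc j"] o_def
      by (rule neg_laplacian_cong[OF _ Suc.prems]) (rule Suc.IH)
    also have "\<dots> = - ((-1) ^ Suc j) * (norm z powr (d - 2 * real (Suc (Suc j))) * spherical_potential p d (Suc (Suc j)) h z)"
      by (rule neg_laplacian_spherical_potential[OF h Suc.prems]) simp
    also have "- ((-1) ^ Suc j) = (-1 :: real) ^ Suc (Suc j)" by simp
    finally show ?case .
  qed
  from this[OF z, of "k - 1"] show ?thesis by (simp only: Suc_pred'[OF k, symmetric])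
qed

lemma spherical_integral_kernel:
  fixes p :: "'n::finite"
  assumes f: "continuous_on UNIV f" and y: "y \<noteq> 0"
  shows "(LINT \<xi>|surface_measure. \<bar>y \<bullet> \<xi>\<bar> * f (\<xi> $ p)) = norm y * spherical_integral p 1 f y"
    and "(LINT \<xi>|surface_measure. ln \<bar>y \<bullet> \<xi>\<bar> * f (\<xi> $ p)) = spherical_integral p 0 f y + axial_mean p f * ln (norm y)"
proof -
  let ?M = "surface_measure :: (real^'n) measure"
  define \<zeta> where "\<zeta> = y /\<^sub>R norm y"
  have \<zeta>: "norm \<zeta> = norm (axis p (1::real))" using y by (simp add: \<zeta>_def norm_axis_1)
  have \<zeta>y: "\<zeta> \<bullet> \<xi> = y \<bullet> \<xi> / norm y" "y \<bullet> \<xi> = norm y * (\<zeta> \<bullet> \<xi>)" for \<xi>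
    using y by (simp_all add: \<zeta>_def divide_inverse_commute)
  have swap: "(LINT \<xi>|?M. w (\<zeta> \<bullet> \<xi>) * f (\<xi> $ p)) = (LINT \<xi>|?M. w (\<xi> $ p) * f (y \<bullet> \<xi> / norm y))"
    if "w \<in> borel_measurable borel" for w
  proof -
    have "(\<lambda>(x, y). w x * f y) \<in> borel_measurable borel"
      unfolding borel_prod[symmetric] using that borel_measurable_continuous_onI[OF f] by measurable
    from integral_surface_measure_swap[OF \<zeta> this] show ?thesis by (simp add: inner_axis' \<zeta>y(1)[symmetric])
  qed
  have "(LINT \<xi>|?M. \<bar>y \<bullet> \<xi>\<bar> * f (\<xi> $ p)) = norm y * (LINT \<xi>|?M. \<bar>\<zeta> \<bullet> \<xi>\<bar> * f (\<xi> $ p))"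
    by (simp add: \<zeta>y(2) abs_mult mult.assoc)
  then show "(LINT \<xi>|?M. \<bar>y \<bullet> \<xi>\<bar> * f (\<xi> $ p)) = norm y * spherical_integral p 1 f y"
    unfolding spherical_integral_def kernel_weight_def using swap[of abs] by simp
  have fy: "continuous_on (sphere 0 1) (\<lambda>\<xi>. f (y \<bullet> \<xi> / norm y))"
    by (intro continuous_on_compose2[OF f]) (auto simp: divide_inverse intro!: continuous_intros)
  have i1: "integrable ?M (\<lambda>\<xi>. ln \<bar>\<xi> $ p\<bar> * f (y \<bullet> \<xi> / norm y))"
    by (intro integrable_surface_measure_mult integrable_ln_coord fy)
  have i2: "integrable ?M (\<lambda>\<xi>. f (y \<bullet> \<xi> / norm y))"
    using integrable_surface_measure_mult[OF fy integrable_surface_measure_const[of 1]] by simp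
  have "(LINT \<xi>|?M. ln \<bar>y \<bullet> \<xi>\<bar> * f (\<xi> $ p)) = (LINT \<xi>|?M. ln \<bar>norm y * (\<zeta> \<bullet> \<xi>)\<bar> * f (\<xi> $ p))"
    by (simp add: \<zeta>y(2))
  also have "\<dots> = (LINT \<xi>|?M. ln \<bar>norm y * (\<xi> $ p)\<bar> * f (y \<bullet> \<xi> / norm y))"
    using swap[of "\<lambda>x. ln \<bar>norm y * x\<bar>"] by simp
  also have "\<dots> = (LINT \<xi>|?M. ln \<bar>\<xi> $ p\<bar> * f (y \<bullet> \<xi> / norm y) + ln (norm y) * f (y \<bullet> \<xi> / norm y))"
  \<comment> \<open>The splitting of the logarithm of a product needs
    \<open>\<xi> $ p \<noteq> 0\<close>, so the integrands are compared off the equator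
    only.\<close>
  proof (rule integral_cong_AE)
    show "AE \<xi> in ?M. ln \<bar>norm y * \<xi> $ p\<bar> * f (y \<bullet> \<xi> / norm y) =
        ln \<bar>\<xi> $ p\<bar> * f (y \<bullet> \<xi> / norm y) + ln (norm y) * f (y \<bullet> \<xi> / norm y)"
      using AE_coord_neq_0[of p] by eventually_elim (use y in \<open>simp add: abs_mult ln_mult algebra_simps\<close>)
    have "(\<lambda>\<xi>. \<xi> $ p) \<in> borel_measurable ?M"
      by (rule borel_measurable_integrable[OF integrable_axial[OF continuous_on_id, of p]])
    then show "(\<lambda>\<xi>. ln \<bar>norm y * \<xi> $ p\<bar> * f (y \<bullet> \<xi> / norm y)) \<in> borel_measurable ?M"
      using borel_measurable_integrable[OF i2] by measurable
  qed (intro borel_measurable_integrable Bochner_Integration.integrable_add integrable_mult_right i1 i2)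
  also have "\<dots> = (LINT \<xi>|?M. ln \<bar>\<xi> $ p\<bar> * f (y \<bullet> \<xi> / norm y)) + ln (norm y) * (LINT \<xi>|?M. f (y \<bullet> \<xi> / norm y))"
    using i1 i2 by simp
  also have "(LINT \<xi>|?M. f (y \<bullet> \<xi> / norm y)) = axial_mean p f"
    by (rule integral_surface_measure_normalized_inner[OF y f])
  finally show "(LINT \<xi>|?M. ln \<bar>y \<bullet> \<xi>\<bar> * f (\<xi> $ p)) = spherical_integral p 0 f y + axial_mean p f * ln (norm y)"
    by (simp add: spherical_integral_def kernel_weight_def)
qed

section \<open>Value on the axis and mean over all directions\<close>

lemma spherical_potential_scale: "0 < r \<Longrightarrow> spherical_potential p d k h (r *\<^sub>R z) = spherical_potential p d k h z"
  by (simp add: spherical_potential_def spherical_integral_def)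

lemma spherical_potential_axis: "spherical_potential p d k h (axis p 1) = axial_value p d k h"
  by (simp add: spherical_potential_def spherical_integral_def axial_value_def axial_mean_def inner_axis')

text \<open>Fubini: for fixed \<open>\<xi>\<close> the integral over \<open>z\<close> of a function
  of \<open>z \<bullet> \<xi>\<close> does not depend on \<open>\<xi>\<close>, so the double
  integral factorizes. Averaging over directions thus sees \<open>h\<close> only through its mean,
  as if \<open>h\<close> were constant.\<close>

lemma spherical_potential_mean:
  fixes p :: "'n::finite"
  assumes h: "smooth h" and n: "CARD('n) \<ge> 2"
  shows "(LINT z|surface_measure. spherical_potential p d k h z) = axial_mean p h * axial_value p d k (\<lambda>_. 1)"
    and "integrable surface_measure (spherical_potential p d k h)"
proof -
  let ?M = "surface_measure :: (real^'n) measure"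
  let ?F = "laplacian_product CARD('n) d k h"
  let ?w = "\<lambda>\<xi>::real^'n. kernel_weight d (\<xi> $ p)"
  define C where "C = (if d = 0 then log_coefficient CARD('n) k * axial_mean p h else 0)"
  interpret finite_measure ?M by (rule finite_measure_surface_measure)
  interpret P: pair_sigma_finite ?M ?M ..
  have F: "smooth ?F" by (rule smooth_laplacian_product[OF h])
  have Fc: "continuous_on UNIV ?F" by (rule smooth_continuous[OF F])
  obtain B where B: "0 \<le> B" "\<And>t. t \<in> {-1..1} \<Longrightarrow> \<bar>?F t\<bar> \<le> B"
    using continuous_on_bounded_interval[OF smooth_continuous[OF F]] by blast
  have w: "integrable ?M ?w" by (rule integrable_kernel_weight)
  have wm [measurable]: "?w \<in> borel_measurable ?M" using w by (rule borel_measurable_integrable)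
  have id [measurable]: "(\<lambda>x. x) \<in> borel_measurable ?M"
    unfolding measurable_cong_sets[OF sets_surface_measure refl] by (intro measurable_restrict_space1) simp
  have Fm [measurable]: "?F \<in> borel_measurable borel" by (rule borel_measurable_continuous_onI[OF Fc])
  have meas: "(\<lambda>x. ?w (snd x) * ?F (fst x \<bullet> snd x)) \<in> borel_measurable (?M \<Otimes>\<^sub>M ?M)"
  proof -
    have "(\<lambda>x. fst x) \<in> borel_measurable (?M \<Otimes>\<^sub>M ?M)" "(\<lambda>x. snd x) \<in> borel_measurable (?M \<Otimes>\<^sub>M ?M)"
      using measurable_compose[OF measurable_fst id] measurable_compose[OF measurable_snd id] by simp_all
    then have "(\<lambda>x. fst x \<bullet> snd x) \<in> borel_measurable (?M \<Otimes>\<^sub>M ?M)" by (rule borel_measurable_inner)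
    then have "(\<lambda>x. ?F (fst x \<bullet> snd x)) \<in> borel_measurable (?M \<Otimes>\<^sub>M ?M)" by (rule measurable_compose) (rule Fm)
    moreover have "(\<lambda>x. ?w (snd x)) \<in> borel_measurable (?M \<Otimes>\<^sub>M ?M)" by (rule measurable_compose[OF measurable_snd wm])
    ultimately show ?thesis by (rule borel_measurable_times[rotated])
  qed
  have le: "\<bar>?F (z \<bullet> \<xi>)\<bar> \<le> B" if "norm z = 1" "norm \<xi> = 1" for z \<xi> :: "real^'n"
    using abs_inner_normalized_le[OF that(2), of z] that(1) by (intro B) (auto simp: abs_le_iff)
  have int1: "integrable ?M (\<lambda>\<xi>. ?w \<xi> * ?F (z \<bullet> \<xi>))" for z
    by (intro integrable_surface_measure_mult w continuous_on_compose2[OF Fc]) (auto intro!: continuous_intros)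
  have int: "integrable (?M \<Otimes>\<^sub>M ?M) (\<lambda>(z, \<xi>). ?w \<xi> * ?F (z \<bullet> \<xi>))"
  proof (rule P.Fubini_integrable)
    show "(\<lambda>(z, \<xi>). ?w \<xi> * ?F (z \<bullet> \<xi>)) \<in> borel_measurable (?M \<Otimes>\<^sub>M ?M)"
      using meas by (simp add: case_prod_beta)
    show "AE z in ?M. integrable ?M (\<lambda>\<xi>. case (z, \<xi>) of (z, \<xi>) \<Rightarrow> ?w \<xi> * ?F (z \<bullet> \<xi>))" using int1 by simp
    show "integrable ?M (\<lambda>z. LINT \<xi>|?M. norm (case (z, \<xi>) of (z, \<xi>) \<Rightarrow> ?w \<xi> * ?F (z \<bullet> \<xi>)))"
    proof (rule Bochner_Integration.integrable_bound[OF integrable_surface_measure_const[of "(LINT \<xi>|?M. \<bar>?w \<xi>\<bar> * B)"]])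
      have "(\<lambda>x. \<bar>?w (snd x) * ?F (fst x \<bullet> snd x)\<bar>) \<in> borel_measurable (?M \<Otimes>\<^sub>M ?M)"
        using meas by (rule borel_measurable_abs)
      then have "(\<lambda>z. LINT \<xi>|?M. \<bar>?w \<xi> * ?F (z \<bullet> \<xi>)\<bar>) \<in> borel_measurable ?M"
        by (intro borel_measurable_lebesgue_integral) (simp add: case_prod_beta)
      then show "(\<lambda>z. LINT \<xi>|?M. norm (case (z, \<xi>) of (z, \<xi>) \<Rightarrow> ?w \<xi> * ?F (z \<bullet> \<xi>))) \<in> borel_measurable ?M" by simp
      show "AE z in ?M. norm (LINT \<xi>|?M. norm (case (z, \<xi>) of (z, \<xi>) \<Rightarrow> ?w \<xi> * ?F (z \<bullet> \<xi>))) \<le> norm (LINT \<xi>|?M. \<bar>?w \<xi>\<bar> * B)"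
      proof (rule AE_I2)
        fix z assume z: "z \<in> space ?M"
        have "(LINT \<xi>|?M. \<bar>?w \<xi> * ?F (z \<bullet> \<xi>)\<bar>) \<le> (LINT \<xi>|?M. \<bar>?w \<xi>\<bar> * B)"
        proof (rule integral_mono[OF integrable_abs[OF int1] integrable_mult_left[OF integrable_abs[OF w]]])
          fix \<xi> :: "real^'n" assume "\<xi> \<in> space ?M"
          then show "\<bar>?w \<xi> * ?F (z \<bullet> \<xi>)\<bar> \<le> \<bar>?w \<xi>\<bar> * B"
            unfolding abs_mult using z by (intro mult_left_mono le) auto
        qed
        moreover have "0 \<le> (LINT \<xi>|?M. \<bar>?w \<xi> * ?F (z \<bullet> \<xi>)\<bar>)" by simp
        ultimately show "norm (LINT \<xi>|?M. norm (case (z, \<xi>) of (z, \<xi>) \<Rightarrow> ?w \<xi> * ?F (z \<bullet> \<xi>))) \<le> norm (LINT \<xi>|?M. \<bar>?w \<xi>\<bar> * B)"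
          by simp
      qed
    qed
  qed
  have inner: "(LINT z|?M. ?F (z \<bullet> \<xi>)) = axial_mean p ?F" if "norm \<xi> = 1" for \<xi>
    using integral_surface_measure_normalized_inner[of \<xi> ?F p] Fc that
    by (cases "\<xi> = 0") (auto simp: inner_commute)
  have V: "spherical_potential p d k h z = (LINT \<xi>|?M. ?w \<xi> * ?F (z \<bullet> \<xi>)) + C" if "norm z = 1" for z
    using that by (simp add: spherical_potential_def spherical_integral_def C_def)
  have intV: "integrable ?M (\<lambda>z. (LINT \<xi>|?M. ?w \<xi> * ?F (z \<bullet> \<xi>)) + C)"
    using P.integrable_fst'[OF int] by (intro Bochner_Integration.integrable_add integrable_surface_measure_const) simp
  then show "integrable ?M (spherical_potential p d k h)"
    by (rule Bochner_Integration.integrable_cong[THEN iffD1, rotated 2]) (auto simp: V)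
  have "(LINT z|?M. spherical_potential p d k h z) = (LINT z|?M. (LINT \<xi>|?M. ?w \<xi> * ?F (z \<bullet> \<xi>)) + C)"
    by (rule Bochner_Integration.integral_cong) (auto simp: V)
  also have "\<dots> = (LINT z|?M. (LINT \<xi>|?M. ?w \<xi> * ?F (z \<bullet> \<xi>))) + C * axial_mean p (\<lambda>_. 1)"
    using P.integrable_fst'[OF int] by (simp add: axial_mean_def integrable_surface_measure_const)
  also have "(LINT z|?M. (LINT \<xi>|?M. ?w \<xi> * ?F (z \<bullet> \<xi>))) = (LINT \<xi>|?M. (LINT z|?M. ?w \<xi> * ?F (z \<bullet> \<xi>)))"
    using P.Fubini_integral[OF int] by simp
  also have "\<dots> = (LINT \<xi>|?M. ?w \<xi> * axial_mean p ?F)"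
    by (rule Bochner_Integration.integral_cong) (auto simp: inner)
  also have "\<dots> = axial_mean p (kernel_weight d) * axial_mean p ?F" by (simp add: axial_mean_def)
  also have "axial_mean p ?F = (\<Prod>i<k. radial_eigenvalue CARD('n) d i) * axial_mean p h"
    by (rule axial_mean_laplacian_product[OF h])
  also have "axial_mean p (kernel_weight d) * ((\<Prod>i<k. radial_eigenvalue CARD('n) d i) * axial_mean p h) + C * axial_mean p (\<lambda>_. 1)
      = axial_mean p h * axial_value p d k (\<lambda>_. 1)"
    using axial_mean_cmult[of p "\<Prod>i<k. radial_eigenvalue CARD('n) d i" "kernel_weight d"]
    by (simp add: axial_value_def laplacian_product_const C_def algebra_simps)
  finally show "(LINT z|?M. spherical_potential p d k h z) = axial_mean p h * axial_value p d k (\<lambda>_. 1)" .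
qed

text \<open>Unites both parities: \<open>d = 1\<close> and \<open>k = (n - 3) / 2\<close> for odd
  \<open>n\<close>, \<open>d = 0\<close> and \<open>k = (n - 4) / 2\<close> for even
  \<open>n\<close>. The pole is put at \<open>x = 0\<close>, where \<open>x - y = - y\<close> enters
  through an absolute value. \<open>Q\<close> is prescribed on the unit sphere, where the integral
  lives.\<close>

lemma john_fundamental_solution_axial:
  assumes "CARD('n::finite) \<ge> 6"
  obtains c d :: real and k :: nat where "0 < c" "d = 0 \<or> d = 1" "0 < k" "2 * real k = real CARD('n) - 4 + d"
    "\<And>(p::'n) f Q y. smooth f \<Longrightarrow> (\<And>\<xi>. norm \<xi> = 1 \<Longrightarrow> Q \<xi> = inverse (f (\<xi> $ p))) \<Longrightarrow> y \<noteq> 0 \<Longrightarrow>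
       john_fundamental_solution 2 Q 0 y = - c * norm y powr (d - 2 * real k) * ((-1) ^ k * spherical_potential p d k f y)"
proof (cases "odd CARD('n)")
  case True
  then obtain m where m: "CARD('n) = 2 * m + 1" by (auto elim: oddE)
  define k where "k = (CARD('n) + 1 - 2 * 2) div 2"
  have k: "k = m - 1" by (simp add: k_def m)
  show ?thesis
  proof (rule that[of "1 / (4 * (2 * pi) ^ (CARD('n) - 1))" 1 k])
    show "0 < k" using assms m k by simp
    show "2 * real k = real CARD('n) - 4 + 1" using assms m k by simp
    fix p :: 'n and f and Q :: "real^'n \<Rightarrow> real" and y :: "real^'n"
    assume f: "smooth f" and Q: "\<And>\<xi>. norm \<xi> = 1 \<Longrightarrow> Q \<xi> = inverse (f (\<xi> $ p))" and y: "y \<noteq> 0"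
    define u where "u y = (LINT \<xi>:sphere 0 1|hausdorff_measure (CARD('n) - 1). \<bar>(0 - y) \<bullet> \<xi>\<bar> / Q \<xi>)" for y
    have "u z = norm z * spherical_integral p 1 f z" if "z \<noteq> 0" for z
    proof -
      have "u z = (LINT \<xi>|surface_measure. \<bar>(0 - z) \<bullet> \<xi>\<bar> / Q \<xi>)"
        unfolding u_def using set_integral_sphere_eq[where 'a = "real^'n"] by simp
      also have "\<dots> = (LINT \<xi>|surface_measure. \<bar>z \<bullet> \<xi>\<bar> * f (\<xi> $ p))"
        by (rule Bochner_Integration.integral_cong) (auto simp: Q divide_inverse)
      finally show ?thesis using spherical_integral_kernel(1)[OF smooth_continuous[OF f] that] by simp
    qed
    then have "(neg_laplacian ^^ k) u y = (-1) ^ k * (norm y powr (1 - 2 * real k) * spherical_potential p 1 k f y)"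
      using \<open>0 < k\<close> by (intro funpow_neg_laplacian_kernel[OF f y]) auto
    moreover have "john_fundamental_solution 2 Q 0 y = - (1 / (4 * (2 * pi) ^ (CARD('n) - 1))) * (neg_laplacian ^^ k) u y"
      unfolding john_fundamental_solution_def u_def[abs_def] k_def using True by simp
    ultimately show "john_fundamental_solution 2 Q 0 y =
        - (1 / (4 * (2 * pi) ^ (CARD('n) - 1))) * norm y powr (1 - 2 * real k) * ((-1) ^ k * spherical_potential p 1 k f y)"
      by (simp only:) (simp only: mult_ac)
  qed simp_all
next
  case False
  then obtain m where m: "CARD('n) = 2 * m" by (auto elim: evenE)
  define k where "k = (CARD('n) - 2 * 2) div 2"
  have k: "k = m - 2" by (simp add: k_def m)
  show ?thesis
  proof (rule that[of "1 / (2 * pi) ^ CARD('n)" 0 k])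
    show "0 < k" using assms m k by simp
    show "2 * real k = real CARD('n) - 4 + 0" using assms m k by simp
    fix p :: 'n and f and Q :: "real^'n \<Rightarrow> real" and y :: "real^'n"
    assume f: "smooth f" and Q: "\<And>\<xi>. norm \<xi> = 1 \<Longrightarrow> Q \<xi> = inverse (f (\<xi> $ p))" and y: "y \<noteq> 0"
    define u where "u y = (LINT \<xi>:sphere 0 1|hausdorff_measure (CARD('n) - 1). ln \<bar>(0 - y) \<bullet> \<xi>\<bar> / Q \<xi>)" for y
    have "u z = spherical_integral p 0 f z + axial_mean p f * ln (norm z)" if "z \<noteq> 0" for z
    proof -
      have "u z = (LINT \<xi>|surface_measure. ln \<bar>(0 - z) \<bullet> \<xi>\<bar> / Q \<xi>)"
        unfolding u_def using set_integral_sphere_eq[where 'a = "real^'n"] by simp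
      also have "\<dots> = (LINT \<xi>|surface_measure. ln \<bar>z \<bullet> \<xi>\<bar> * f (\<xi> $ p))"
        by (rule Bochner_Integration.integral_cong) (auto simp: Q divide_inverse)
      finally show ?thesis using spherical_integral_kernel(2)[OF smooth_continuous[OF f] that] by simp
    qed
    then have "(neg_laplacian ^^ k) u y = (-1) ^ k * (norm y powr (0 - 2 * real k) * spherical_potential p 0 k f y)"
      using \<open>0 < k\<close> by (intro funpow_neg_laplacian_kernel[OF f y]) auto
    moreover have "john_fundamental_solution 2 Q 0 y = - (1 / (2 * pi) ^ CARD('n)) * (neg_laplacian ^^ k) u y"
      unfolding john_fundamental_solution_def u_def[abs_def] k_def using False by simp
    ultimately show "john_fundamental_solution 2 Q 0 y =
        - (1 / (2 * pi) ^ CARD('n)) * norm y powr (0 - 2 * real k) * ((-1) ^ k * spherical_potential p 0 k f y)"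
      by (simp only:) (simp only: mult_ac)
  qed simp_all
qed

section \<open>The quartic form as an elliptic symbol\<close>

definition quartic_form :: "real \<Rightarrow> 'n::finite \<Rightarrow> real^'n \<Rightarrow> real" where
  "quartic_form \<theta> p \<xi> = (\<xi> $ p) ^ 4 + 2 * cos \<theta> * (\<xi> $ p)\<^sup>2 * ((norm \<xi>)\<^sup>2 - (\<xi> $ p)\<^sup>2) + ((norm \<xi>)\<^sup>2 - (\<xi> $ p)\<^sup>2)\<^sup>2"

text \<open>Coefficient families may be asymmetric, so a form in the squares of the coordinates can
  be supported on the lists \<open>[i, i, j, j]\<close>; positions 0 and 2 recover \<open>i\<close>
  and \<open>j\<close>.\<close>

lemma symbol_poly_biquadratic:
  fixes B :: "'n::finite \<Rightarrow> 'n \<Rightarrow> real"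
  defines "A is \<equiv> (if \<exists>i j. is = [i, i, j, j] then B (is ! 0) (is ! 2) else 0)"
  shows "symbol_poly 2 A \<xi> = (\<Sum>i\<in>UNIV. \<Sum>j\<in>UNIV. B i j * ((\<xi> $ i)\<^sup>2 * (\<xi> $ j)\<^sup>2))"
proof -
  let ?f = "\<lambda>(i, j). [i, i, j, j] :: 'n list"
  let ?t = "\<lambda>is. A is * (\<Prod>i\<leftarrow>is. \<xi> $ i)"
  have "finite {is :: 'n list. length is = 2 * 2}"
    using finite_lists_length_eq[of "UNIV :: 'n set" "2 * 2"] by simp
  then have "symbol_poly 2 A \<xi> = sum ?t (?f ` (UNIV \<times> UNIV))"
    unfolding symbol_poly_def by (intro sum.mono_neutral_right) (auto simp: A_def)
  also have "\<dots> = (\<Sum>x\<in>UNIV \<times> UNIV. ?t (?f x))"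
    by (subst sum.reindex) (auto simp: inj_on_def)
  also have "\<dots> = (\<Sum>(i, j)\<in>UNIV \<times> UNIV. B i j * ((\<xi> $ i)\<^sup>2 * (\<xi> $ j)\<^sup>2))"
    by (intro sum.cong) (auto simp: A_def power2_eq_square)
  finally show ?thesis by (simp only: sum.cartesian_product)
qed

lemma quartic_form_symbol:
  fixes p :: "'n::finite"
  shows "\<exists>L. operator_with_symbol 2 L (quartic_form \<theta> p)"
proof -
  \<comment> \<open>Pairs with exactly one index equal to \<open>p\<close> occur in both orders,
    which accounts for the coefficient \<open>2 cos \<theta>\<close> of the form.\<close>
  define B where "B i j = (if (i = p) = (j = p) then 1 else cos \<theta>)" for i j
  have "(\<Sum>i\<in>UNIV. \<Sum>j\<in>UNIV. B i j * ((\<xi> $ i)\<^sup>2 * (\<xi> $ j)\<^sup>2)) = quartic_form \<theta> p \<xi>" for \<xi> :: "real^'n"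
  proof -
    let ?a = "\<lambda>i. if i = p then (\<xi> $ i)\<^sup>2 else 0" and ?b = "\<lambda>i. if i = p then 0 else (\<xi> $ i)\<^sup>2"
    have a: "(\<Sum>i\<in>UNIV. ?a i) = (\<xi> $ p)\<^sup>2" by simp
    have "(\<Sum>i\<in>UNIV. ?a i) + (\<Sum>i\<in>UNIV. ?b i) = (\<Sum>i\<in>UNIV. (\<xi> $ i)\<^sup>2)"
      unfolding sum.distrib[symmetric] by (rule sum.cong) auto
    also have "\<dots> = (norm \<xi>)\<^sup>2"
      unfolding power2_norm_eq_inner by (simp add: inner_vec_def power2_eq_square)
    finally have b: "(\<Sum>i\<in>UNIV. ?b i) = (norm \<xi>)\<^sup>2 - (\<xi> $ p)\<^sup>2" unfolding a by simp
    have "(\<Sum>i\<in>UNIV. \<Sum>j\<in>UNIV. B i j * ((\<xi> $ i)\<^sup>2 * (\<xi> $ j)\<^sup>2)) =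
        (\<Sum>i\<in>UNIV. \<Sum>j\<in>UNIV. ?a i * ?a j + cos \<theta> * (?a i * ?b j) + cos \<theta> * (?b i * ?a j) + ?b i * ?b j)"
      by (intro sum.cong) (auto simp: B_def)
    also have "\<dots> = (\<Sum>i\<in>UNIV. ?a i) * (\<Sum>j\<in>UNIV. ?a j) + cos \<theta> * ((\<Sum>i\<in>UNIV. ?a i) * (\<Sum>j\<in>UNIV. ?b j))
        + cos \<theta> * ((\<Sum>i\<in>UNIV. ?b i) * (\<Sum>j\<in>UNIV. ?a j)) + (\<Sum>i\<in>UNIV. ?b i) * (\<Sum>j\<in>UNIV. ?b j)"
      by (simp only: sum.distrib sum_distrib_left[symmetric] sum_distrib_right[symmetric])
    also have "\<dots> = quartic_form \<theta> p \<xi>"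
      unfolding a b quartic_form_def by (simp add: power2_eq_square power4_eq_xxxx algebra_simps)
    finally show ?thesis .
  qed
  then have "quartic_form \<theta> p = symbol_poly 2 (\<lambda>is. if \<exists>i j. is = [i, i, j, j] then B (is ! 0) (is ! 2) else 0)"
    by (intro ext) (simp only: symbol_poly_biquadratic)
  then show ?thesis unfolding operator_with_symbol_def by blast
qed

lemma quartic_form_elliptic:
  fixes p :: "'n::finite"
  assumes "\<theta> \<in> {-pi<..<pi}"
  shows "uniformly_elliptic 2 (quartic_form \<theta> p)"
  unfolding uniformly_elliptic_def
\<comment> \<open>The constant is \<open>1 - 2 (1 - cos \<theta>) / 4\<close>, obtained from
  \<open>s (P - s) \<le> P\<^sup>2 / 4\<close>; it tends to 0 as \<open>\<theta>\<close> approaches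
  \<open>\<pi>\<close>.\<close>
proof (intro exI[of _ "(1 + cos \<theta>) / 2"] conjI allI)
  show "0 < (1 + cos \<theta>) / 2" using cos_gt_minus_one[OF assms] by simp
  fix \<xi> :: "real^'n"
  define s where "s = (\<xi> $ p)\<^sup>2"
  define P where "P = (norm \<xi>)\<^sup>2"
  have "0 \<le> (2 * s - P)\<^sup>2" by simp
  then have "s * (P - s) \<le> P\<^sup>2 / 4" by (simp add: power2_eq_square algebra_simps)
  then have le: "2 * (1 - cos \<theta>) * (s * (P - s)) \<le> 2 * (1 - cos \<theta>) * (P\<^sup>2 / 4)"
    by (intro mult_left_mono) auto
  have "norm \<xi> ^ (2 * 2) = P\<^sup>2" unfolding P_def by (rule power_mult)
  then have "(1 + cos \<theta>) / 2 * norm \<xi> ^ (2 * 2) = P\<^sup>2 - 2 * (1 - cos \<theta>) * (P\<^sup>2 / 4)"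
    by (simp add: field_simps)
  also have "\<dots> \<le> P\<^sup>2 - 2 * (1 - cos \<theta>) * (s * (P - s))" by (rule diff_left_mono[OF le])
  also have "\<dots> = s\<^sup>2 + 2 * cos \<theta> * s * (P - s) + (P - s)\<^sup>2"
    by (simp add: power2_eq_square algebra_simps)
  also have "\<dots> = quartic_form \<theta> p \<xi>"
    unfolding quartic_form_def s_def P_def by (simp flip: power_mult)
  finally show "(1 + cos \<theta>) / 2 * norm \<xi> ^ (2 * 2) \<le> quartic_form \<theta> p \<xi>" .
qed

lemma quartic_form_sphere: "norm \<xi> = 1 \<Longrightarrow> quartic_form \<theta> p \<xi> = quartic \<theta> (\<xi> $ p)"
  by (simp add: quartic_form_def quartic_def)

theorem theorem1p1:
  assumes "CARD('n::finite) \<ge> 6"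
  shows "\<exists>(L :: (real^'n \<Rightarrow> real) \<Rightarrow> real^'n \<Rightarrow> real) (Q :: real^'n \<Rightarrow> real).
           operator_with_symbol 2 L Q \<and> uniformly_elliptic 2 Q \<and>
           sign_changing_at_pole (john_fundamental_solution 2 Q)"
proof -
  obtain c d :: real and k :: nat where c: "0 < c" and d: "d = 0 \<or> d = 1" and k: "0 < k" "2 * real k = real CARD('n) - 4 + d"
    and john: "\<And>(p::'n) f Q y. smooth f \<Longrightarrow> (\<And>\<xi>. norm \<xi> = 1 \<Longrightarrow> Q \<xi> = inverse (f (\<xi> $ p))) \<Longrightarrow> y \<noteq> 0 \<Longrightarrow>
       john_fundamental_solution 2 Q 0 y = - c * norm y powr (d - 2 * real k) * ((-1) ^ k * spherical_potential p d k f y)"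
    using john_fundamental_solution_axial[OF assms] by blast
  fix p :: 'n
  define \<omega> where "\<omega> = (real CARD('n) - 3) / 2"
  define \<theta> where "\<theta> = 4 * pi / (3 * \<omega>)"
  define f where "f t = inverse (quartic \<theta> t)" for t
  let ?A = "axial_value p d k (\<lambda>_. 1)"
  let ?V = "\<lambda>z. (-1) ^ k * spherical_potential p d k f z"
  \<comment> \<open>With \<open>n \<ge> 6\<close> the angle stays at or below
    \<open>8 \<pi> / 9\<close>, so the form remains elliptic.\<close>
  have \<omega>: "3 / 2 \<le> \<omega>" using assms by (simp add: \<omega>_def)
  then have "\<theta> \<le> 4 * pi / (3 * (3 / 2))" unfolding \<theta>_def by (intro divide_left_mono) auto
  also have "4 * pi / (3 * (3 / 2)) < pi" using pi_gt_zero by simp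
  finally have \<theta>: "0 < \<theta>" "\<theta> < pi" using \<omega> by (simp_all add: \<theta>_def)
  then have \<theta>': "\<theta> \<in> {-pi<..<pi}" by simp
  have f: "smooth f"
    unfolding f_def[abs_def] by (rule smooth_trig_rational[OF trig_rational.inv \<theta>'])
  have fpos: "0 < f t" for t using quartic_pos[OF \<theta>'] by (simp add: f_def)
  have n2: "CARD('n) \<ge> 2" using assms by simp
  have A: "(-1) ^ k * ?A < 0" by (rule axial_value_1_sign[OF d k n2])
  have K: "john_fundamental_solution 2 (quartic_form \<theta> p) 0 (r *\<^sub>R z) = - (c * norm (r *\<^sub>R z) powr (d - 2 * real k)) * ?V z"
    if "0 < r" "z \<noteq> 0" for r z
    using that john[of f "quartic_form \<theta> p" p "r *\<^sub>R z", OF f] by (simp add: quartic_form_sphere f_def spherical_potential_scale)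
  \<comment> \<open>The fundamental solution is a negative multiple of \<open>?V\<close>, so this is
    its negativity on the axis. The two negative factors are the value for
    \<open>(-\<Delta>)\<^sup>2\<close> and \<open>sin (\<omega> \<theta>)\<close>.\<close>
  have neg: "0 < ?V (axis p 1)"
  proof -
    have "\<omega> * \<theta> = pi / 3 + pi" using \<omega> by (simp add: \<theta>_def)
    then have "sin (\<omega> * \<theta>) = - sin (pi / 3)" by (simp only: sin_periodic_pi)
    then have sin: "sin (\<omega> * \<theta>) < 0" by (simp add: sin_60)
    have "sin \<theta> * axial_value p d k f = ?A * sin (\<omega> * \<theta>) / \<omega>"
      unfolding f_def[abs_def] \<omega>_def using axial_value_quartic[OF d k _ \<theta>', of p] assms by simp
    then have "sin \<theta> * ?V (axis p 1) = ((-1) ^ k * ?A) * sin (\<omega> * \<theta>) / \<omega>"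
      by (simp add: spherical_potential_axis mult.left_commute[of _ "(-1) ^ k"])
    also have "\<dots> > 0" using A sin \<omega> by (intro divide_pos_pos mult_neg_neg) auto
    finally show ?thesis using sin_gt_zero[OF \<theta>] by (simp add: zero_less_mult_iff)
  qed
  \<comment> \<open>If \<open>?V\<close> were nonnegative on the sphere, its integral would be too;
    but that integral is the positive mean of \<open>f\<close> times the negative value for
    \<open>(-\<Delta>)\<^sup>2\<close>.\<close>
  have "\<exists>z. norm z = 1 \<and> ?V z < 0"
  proof (rule ccontr)
    assume "\<not> ?thesis"
    then have "0 \<le> ?V z" if "norm z = 1" for z using that by (meson not_le)
    then have "0 \<le> (LINT z|surface_measure. ?V z)"
      by (intro Bochner_Integration.integral_nonneg_AE AE_I2) auto
    also have "\<dots> = (-1) ^ k * (axial_mean p f * ?A)"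
      by (simp add: spherical_potential_mean(1)[OF f n2])
    also have "\<dots> = axial_mean p f * ((-1) ^ k * ?A)" by simp
    also have "\<dots> < 0"
    proof (rule mult_pos_neg[OF _ A])
      have "\<exists>t0\<in>{-1..1}. \<forall>t\<in>{-1..1}. f t0 \<le> f t"
        by (intro continuous_attains_inf smooth_continuous f) auto
      then obtain t0 where t0: "\<And>t. t \<in> {-1..1} \<Longrightarrow> f t0 \<le> f t" by blast
      then have "axial_mean p (\<lambda>_. f t0) \<le> axial_mean p f"
        unfolding axial_mean_def
        by (intro integral_mono integrable_surface_measure_const integrable_axial smooth_continuous f)
          (intro t0 coord_in_unit, simp)
      moreover have "0 < axial_mean p (\<lambda>_. f t0)"
        using measure_surface_measure_pos[where 'a = "real^'n"] n2 fpos by (simp add: axial_mean_def)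
      ultimately show "0 < axial_mean p f" by linarith
    qed
    finally show False by simp
  qed
  then obtain z0 where z0: "norm z0 = 1" "?V z0 < 0" by blast
  have "sign_changing_at_pole (john_fundamental_solution 2 (quartic_form \<theta> p))"
    unfolding sign_changing_at_pole_def
  proof (intro allI impI conjI)
    fix r :: real assume "r > 0"
    have dist: "0 < dist 0 ((r / 2) *\<^sub>R z)" "dist 0 ((r / 2) *\<^sub>R z) < r" if "norm z = 1" for z :: "real^'n"
      using \<open>r > 0\<close> that by (auto simp: dist_norm)
    have pos: "0 < c * norm ((r / 2) *\<^sub>R z) powr (d - 2 * real k)" if "norm z = 1" for z :: "real^'n"
      using c \<open>r > 0\<close> that by (intro mult_pos_pos) auto
    have "john_fundamental_solution 2 (quartic_form \<theta> p) 0 ((r / 2) *\<^sub>R z0) > 0"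
      using \<open>r > 0\<close> z0 by (subst K) (auto intro!: mult_pos_neg pos simp del: norm_scaleR)
    then show "\<exists>x y. 0 < dist x y \<and> dist x y < r \<and> john_fundamental_solution 2 (quartic_form \<theta> p) x y > 0"
      using dist[OF z0(1)] by blast
    have "norm (axis p 1 :: real^'n) = 1" by (simp add: norm_axis_1)
    moreover from this have "john_fundamental_solution 2 (quartic_form \<theta> p) 0 ((r / 2) *\<^sub>R axis p 1) < 0"
      using \<open>r > 0\<close> neg by (subst K) (auto intro!: mult_pos_pos pos simp del: norm_scaleR simp: axis_eq_0_iff)
    ultimately show "\<exists>x y. 0 < dist x y \<and> dist x y < r \<and> john_fundamental_solution 2 (quartic_form \<theta> p) x y < 0"
      using dist by blast
  qed
  then show ?thesis
    using quartic_form_symbol[of \<theta> p] quartic_form_elliptic[OF \<theta>', of p] by blast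
qed

end
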